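(* Let $M$ be a correspondence over a $C^*$-algebra $A$, let $Y$ be a right Hilbert $A$-module, and let $T:Y\to Y\otimes_A M$ be inner-product preserving and adjointable. Put $T_k:=T\otimes\mathrm{id}_k:Y\otimes_A M^{\otimes k}\to Y\otimes_A M^{\otimes(k+1)}$, let $(Y_\infty,\iota^k)=\varinjlim(Y\otimes_A M^{\otimes k},T_k)$, let $Y_k:=\iota^k(Y\otimes_A M^{\otimes k})\subset Y_\infty$, and let $R:Y_\infty\to Y_\infty\otimes_A M$ be the Hilbert-module isomorphism satisfying $R\circ\iota^{k+1}=\iota^k\otimes\mathrm{id}$ for all $k\ge0$. For $k\ge 0$ let $Z_k:=Y_{k+1}\ominus Y_k$ be the complement of $Y_k$ in $Y_{k+1}$. Then there is a natural Hilbert-module direct-sum decomposition $$Y_\infty=Y_0\oplus\Big(\bigoplus_{k=0}^\infty Z_k\Big),$$ that is, $(y,\{z_k\})\mapsto y+\sum_k z_k$ is a well-defined Hilbert-module isomorphism of the Hilbert-module direct sum $Y_0\oplus\bigoplus_{k=0}^\infty Z_k$ onto $Y_\infty$; and for each $k$ the isomorphism $R^k:Y_\infty\to Y_\infty\otimes_A M^{\otimes k}$ induced by $R$ restricts to an isomorphism of $Z_k$ onto $Z_0\otimes_A M^{\otimes k}$.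
   Context: All Hilbert modules are right Hilbert $A$-modules, with inner product $A$-linear in the second variable. A correspondence over $A$ is a right Hilbert $A$-module $M$ with a left action of $A$ given by a $*$-homomorphism $A\to\mathcal L(M)$ into the adjointable operators. A map is inner-product preserving if $\langle Tx,Ty\rangle=\langle x,y\rangle$; a Hilbert-module isomorphism is a surjective inner-product preserving map. $X\otimes_A M$ is the internal (balanced) tensor product, with $\langle x\otimes m,y\otimes n\rangle=\langle m,\langle x,y\rangle\cdot n\rangle$; $M^{\otimes k}$ is the $k$-fold internal tensor power, $\mathrm{id}_k$ its identity map, and $Y\otimes_A M^{\otimes 0}$ means $Y$. For $S$ adjointable or inner-product preserving, $S\otimes\mathrm{id}$ is the bounded map with $(S\otimes\mathrm{id})(x\otimes m)=(Sx)\otimes m$. For a closed submodule $X_0\subset X$, $X_0\otimes_A M^{\otimes k}$ is regarded as a submodule of $X\otimes_A M^{\otimes k}$. A closed submodule $N$ of $X$ is complemented if $(m,n)\mapsto m+n$ is an isomorphism of $N\oplus N^\perp$ onto $X$; then $X\ominus N:=N^\perp$. It is known that in this setting an isomorphism $R$ as described exists (and is uniquely determined), and that each $Y_k$ is complemented in $Y_{k+1}$. The powers of $R$ are defined by $R^0=\mathrm{id}$, $R^1=R$, $R^{k+1}=(R\otimes\mathrm{id}_k)\circ R^k:Y_\infty\to Y_\infty\otimes_A M^{\otimes(k+1)}$. $\varinjlim(X_k,T_k)$, for inner-product preserving $T_k:X_k\to X_{k+1}$, is the Hilbert-module direct limit: the completion $X_\infty$ of the quotient of $\bigsqcup_kX_k$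 in which $x\in X_k$ is identified with $T_kx\in X_{k+1}$, with $\iota^k:X_k\to X_\infty$ the canonical inner-product preserving maps, so that $\iota^{k+1}\circ T_k=\iota^k$ and $\bigcup_k\iota^k(X_k)$ is dense. The Hilbert-module direct sum $Y_0\oplus\bigoplus_k Z_k$ consists of the $(y,\{z_k\})$ with $y\in Y_0$, $z_k\in Z_k$ and $\sum_k\langle z_k,z_k\rangle$ norm-convergent in $A$, with inner product $\langle (y,\{z_k\}),(y',\{z'_k\})\rangle=\langle y,y'\rangle+\sum_k\langle z_k,z_k'\rangle$. *)

theory Defs
  imports "HOL-Analysis.Analysis" "HOL-Library.FuncSet" "HOL-Library.Function_Algebras"
begin

class cstar_algebra = real_normed_algebra + banach +
  fixes scaleC :: "complex \<Rightarrow> 'a \<Rightarrow> 'a" (infixr "*\<^sub>C" 75)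
    and star :: "'a \<Rightarrow> 'a"
  assumes scaleC_of_real: "complex_of_real r *\<^sub>C a = r *\<^sub>R a"
    and scaleC_add_right: "c *\<^sub>C (a + b) = c *\<^sub>C a + c *\<^sub>C b"
    and scaleC_add_left: "(c + d) *\<^sub>C a = c *\<^sub>C a + d *\<^sub>C a"
    and scaleC_scaleC: "c *\<^sub>C (d *\<^sub>C a) = (c * d) *\<^sub>C a"
    and mult_scaleC_left: "(c *\<^sub>C a) * b = c *\<^sub>C (a * b)"
    and mult_scaleC_right: "a * (c *\<^sub>C b) = c *\<^sub>C (a * b)"
    and norm_scaleC: "norm (c *\<^sub>C a) = cmod c * norm a"
    and star_star: "star (star a) = a"
    and star_add: "star (a + b) = star a + star b"
    and star_scaleC: "star (c *\<^sub>C a) = cnj c *\<^sub>C star a"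
    and star_mult: "star (a * b) = star b * star a"
    and cstar_identity: "norm (star a * a) = (norm a)\<^sup>2"

definition cstar_positive :: "'a::cstar_algebra \<Rightarrow> bool" where
  "cstar_positive a \<longleftrightarrow> (\<exists>b. a = star b * b)"

text \<open>A module is a subset \<open>carr\<close> of an additive group type. Addition is that of the type; the
  complex scalars, the right action of the algebra and the inner product are part of the
  structure. This is no restriction: a Hilbert module \<open>X\<close> embeds additively into the functions
  from \<open>X\<close> to the algebra by sending \<open>x\<close> to the function \<open>\<langle>\<cdot>, x\<rangle>\<close>, and a sequence of modules
  embeds into its product.\<close>

record ('a, 'x) hmod =
  carr :: "'x set"
  scal :: "complex \<Rightarrow> 'x \<Rightarrow> 'x"
  act :: "'x \<Rightarrow> 'a \<Rightarrow> 'x"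
  ip :: "'x \<Rightarrow> 'x \<Rightarrow> 'a"

definition hnorm :: "('a::cstar_algebra, 'x, 'b) hmod_scheme \<Rightarrow> 'x \<Rightarrow> real" where
  "hnorm X x = sqrt (norm (ip X x x))"

definition hm_lim ::
    "('a::cstar_algebra, 'x::ab_group_add, 'b) hmod_scheme \<Rightarrow> (nat \<Rightarrow> 'x) \<Rightarrow> 'x \<Rightarrow> bool" where
  "hm_lim X f x \<longleftrightarrow> x \<in> carr X \<and> (\<lambda>n. hnorm X (f n - x)) \<longlonglongrightarrow> 0"

definition hm_Cauchy ::
    "('a::cstar_algebra, 'x::ab_group_add, 'b) hmod_scheme \<Rightarrow> (nat \<Rightarrow> 'x) \<Rightarrow> bool" where
  "hm_Cauchy X f \<longleftrightarrow> (\<forall>e>0. \<exists>N. \<forall>m\<ge>N. \<forall>n\<ge>N. hnorm X (f m - f n) < e)"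

definition hm_sums ::
    "('a::cstar_algebra, 'x::ab_group_add, 'b) hmod_scheme \<Rightarrow> (nat \<Rightarrow> 'x) \<Rightarrow> 'x \<Rightarrow> bool" where
  "hm_sums X f s \<longleftrightarrow> hm_lim X (\<lambda>n. \<Sum>i<n. f i) s"

definition hm_suminf ::
    "('a::cstar_algebra, 'x::ab_group_add, 'b) hmod_scheme \<Rightarrow> (nat \<Rightarrow> 'x) \<Rightarrow> 'x" where
  "hm_suminf X f = (THE s. hm_sums X f s)"

definition hm_closure ::
    "('a::cstar_algebra, 'x::ab_group_add, 'b) hmod_scheme \<Rightarrow> 'x set \<Rightarrow> 'x set" where
  "hm_closure X S = {x \<in> carr X. \<forall>e>0. \<exists>s\<in>S. hnorm X (x - s) < e}"

locale hilbert_module =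
  fixes X :: "('a::cstar_algebra, 'x::ab_group_add, 'b) hmod_scheme"
  assumes zero_closed: "0 \<in> carr X"
    and add_closed: "\<lbrakk>x \<in> carr X; y \<in> carr X\<rbrakk> \<Longrightarrow> x + y \<in> carr X"
    and uminus_closed: "x \<in> carr X \<Longrightarrow> - x \<in> carr X"
    and scal_closed: "x \<in> carr X \<Longrightarrow> scal X c x \<in> carr X"
    and act_closed: "x \<in> carr X \<Longrightarrow> act X x a \<in> carr X"
    and scal_one: "x \<in> carr X \<Longrightarrow> scal X 1 x = x"
    and scal_scal: "x \<in> carr X \<Longrightarrow> scal X c (scal X d x) = scal X (c * d) x"
    and scal_add_left: "x \<in> carr X \<Longrightarrow> scal X (c + d) x = scal X c x + scal X d x"
    and scal_add_right:
      "\<lbrakk>x \<in> carr X; y \<in> carr X\<rbrakk> \<Longrightarrow> scal X c (x + y) = scal X c x + scal X c y"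
    and act_add_left:
      "\<lbrakk>x \<in> carr X; y \<in> carr X\<rbrakk> \<Longrightarrow> act X (x + y) a = act X x a + act X y a"
    and act_add_right: "x \<in> carr X \<Longrightarrow> act X x (a + b) = act X x a + act X x b"
    and act_mult: "x \<in> carr X \<Longrightarrow> act X x (a * b) = act X (act X x a) b"
    and act_scal: "x \<in> carr X \<Longrightarrow> act X (scal X c x) a = scal X c (act X x a)"
    and act_scaleC: "x \<in> carr X \<Longrightarrow> act X x (c *\<^sub>C a) = scal X c (act X x a)"
    and ip_add: "\<lbrakk>x \<in> carr X; y \<in> carr X; z \<in> carr X\<rbrakk> \<Longrightarrow> ip X x (y + z) = ip X x y + ip X x z"
    and ip_scal: "\<lbrakk>x \<in> carr X; y \<in> carr X\<rbrakk> \<Longrightarrow> ip X x (scal X c y) = c *\<^sub>C ip X x y"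
    and ip_act: "\<lbrakk>x \<in> carr X; y \<in> carr X\<rbrakk> \<Longrightarrow> ip X x (act X y a) = ip X x y * a"
    and ip_star: "\<lbrakk>x \<in> carr X; y \<in> carr X\<rbrakk> \<Longrightarrow> ip X y x = star (ip X x y)"
    and ip_positive: "x \<in> carr X \<Longrightarrow> cstar_positive (ip X x x)"
    and ip_definite: "\<lbrakk>x \<in> carr X; ip X x x = 0\<rbrakk> \<Longrightarrow> x = 0"
    and complete: "\<lbrakk>\<And>n. f n \<in> carr X; hm_Cauchy X f\<rbrakk> \<Longrightarrow> \<exists>x. hm_lim X f x"

definition ip_preserving ::
    "('a, 'x, 'b) hmod_scheme \<Rightarrow> ('a, 'y, 'c) hmod_scheme \<Rightarrow> ('x \<Rightarrow> 'y) \<Rightarrow> bool" where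
  "ip_preserving X Y S \<longleftrightarrow> S \<in> carr X \<rightarrow> carr Y \<and>
    (\<forall>x\<in>carr X. \<forall>y\<in>carr X. ip Y (S x) (S y) = ip X x y)"

definition hm_iso ::
    "('a, 'x, 'b) hmod_scheme \<Rightarrow> ('a, 'y, 'c) hmod_scheme \<Rightarrow> ('x \<Rightarrow> 'y) \<Rightarrow> bool" where
  "hm_iso X Y S \<longleftrightarrow> ip_preserving X Y S \<and> S ` carr X = carr Y"

definition is_adjoint ::
    "('a, 'x, 'b) hmod_scheme \<Rightarrow> ('a, 'y, 'c) hmod_scheme \<Rightarrow> ('x \<Rightarrow> 'y) \<Rightarrow> ('y \<Rightarrow> 'x) \<Rightarrow> bool" where
  "is_adjoint X Y S S' \<longleftrightarrow> S \<in> carr X \<rightarrow> carr Y \<and> S' \<in> carr Y \<rightarrow> carr X \<and>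
    (\<forall>x\<in>carr X. \<forall>y\<in>carr Y. ip Y (S x) y = ip X x (S' y))"

definition adjointable ::
    "('a, 'x, 'b) hmod_scheme \<Rightarrow> ('a, 'y, 'c) hmod_scheme \<Rightarrow> ('x \<Rightarrow> 'y) \<Rightarrow> bool" where
  "adjointable X Y S \<longleftrightarrow> (\<exists>S'. is_adjoint X Y S S')"

definition hm_bounded_linear ::
    "('a::cstar_algebra, 'x::ab_group_add, 'b) hmod_scheme \<Rightarrow>
     ('a, 'y::ab_group_add, 'c) hmod_scheme \<Rightarrow> ('x \<Rightarrow> 'y) \<Rightarrow> bool" where
  "hm_bounded_linear X Y S \<longleftrightarrow> S \<in> carr X \<rightarrow> carr Y \<and>
    (\<forall>x\<in>carr X. \<forall>y\<in>carr X. S (x + y) = S x + S y) \<and>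
    (\<forall>x\<in>carr X. \<forall>c. S (scal X c x) = scal Y c (S x)) \<and>
    (\<exists>C. \<forall>x\<in>carr X. hnorm Y (S x) \<le> C * hnorm X x)"

definition submod :: "('a, 'x) hmod \<Rightarrow> 'x set \<Rightarrow> ('a, 'x) hmod" where
  "submod X S = X\<lparr>carr := S\<rparr>"

definition hm_ominus :: "('a::zero, 'x) hmod \<Rightarrow> ('a, 'x) hmod \<Rightarrow> ('a, 'x) hmod" (infixl "\<ominus>\<^sub>H" 65) where
  "X \<ominus>\<^sub>H N = submod X {x \<in> carr X. \<forall>n\<in>carr N. ip X n x = 0}"

definition hm_direct_sum ::
    "('a::cstar_algebra, 'y::ab_group_add) hmod \<Rightarrow> (nat \<Rightarrow> ('a, 'z::ab_group_add) hmod) \<Rightarrow>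
     ('a, 'y \<times> (nat \<Rightarrow> 'z)) hmod" where
  "hm_direct_sum Y Z = \<lparr>
     carr = {(y, z). y \<in> carr Y \<and> (\<forall>k. z k \<in> carr (Z k)) \<and>
                     summable (\<lambda>k. ip (Z k) (z k) (z k))},
     scal = (\<lambda>c (y, z). (scal Y c y, \<lambda>k. scal (Z k) c (z k))),
     act = (\<lambda>(y, z) a. (act Y y a, \<lambda>k. act (Z k) (z k) a)),
     ip = (\<lambda>(y, z) (y', z'). ip Y y y' + (\<Sum>k. ip (Z k) (z k) (z' k))) \<rparr>"

text \<open>The Hilbert-module direct limit, i.e. the completion of the quotient of the disjoint union
  of the \<open>X k\<close>, up to the unique isomorphism compatible with the maps \<open>\<iota> k\<close>.\<close>

definition direct_limit ::
    "(nat \<Rightarrow> ('a::cstar_algebra, 'x::ab_group_add) hmod) \<Rightarrow> (nat \<Rightarrow> 'x \<Rightarrow> 'x) \<Rightarrow>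
     ('a, 'l::ab_group_add) hmod \<Rightarrow> (nat \<Rightarrow> 'x \<Rightarrow> 'l) \<Rightarrow> bool" where
  "direct_limit X T L \<iota> \<longleftrightarrow> hilbert_module L \<and>
    (\<forall>k. ip_preserving (X k) L (\<iota> k)) \<and>
    (\<forall>k. \<forall>x\<in>carr (X k). \<iota> (Suc k) (T k x) = \<iota> k x) \<and>
    hm_closure L (\<Union>k. \<iota> k ` carr (X k)) = carr L"

record ('a, 'm) corr = "('a, 'm) hmod" +
  lact :: "'a \<Rightarrow> 'm \<Rightarrow> 'm"

locale correspondence = hilbert_module M
  for M :: "('a::cstar_algebra, 'm::ab_group_add) corr" +
  assumes lact_adjoint: "is_adjoint M M (lact M a) (lact M (star a))"
    and lact_add: "m \<in> carr M \<Longrightarrow> lact M (a + b) m = lact M a m + lact M b m"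
    and lact_scaleC: "m \<in> carr M \<Longrightarrow> lact M (c *\<^sub>C a) m = scal M c (lact M a m)"
    and lact_mult: "m \<in> carr M \<Longrightarrow> lact M (a * b) m = lact M a (lact M b m)"

text \<open>\<open>P\<close> with the balanced bilinear map \<open>t\<close> is the internal tensor product of \<open>X\<close> and \<open>M\<close>:
  the finite sums of the \<open>t x m\<close> form the image of the algebraic balanced tensor product modulo
  the null space of its semi-inner product, and \<open>P\<close> is their completion. This
  determines \<open>(P, t)\<close> up to a unique isomorphism.\<close>

definition finite_sums :: "'x::comm_monoid_add set \<Rightarrow> 'x set" where
  "finite_sums S = {sum_list xs | xs. set xs \<subseteq> S}"

definition internal_tensor ::
    "('a::cstar_algebra, 'x::ab_group_add) hmod \<Rightarrow> ('a, 'm::ab_group_add) corr \<Rightarrow>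
     ('a, 'p::ab_group_add) hmod \<Rightarrow> ('x \<Rightarrow> 'm \<Rightarrow> 'p) \<Rightarrow> bool" where
  "internal_tensor X M P t \<longleftrightarrow> hilbert_module P \<and>
    (\<forall>x\<in>carr X. \<forall>m\<in>carr M. t x m \<in> carr P) \<and>
    (\<forall>x\<in>carr X. \<forall>y\<in>carr X. \<forall>m\<in>carr M. t (x + y) m = t x m + t y m) \<and>
    (\<forall>x\<in>carr X. \<forall>m\<in>carr M. \<forall>n\<in>carr M. t x (m + n) = t x m + t x n) \<and>
    (\<forall>x\<in>carr X. \<forall>m\<in>carr M. \<forall>c. t (scal X c x) m = scal P c (t x m)) \<and>
    (\<forall>x\<in>carr X. \<forall>m\<in>carr M. \<forall>c. t x (scal M c m) = scal P c (t x m)) \<and>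
    (\<forall>x\<in>carr X. \<forall>m\<in>carr M. \<forall>a. t (act X x a) m = t x (lact M a m)) \<and>
    (\<forall>x\<in>carr X. \<forall>m\<in>carr M. \<forall>a. t x (act M m a) = act P (t x m) a) \<and>
    (\<forall>x\<in>carr X. \<forall>y\<in>carr X. \<forall>m\<in>carr M. \<forall>n\<in>carr M.
       ip P (t x m) (t y n) = ip M m (lact M (ip X x y) n)) \<and>
    hm_closure P (finite_sums {t x m | x m. x \<in> carr X \<and> m \<in> carr M}) = carr P"

text \<open>The tensor products of \<open>X\<close> with the tensor powers of \<open>M\<close> are formed one factor at a time,
  bracketed to the left, starting with \<open>X\<close> itself; \<open>tpow P k\<close> stands for the product of \<open>X\<close> with
  the \<open>k\<close>-th power and \<open>tmul P k\<close> is the canonical map from \<open>tpow P k \<times> M\<close>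
  to \<open>tpow P (Suc k)\<close>. The associativity identifications thereby become equalities:
  \<open>tower_shift j P\<close> consists of the tensor products of \<open>tpow P j\<close> with the powers of \<open>M\<close>.\<close>

record ('a, 'p, 'm) tower =
  tpow :: "nat \<Rightarrow> ('a, 'p) hmod"
  tmul :: "nat \<Rightarrow> 'p \<Rightarrow> 'm \<Rightarrow> 'p"

definition tensor_tower ::
    "('a::cstar_algebra, 'p::ab_group_add) hmod \<Rightarrow> ('a, 'm::ab_group_add) corr \<Rightarrow>
     ('a, 'p, 'm) tower \<Rightarrow> bool" where
  "tensor_tower X M P \<longleftrightarrow> tpow P 0 = X \<and>
    (\<forall>k. internal_tensor (tpow P k) M (tpow P (Suc k)) (tmul P k))"

definition tower_shift :: "nat \<Rightarrow> ('a, 'p, 'm) tower \<Rightarrow> ('a, 'p, 'm) tower" where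
  "tower_shift j P = \<lparr>tpow = (\<lambda>k. tpow P (j + k)), tmul = (\<lambda>k. tmul P (j + k))\<rparr>"

text \<open>\<open>elem_tensor P x [m\<^sub>1, \<dots>, m\<^sub>k]\<close> is \<open>x \<otimes> m\<^sub>1 \<otimes> \<dots> \<otimes> m\<^sub>k\<close>.\<close>

primrec elem_tensor :: "('a, 'p, 'm) tower \<Rightarrow> 'p \<Rightarrow> 'm list \<Rightarrow> 'p" where
  "elem_tensor P x [] = x"
| "elem_tensor P x (m # ms) = elem_tensor (tower_shift 1 P) (tmul P 0 x m) ms"

text \<open>\<open>tensor_id M P P' S k\<close> is \<open>S \<otimes> id\<^sub>k\<close>, where \<open>S\<close> is a map from \<open>tpow P 0\<close> to \<open>tpow P' 0\<close>.
  It is \<open>undefined\<close> off the carrier, so that it is uniquely described.\<close>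

definition tensor_id ::
    "('a::cstar_algebra, 'm::ab_group_add) corr \<Rightarrow> ('a, 'p::ab_group_add, 'm) tower \<Rightarrow>
     ('a, 'q::ab_group_add, 'm) tower \<Rightarrow> ('p \<Rightarrow> 'q) \<Rightarrow> nat \<Rightarrow> 'p \<Rightarrow> 'q" where
  "tensor_id M P P' S k = (THE F. F \<in> extensional (carr (tpow P k)) \<and>
     hm_bounded_linear (tpow P k) (tpow P' k) F \<and>
     (\<forall>x\<in>carr (tpow P 0). \<forall>ms. length ms = k \<and> set ms \<subseteq> carr M \<longrightarrow>
        F (elem_tensor P x ms) = elem_tensor P' (S x) ms))"

text \<open>For a closed submodule \<open>N\<close> of \<open>tpow P 0\<close>, the product of \<open>N\<close> with the \<open>k\<close>-th power of \<open>M\<close>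
  as a submodule of \<open>tpow P k\<close>.\<close>

definition sub_tensor ::
    "('a::cstar_algebra, 'm::ab_group_add) corr \<Rightarrow> ('a, 'p::ab_group_add, 'm) tower \<Rightarrow>
     ('a, 'p) hmod \<Rightarrow> nat \<Rightarrow> ('a, 'p) hmod" where
  "sub_tensor M P N k = submod (tpow P k) (hm_closure (tpow P k) (finite_sums
     {elem_tensor P x ms | x ms. x \<in> carr N \<and> length ms = k \<and> set ms \<subseteq> carr M}))"

primrec tensor_power_map ::
    "('a::cstar_algebra, 'm::ab_group_add) corr \<Rightarrow> ('a, 'p::ab_group_add, 'm) tower \<Rightarrow>
     ('p \<Rightarrow> 'p) \<Rightarrow> nat \<Rightarrow> 'p \<Rightarrow> 'p" where
  "tensor_power_map M Q R 0 = id"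
| "tensor_power_map M Q R (Suc k) =
     tensor_id M Q (tower_shift 1 Q) R k \<circ> tensor_power_map M Q R k"

end

theory Submission
  imports Defs
begin

text \<open>Since \<open>T\<close> is isometric and adjointable, \<open>Y \<otimes> M\<close> is the orthogonal sum of \<open>T Y\<close> and its complement.
  Tensoring with \<open>M\<^sup>k\<close> keeps this sum orthogonal, so the range of \<open>T \<otimes> id\<^sub>k\<close> is complemented and \<open>Y\<^sub>k\<close> is
  complemented in \<open>Y\<^sub>k\<^sub>+\<^sub>1\<close>. By density the projections onto the \<open>Y\<^sub>k\<close> converge pointwise to the identity of the
  direct limit, which gives the direct sum decomposition. Iterating \<open>R \<circ> \<iota>\<^sup>k\<^sup>+\<^sup>1 = \<iota>\<^sup>k \<otimes> id\<close> yields
  \<open>R\<^sup>k \<circ> \<iota>\<^sup>j\<^sup>+\<^sup>k = \<iota>\<^sup>j \<otimes> id\<^sub>k\<close>, so \<open>R\<^sup>k\<close> maps \<open>Y\<^sub>j\<^sub>+\<^sub>k\<close> onto \<open>Y\<^sub>j \<otimes> M\<^sup>k\<close>; the cases \<open>j = 0, 1\<close> show that it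
  maps the complement \<open>Z\<^sub>k\<close> onto \<open>Z\<^sub>0 \<otimes> M\<^sup>k\<close>.

  The analytic input is the Cauchy--Schwarz inequality and the contractivity of the left action. Both
  reduce to the monotonicity of the norm on positive elements of a C*-algebra, whose core is
  Kaplansky's theorem that every \<open>star b * b\<close> is the square of a self-adjoint element.\<close>

section \<open>Norm inequalities in C*-algebras\<close>

text \<open>No spectral theory is used. Positivity of \<open>p\<close> is tested by membership in a
  ball of radius \<open>N\<close> about \<open>N *\<^sub>R 1\<close>, and square roots come from a
  fixed-point iteration. Cauchy--Schwarz makes \<open>hnorm\<close> a norm and the inner product
  continuous. Contractivity of the left action makes \<open>x \<otimes> m\<close> continuous in
  \<open>x\<close>, without which the elementary tensors with several factors could not be shown to
  span a dense subspace.

  Complements are not expressed by projection operators but by orthogonal sums of additive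
  subgroups. One fact carries them: by completeness, closure commutes with orthogonal sums. It
  serves both to tensor a splitting and to project a limit point. The adjoint of \<open>T\<close> is
  therefore used only at the bottom of the tower, and no adjoint of
  \<open>T \<otimes> id\<^sub>k\<close> is ever formed.

  \<open>tensor_id\<close> is a definite description, so its use requires existence and uniqueness.
  Existence is proved for inner-product preserving maps, where the Gram matrices of elementary
  tensors agree; this avoids the matrix inequality behind boundedness of a general
  \<open>S \<otimes> id\<close>.\<close>

lemma star_zero [simp]: "star (0::'a::cstar_algebra) = 0"
  using star_add[of "0::'a" 0] by simp

lemma star_minus: "star (- a) = - star (a::'a::cstar_algebra)"
  using star_add[of a "- a"] by (simp add: eq_neg_iff_add_eq_0 add.commute)

lemma star_diff: "star (a - b) = star a - star (b::'a::cstar_algebra)"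
  using star_add[of a "- b"] by (simp add: star_minus)

lemma star_scaleR: "star (r *\<^sub>R a) = r *\<^sub>R star (a::'a::cstar_algebra)"
  by (metis scaleC_of_real star_scaleC complex_cnj_complex_of_real)

lemma norm_star [simp]: "norm (star a) = norm (a::'a::cstar_algebra)"
proof -
  have le: "norm b \<le> norm (star b)" for b :: 'a
  proof (cases "norm b = 0")
    case False
    have "norm b * norm b \<le> norm (star b) * norm b"
      using cstar_identity[of b] norm_mult_ineq[of "star b" b] by (simp add: power2_eq_square)
    then show ?thesis using False by (simp add: mult_le_cancel_right)
  qed simp
  show ?thesis using le[of a] le[of "star a"] by (simp add: star_star)
qed

lemma bounded_linear_star: "bounded_linear (star :: 'a::cstar_algebra \<Rightarrow> 'a)"
  by (rule bounded_linear_intro[where K = 1]) (simp_all add: star_add star_scaleR)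

lemma scaleC_scaleR: "c *\<^sub>C (r *\<^sub>R a) = r *\<^sub>R (c *\<^sub>C (a::'a::cstar_algebra))"
  by (simp add: scaleC_of_real[symmetric] scaleC_scaleC mult.commute)

lemma bounded_linear_scaleC: "bounded_linear (\<lambda>a::'a::cstar_algebra. c *\<^sub>C a)"
  by (rule bounded_linear_intro[where K = "cmod c"])
     (simp_all add: scaleC_add_right scaleC_scaleR norm_scaleC)

lemma scaleC_one: "1 *\<^sub>C a = (a::'a::cstar_algebra)"
  using scaleC_of_real[of 1 a] by simp

text \<open>The C*-identity at \<open>x = a - b\<close>. With \<open>star x * y\<close> read as an
  inner product, this is nondegeneracy of the algebra as a module over itself.\<close>

lemma star_mult_cancel:
  fixes a b :: "'a::cstar_algebra"
  assumes "\<And>x. star x * a = star x * b"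
  shows "a = b"
proof -
  have "star (a - b) * (a - b) = 0" using assms[of "a - b"] by (simp add: algebra_simps)
  then have "norm (a - b) ^ 2 = 0" by (metis cstar_identity norm_zero)
  then show ?thesis by simp
qed

text \<open>The square root of \<open>1 - k\<close> is \<open>1 - r\<close>. The equation for \<open>r\<close> makes sense without a unit;
  it is solved by iterating \<open>r \<mapsto> (k + r\<^sup>2)/2\<close> from \<open>0\<close>, and the iteration of \<open>(1 + \<rho>\<^sup>2)/2\<close> on the
  real line dominates it.\<close>

lemma one_minus_sqrt:
  fixes k :: "'a::cstar_algebra"
  assumes k: "norm k \<le> 1"
  obtains r where "norm r \<le> 1" "2 *\<^sub>R r - r * r = k"
    "\<And>x. k * x = x * k \<Longrightarrow> r * x = x * r" "star k = k \<Longrightarrow> star r = r"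
proof -
  define f where "f n = ((\<lambda>r. (1/2) *\<^sub>R (k + r * r)) ^^ n) 0" for n
  define g where "g n = ((\<lambda>t::real. (1 + t\<^sup>2) / 2) ^^ n) 0" for n
  have f0: "f 0 = 0" and fS: "f (Suc n) = (1/2) *\<^sub>R (k + f n * f n)" for n
    by (simp_all add: f_def)
  have g0: "g 0 = 0" and gS: "g (Suc n) = (1 + (g n)\<^sup>2) / 2" for n
    by (simp_all add: g_def)
  have g_range: "0 \<le> g n \<and> g n \<le> 1" for n
  proof (induction n)
    case (Suc n)
    then have "(g n)\<^sup>2 \<le> 1" by (simp add: power_le_one)
    then show ?case by (simp add: gS)
  qed (simp add: g0)
  have g_mono: "g n \<le> g (Suc n)" for n
  proof -
    have "0 \<le> (1 - g n)\<^sup>2" by simp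
    then show ?thesis by (simp add: gS power2_eq_square algebra_simps)
  qed
  have commute: "f n * x = x * f n" if "k * x = x * k" for n x
  proof (induction n)
    case (Suc n)
    have "f n * f n * x = x * (f n * f n)" by (metis Suc mult.assoc)
    then show ?case using that by (simp add: fS algebra_simps)
  qed (simp add: f0)
  have ff: "f m * f n = f n * f m" for m n
    using commute commute[of k] by metis
  have f_le: "norm (f n) \<le> g n" for n
  proof (induction n)
    case (Suc n)
    have "norm (k + f n * f n) \<le> 1 + (g n)\<^sup>2"
      unfolding power2_eq_square
      by (intro norm_triangle_mono k order_trans[OF norm_mult_ineq] mult_mono Suc) (use g_range in auto)
    then show ?case by (simp add: fS gS)
  qed (simp add: f0 g0)
  have step: "norm (f (Suc n) - f n) \<le> g (Suc n) - g n" for n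
  proof (induction n)
    case 0
    then show ?case using k by (simp add: f0 g0 fS gS)
  next
    case (Suc n)
    \<comment> \<open>The difference of squares factors because the iterates commute. The same
      factorization on the real line gives the matching increment of \<open>g\<close>.\<close>
    have "f (Suc (Suc n)) - f (Suc n) = (1/2) *\<^sub>R ((f (Suc n) - f n) * (f (Suc n) + f n))"
      using ff[of n "Suc n"] by (simp add: fS[of "Suc n"] fS[of n] algebra_simps flip: scaleR_add_left)
    moreover have "norm ((f (Suc n) - f n) * (f (Suc n) + f n))
        \<le> (g (Suc n) - g n) * (g (Suc n) + g n)"
      by (intro order_trans[OF norm_mult_ineq] mult_mono Suc norm_triangle_mono f_le)
         (use g_mono[of n] in auto)
    moreover have "g (Suc (Suc n)) - g (Suc n) = (g (Suc n) - g n) * (g (Suc n) + g n) / 2"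
      by (simp add: gS[of "Suc n"] gS[of n] power2_eq_square field_simps)
    ultimately show ?case by simp
  qed
  have tele: "norm (f (n + d) - f n) \<le> g (n + d) - g n" for n d
  proof (induction d)
    case (Suc d)
    have "norm (f (n + Suc d) - f n) \<le> norm (f (Suc (n + d)) - f (n + d)) + norm (f (n + d) - f n)"
      by (metis add_Suc_right norm_triangle_ineq diff_add_cancel add_diff_eq)
    also have "\<dots> \<le> (g (Suc (n + d)) - g (n + d)) + (g (n + d) - g n)"
      by (intro add_mono step Suc)
    finally show ?case by simp
  qed simp
  have "incseq g" using g_mono by (simp add: incseq_SucI)
  then have "convergent g"
    using g_range by (intro Bseq_mono_convergent BseqI'[where K = 1]) (auto simp: incseq_def)
  then have "Cauchy g" by (rule convergent_Cauchy)
  have "Cauchy f"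
  proof (rule CauchyI')
    fix e :: real assume "e > 0"
    then obtain N where N: "\<And>m n. m \<ge> N \<Longrightarrow> n \<ge> N \<Longrightarrow> norm (g m - g n) < e"
      using CauchyD[OF \<open>Cauchy g\<close>] by metis
    have "dist (f m) (f n) < e" if "m \<ge> N" "n > m" for m n
    proof -
      have "norm (f (m + (n - m)) - f m) \<le> g (m + (n - m)) - g m" by (rule tele)
      then have "norm (f n - f m) \<le> g n - g m" using that by simp
      also have "\<dots> \<le> norm (g n - g m)" by simp
      also have "\<dots> < e" using that N by simp
      finally show ?thesis by (simp add: dist_norm norm_minus_commute)
    qed
    then show "\<exists>M. \<forall>m\<ge>M. \<forall>n>m. dist (f m) (f n) < e" by blast
  qed
  then obtain r where r: "f \<longlonglongrightarrow> r" using Cauchy_convergent convergent_def by blast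
  show ?thesis
  proof (rule that)
    show "norm r \<le> 1"
      by (rule LIMSEQ_le_const2[OF tendsto_norm[OF r]]) (use f_le g_range order_trans in blast)
    have "(\<lambda>n. f (Suc n)) \<longlonglongrightarrow> (1/2) *\<^sub>R (k + r * r)"
      unfolding fS by (intro tendsto_intros r)
    moreover have "(\<lambda>n. f (Suc n)) \<longlonglongrightarrow> r" using r by (rule LIMSEQ_Suc)
    ultimately have "r = (1/2) *\<^sub>R (k + r * r)" by (rule LIMSEQ_unique[symmetric])
    then have "2 *\<^sub>R r = 2 *\<^sub>R ((1/2) *\<^sub>R (k + r * r))" by simp
    then show "2 *\<^sub>R r - r * r = k" by simp
    show "r * x = x * r" if "k * x = x * k" for x
    proof (rule LIMSEQ_unique)
      show "(\<lambda>n. f n * x) \<longlonglongrightarrow> r * x" by (intro tendsto_intros r)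
      show "(\<lambda>n. f n * x) \<longlonglongrightarrow> x * r" unfolding commute[OF that] by (intro tendsto_intros r)
    qed
    show "star r = r" if "star k = k"
    proof (rule LIMSEQ_unique)
      have "star (f n) = f n" for n
        by (induction n) (simp_all add: f0 fS star_scaleR star_add star_mult that)
      then show "f \<longlonglongrightarrow> star r"
        using bounded_linear.tendsto[OF bounded_linear_star r] by simp
    qed (rule r)
  qed
qed

text \<open>Multipliers supply the unit that the algebra may lack. The second component of a multiplier is the
  adjoint of the first.\<close>

typedef (overloaded) 'a multiplier =
  "{p :: ('a::cstar_algebra \<Rightarrow>\<^sub>L 'a) \<times> ('a \<Rightarrow>\<^sub>L 'a).
     \<forall>x y. star (blinfun_apply (fst p) x) * y = star x * blinfun_apply (snd p) y}"
  by (rule exI[of _ "(0, 0)"]) simp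

setup_lifting type_definition_multiplier

definition mult_op :: "'a::cstar_algebra multiplier \<Rightarrow> 'a \<Rightarrow>\<^sub>L 'a" where
  "mult_op p = fst (Rep_multiplier p)"

lift_definition scaleC_op :: "complex \<Rightarrow> 'a::cstar_algebra \<Rightarrow>\<^sub>L 'a" is "\<lambda>c a. c *\<^sub>C a"
  by (rule bounded_linear_scaleC)

lift_definition left_mult_op :: "'a::cstar_algebra \<Rightarrow> 'a \<Rightarrow>\<^sub>L 'a" is "\<lambda>a x. a * x"
  by (rule bounded_linear_mult_right)

lemma adjoint_op_swap:
  fixes S S' :: "'a::cstar_algebra \<Rightarrow>\<^sub>L 'a"
  assumes "\<And>x y. star (S x) * y = star x * S' y"
  shows "star (S' x) * y = star x * S y"
  by (metis assms star_mult star_star)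

text \<open>\<open>\<Rightarrow>\<^sub>L\<close> guarantees only real linearity. Having an adjoint
  forces complex linearity, as testing against every \<open>star x\<close> shows.\<close>

lemma adjoint_op_scaleC:
  fixes S S' :: "'a::cstar_algebra \<Rightarrow>\<^sub>L 'a"
  assumes "\<forall>x y. star (S x) * y = star x * S' y"
  shows "S (c *\<^sub>C x) = c *\<^sub>C S x" and "S' (c *\<^sub>C x) = c *\<^sub>C S' x"
  by (rule star_mult_cancel, metis assms adjoint_op_swap mult_scaleC_right)+

text \<open>The C*-identity at \<open>S' y\<close> bounds the square of \<open>norm (S' y)\<close>
  by \<open>norm S * norm (S' y) * norm y\<close>. By symmetry both components of a multiplier have
  the same norm.\<close>

lemma adjoint_op_norm_le:
  fixes S S' :: "'a::cstar_algebra \<Rightarrow>\<^sub>L 'a"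
  assumes "\<And>x y. star (S x) * y = star x * S' y"
  shows "norm S' \<le> norm S"
proof (rule norm_blinfun_bound)
  fix y
  have "norm (S' y) * norm (S' y) = norm (star (S (S' y)) * y)"
    using cstar_identity[of "S' y"] by (simp add: assms power2_eq_square)
  also have "\<dots> \<le> norm (S (S' y)) * norm y" using norm_mult_ineq by (metis norm_star)
  also have "\<dots> \<le> norm S * norm (S' y) * norm y"
    by (intro mult_right_mono norm_blinfun) simp
  finally show "norm (S' y) \<le> norm S * norm y"
    by (cases "norm (S' y) = 0") (simp_all add: mult.commute mult.left_commute)
qed simp

lemma norm_scaleC_op_compose:
  fixes S :: "'a::cstar_algebra \<Rightarrow>\<^sub>L 'a"
  shows "norm (scaleC_op c o\<^sub>L S) = cmod c * norm S"
proof -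
  have le: "norm (scaleC_op d o\<^sub>L U) \<le> cmod d * norm U" for d and U :: "'a \<Rightarrow>\<^sub>L 'a"
    by (rule norm_blinfun_bound)
       (simp_all add: scaleC_op.rep_eq norm_scaleC mult.assoc mult_left_mono norm_blinfun)
  show ?thesis
  proof (cases "c = 0")
    case True
    then show ?thesis using le[of c S] by simp
  next
    case False
    have "scaleC_op (inverse c) o\<^sub>L (scaleC_op c o\<^sub>L S) = S"
      by (rule blinfun_eqI) (simp add: scaleC_op.rep_eq scaleC_scaleC scaleC_one False)
    then have "norm S \<le> cmod (inverse c) * norm (scaleC_op c o\<^sub>L S)" using le by metis
    then show ?thesis using le[of c S] False
      by (simp add: norm_inverse field_simps norm_divide)
  qed
qed

text \<open>The unit enters only through \<open>monoid_mult\<close>: over the zero algebra the unit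
  multiplier is \<open>0\<close>, so neither \<open>0 \<noteq> 1\<close> nor
  \<open>norm 1 = 1\<close> holds in general. \<open>norm_one_le\<close> stands in for the
  latter.\<close>

instantiation multiplier :: (cstar_algebra) "{real_normed_algebra, monoid_mult}"
begin

lift_definition zero_multiplier :: "'a multiplier" is "(0, 0)" by simp
lift_definition one_multiplier :: "'a multiplier" is "(id_blinfun, id_blinfun)" by simp
lift_definition plus_multiplier :: "'a multiplier \<Rightarrow> 'a multiplier \<Rightarrow> 'a multiplier"
  is "\<lambda>p q. (fst p + fst q, snd p + snd q)"
  by (simp add: blinfun.add_left star_add algebra_simps)
lift_definition minus_multiplier :: "'a multiplier \<Rightarrow> 'a multiplier \<Rightarrow> 'a multiplier"
  is "\<lambda>p q. (fst p - fst q, snd p - snd q)"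
  by (simp add: blinfun.diff_left star_diff algebra_simps)
lift_definition uminus_multiplier :: "'a multiplier \<Rightarrow> 'a multiplier"
  is "\<lambda>p. (- fst p, - snd p)"
  by (simp add: blinfun.minus_left star_minus)
lift_definition scaleR_multiplier :: "real \<Rightarrow> 'a multiplier \<Rightarrow> 'a multiplier"
  is "\<lambda>r p. (r *\<^sub>R fst p, r *\<^sub>R snd p)"
  by (simp add: blinfun.scaleR_left star_scaleR)
lift_definition times_multiplier :: "'a multiplier \<Rightarrow> 'a multiplier \<Rightarrow> 'a multiplier"
  is "\<lambda>p q. (fst p o\<^sub>L fst q, snd q o\<^sub>L snd p)"
  by simp
definition norm_multiplier :: "'a multiplier \<Rightarrow> real" where
  "norm_multiplier p = norm (mult_op p)"
definition dist_multiplier :: "'a multiplier \<Rightarrow> 'a multiplier \<Rightarrow> real" where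
  "dist_multiplier p q = norm (p - q)"
definition sgn_multiplier :: "'a multiplier \<Rightarrow> 'a multiplier" where
  "sgn_multiplier p = scaleR (inverse (norm p)) p"
definition uniformity_multiplier :: "('a multiplier \<times> 'a multiplier) filter" where
  "uniformity_multiplier = (INF e\<in>{0<..}. principal {(p, q). dist p q < e})"
definition open_multiplier :: "'a multiplier set \<Rightarrow> bool" where
  "open_multiplier U \<longleftrightarrow> (\<forall>p\<in>U. \<forall>\<^sub>F (p', q) in uniformity. p' = p \<longrightarrow> q \<in> U)"

text \<open>The norm is defined through the first component alone; this equality lets it detect zero
  and control limits in the second component too.\<close>

lemma norm_multiplier_snd: "norm (p :: 'a multiplier) = norm (snd (Rep_multiplier p))"
proof -
  have "star (fst (Rep_multiplier p) x) * y = star x * snd (Rep_multiplier p) y" for x y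
    using Rep_multiplier[of p] by simp
  then show ?thesis
    unfolding norm_multiplier_def mult_op_def
    by (metis adjoint_op_norm_le adjoint_op_swap antisym)
qed

instance
proof
  fix p q s :: "'a multiplier" and r r' :: real
  show "p + q + s = p + (q + s)" by transfer (simp add: add.assoc)
  show "p + q = q + p" by transfer (simp add: add.commute)
  show "0 + p = p" by transfer simp
  show "- p + p = 0" by transfer simp
  show "p - q = p + - q" by transfer simp
  show "r *\<^sub>R (p + q) = r *\<^sub>R p + r *\<^sub>R q" by transfer (simp add: scaleR_add_right)
  show "(r + r') *\<^sub>R p = r *\<^sub>R p + r' *\<^sub>R p" by transfer (simp add: scaleR_add_left)
  show "r *\<^sub>R r' *\<^sub>R p = (r * r') *\<^sub>R p" by transfer simp
  show "1 *\<^sub>R p = p" by transfer simp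
  show "p * q * s = p * (q * s)" by transfer (auto intro!: blinfun_eqI)
  show "(p + q) * s = p * s + q * s"
    by transfer (auto intro!: blinfun_eqI simp: blinfun.add_left blinfun.add_right)
  show "p * (q + s) = p * q + p * s"
    by transfer (auto intro!: blinfun_eqI simp: blinfun.add_left blinfun.add_right)
  show "r *\<^sub>R p * q = r *\<^sub>R (p * q)"
    by transfer (auto intro!: blinfun_eqI simp: blinfun.scaleR_left blinfun.scaleR_right)
  show "p * r *\<^sub>R q = r *\<^sub>R (p * q)"
    by transfer (auto intro!: blinfun_eqI simp: blinfun.scaleR_left blinfun.scaleR_right)
  show "1 * p = p" by transfer (auto intro!: blinfun_eqI)
  show "p * 1 = p" by transfer (auto intro!: blinfun_eqI)
  show "dist p q = norm (p - q)" by (rule dist_multiplier_def)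
  show "sgn p = scaleR (inverse (norm p)) p" by (rule sgn_multiplier_def)
  show "uniformity = (INF e\<in>{0<..}. principal {(p, q). dist (p::'a multiplier) q < e})"
    by (rule uniformity_multiplier_def)
  show "open U = (\<forall>p\<in>U. \<forall>\<^sub>F (p', q) in uniformity. p' = p \<longrightarrow> q \<in> U)" for U :: "'a multiplier set"
    by (rule open_multiplier_def)
  show "(norm p = 0) = (p = 0)"
  proof
    assume "norm p = 0"
    then have "fst (Rep_multiplier p) = 0" "snd (Rep_multiplier p) = 0"
      using norm_multiplier_snd[of p] by (simp_all add: norm_multiplier_def mult_op_def)
    then show "p = 0"
      by (metis Rep_multiplier_inject prod.collapse zero_multiplier.rep_eq)
  qed (simp add: norm_multiplier_def mult_op_def zero_multiplier.rep_eq)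
  show "norm (p + q) \<le> norm p + norm q"
    unfolding norm_multiplier_def mult_op_def plus_multiplier.rep_eq
    by (simp add: norm_triangle_ineq)
  show "norm (r *\<^sub>R p) = \<bar>r\<bar> * norm p"
    unfolding norm_multiplier_def mult_op_def scaleR_multiplier.rep_eq by simp
  show "norm (p * q) \<le> norm p * norm q"
    unfolding norm_multiplier_def mult_op_def times_multiplier.rep_eq
    by (simp add: norm_blinfun_compose)
qed

end

instance multiplier :: (cstar_algebra) banach
proof
  show "convergent X" if "Cauchy X" for X :: "nat \<Rightarrow> 'a multiplier"
  proof -
    let ?F = "\<lambda>n. fst (Rep_multiplier (X n))" and ?G = "\<lambda>n. snd (Rep_multiplier (X n))"
    have dF: "dist (?F m) (?F n) = dist (X m) (X n)" for m n
      by (simp add: dist_norm dist_multiplier_def norm_multiplier_def mult_op_def minus_multiplier.rep_eq)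
    have dG: "dist (?G m) (?G n) = dist (X m) (X n)" for m n
      by (simp add: dist_norm dist_multiplier_def norm_multiplier_snd minus_multiplier.rep_eq)
    have "Cauchy ?F" "Cauchy ?G" using that by (simp_all add: Cauchy_def dF dG)
    then have "convergent ?F" "convergent ?G" by (simp_all only: Cauchy_convergent_iff)
    then obtain S S' where S: "?F \<longlonglongrightarrow> S" and S': "?G \<longlonglongrightarrow> S'"
      by (auto simp only: convergent_def)
    have "star (S x) * y = star x * S' y" for x y
    proof (rule LIMSEQ_unique)
      show "(\<lambda>n. star (?F n x) * y) \<longlonglongrightarrow> star (S x) * y"
        by (intro tendsto_mult tendsto_const bounded_linear.tendsto[OF bounded_linear_star]
            blinfun.tendsto S)
      have "star (?F n x) * y = star x * ?G n y" for n using Rep_multiplier[of "X n"] by simp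
      then show "(\<lambda>n. star (?F n x) * y) \<longlonglongrightarrow> star x * S' y"
        by (simp only:) (intro tendsto_mult tendsto_const blinfun.tendsto S')
    qed
    then have p: "Rep_multiplier (Abs_multiplier (S, S')) = (S, S')"
      by (intro Abs_multiplier_inverse) simp
    let ?p = "Abs_multiplier (S, S')"
    have "(\<lambda>n. dist (?F n) S) \<longlonglongrightarrow> 0" using S by (rule tendsto_dist_iff[THEN iffD1])
    moreover have "dist (X n) ?p = dist (?F n) S" for n
      by (simp add: dist_norm dist_multiplier_def norm_multiplier_def mult_op_def minus_multiplier.rep_eq p)
    ultimately have "(\<lambda>n. dist (X n) ?p) \<longlonglongrightarrow> 0" by simp
    then have "X \<longlonglongrightarrow> ?p" by (rule tendsto_dist_iff[THEN iffD2])
    then show ?thesis by (rule convergentI)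
  qed
qed

instantiation multiplier :: (cstar_algebra) cstar_algebra
begin

lift_definition scaleC_multiplier :: "complex \<Rightarrow> 'a multiplier \<Rightarrow> 'a multiplier"
  is "\<lambda>c p. (scaleC_op c o\<^sub>L fst p, scaleC_op (cnj c) o\<^sub>L snd p)"
  by (simp add: scaleC_op.rep_eq star_scaleC mult_scaleC_left mult_scaleC_right)
lift_definition star_multiplier :: "'a multiplier \<Rightarrow> 'a multiplier"
  is "\<lambda>p. (snd p, fst p)"
  by (metis adjoint_op_swap fst_conv snd_conv)

instance
proof
  fix p q :: "'a multiplier" and c d :: complex and r :: real
  show "complex_of_real r *\<^sub>C p = r *\<^sub>R p"
    by transfer (auto intro!: blinfun_eqI simp: scaleC_op.rep_eq scaleC_of_real blinfun.scaleR_left)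
  show "c *\<^sub>C (p + q) = c *\<^sub>C p + c *\<^sub>C q"
    by transfer (auto intro!: blinfun_eqI simp: scaleC_op.rep_eq scaleC_add_right blinfun.add_left)
  show "(c + d) *\<^sub>C p = c *\<^sub>C p + d *\<^sub>C p"
    by transfer (auto intro!: blinfun_eqI simp: scaleC_op.rep_eq scaleC_add_left blinfun.add_left)
  show "c *\<^sub>C (d *\<^sub>C p) = (c * d) *\<^sub>C p"
    by transfer (auto intro!: blinfun_eqI simp: scaleC_op.rep_eq scaleC_scaleC)
  show "c *\<^sub>C p * q = c *\<^sub>C (p * q)"
    by (transfer, auto intro!: blinfun_eqI simp: scaleC_op.rep_eq, erule adjoint_op_scaleC(2))
  show "p * (c *\<^sub>C q) = c *\<^sub>C (p * q)"
    by (transfer, auto intro!: blinfun_eqI simp: scaleC_op.rep_eq, erule adjoint_op_scaleC(1))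
  show "norm (c *\<^sub>C p) = cmod c * norm p"
    unfolding norm_multiplier_def mult_op_def scaleC_multiplier.rep_eq
    by (simp add: norm_scaleC_op_compose)
  show "star (star p) = p" by transfer simp
  show "star (p + q) = star p + star q" by transfer simp
  show "star (c *\<^sub>C p) = cnj c *\<^sub>C star p" by transfer simp
  show "star (p * q) = star q * star p" by transfer simp
  show "norm (star p * p) = (norm p)\<^sup>2"
  proof (rule antisym)
    have "norm (star p) = norm p"
      using norm_multiplier_snd[of p]
      by (simp add: norm_multiplier_def mult_op_def star_multiplier.rep_eq)
    then show "norm (star p * p) \<le> (norm p)\<^sup>2"
      using norm_blinfun_compose[of "mult_op (star p)" "mult_op p"]
      by (simp add: norm_multiplier_def mult_op_def times_multiplier.rep_eq power2_eq_square)
    define S where "S = mult_op p"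
    define S' where "S' = mult_op (star p)"
    have adj: "star (S x) * y = star x * S' y" for x y
      unfolding S_def S'_def mult_op_def star_multiplier.rep_eq using Rep_multiplier[of p] by simp
    have N: "norm (star p * p) = norm (S' o\<^sub>L S)"
      by (simp add: norm_multiplier_def mult_op_def times_multiplier.rep_eq S_def S'_def)
    \<comment> \<open>As for operators on a Hilbert space, with \<open>star x * y\<close> as inner
      product: the square of \<open>norm (S x)\<close> is the norm of
      \<open>star x * S' (S x)\<close>.\<close>
    have "norm S \<le> sqrt (norm (S' o\<^sub>L S))"
    proof (rule norm_blinfun_bound)
      fix x
      have "(norm (S x))\<^sup>2 = norm (star x * (S' o\<^sub>L S) x)"
        using cstar_identity[of "S x"] by (simp add: adj)
      also have "\<dots> \<le> norm x * norm ((S' o\<^sub>L S) x)" by (metis norm_mult_ineq norm_star)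
      also have "\<dots> \<le> norm x * (norm (S' o\<^sub>L S) * norm x)"
        by (intro mult_left_mono norm_blinfun) simp
      finally have "(norm (S x))\<^sup>2 \<le> norm (S' o\<^sub>L S) * (norm x)\<^sup>2"
        by (simp add: power2_eq_square mult_ac)
      then have "norm (S x) \<le> sqrt (norm (S' o\<^sub>L S) * (norm x)\<^sup>2)" by (rule real_le_rsqrt)
      then show "norm (S x) \<le> sqrt (norm (S' o\<^sub>L S)) * norm x" by (simp add: real_sqrt_mult)
    qed simp
    then have "(norm S)\<^sup>2 \<le> norm (S' o\<^sub>L S)"
      by (metis norm_ge_zero power_mono real_sqrt_pow2)
    then show "(norm p)\<^sup>2 \<le> norm (star p * p)" unfolding N by (simp add: norm_multiplier_def S_def)
  qed
qed

end

section \<open>The isometric embedding of the algebra into its multipliers\<close>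

lift_definition left_mult :: "'a::cstar_algebra \<Rightarrow> 'a multiplier"
  is "\<lambda>a. (left_mult_op a, left_mult_op (star a))"
  by (simp add: left_mult_op.rep_eq star_mult mult.assoc)

lemma left_mult_add: "left_mult (a + b) = left_mult a + left_mult b"
  by transfer (auto intro!: blinfun_eqI simp: left_mult_op.rep_eq blinfun.add_left star_add distrib_right)

lemma left_mult_diff: "left_mult (a - b) = left_mult a - left_mult b"
  by transfer (auto intro!: blinfun_eqI simp: left_mult_op.rep_eq blinfun.diff_left star_diff left_diff_distrib)

lemma left_mult_mult: "left_mult (a * b) = left_mult a * left_mult b"
  by transfer (auto intro!: blinfun_eqI simp: left_mult_op.rep_eq star_mult mult.assoc)

lemma left_mult_star: "left_mult (star a) = star (left_mult a)"
  by transfer (simp add: star_star)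

text \<open>Evaluation at \<open>star a\<close> shows that no norm is lost. Inequalities proved in
  the presence of a unit thereby descend to the original algebra.\<close>

lemma norm_left_mult [simp]: "norm (left_mult a) = norm a"
proof (rule antisym)
  show "norm (left_mult a) \<le> norm a"
    unfolding norm_multiplier_def mult_op_def left_mult.rep_eq
    by (auto intro!: norm_blinfun_bound simp: left_mult_op.rep_eq norm_mult_ineq)
  have "norm a * norm a = norm (a * star a)"
    using cstar_identity[of "star a"] by (simp add: star_star power2_eq_square)
  also have "\<dots> \<le> norm (left_mult a) * norm a"
    using norm_blinfun[of "left_mult_op a" "star a"]
    by (simp add: norm_multiplier_def mult_op_def left_mult.rep_eq left_mult_op.rep_eq)
  finally show "norm a \<le> norm (left_mult a)"
    by (cases "norm a = 0") auto
qed

lemma scaleC_minus_right: "c *\<^sub>C (- a) = - (c *\<^sub>C (a::'a::cstar_algebra))"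
  using linear_neg[OF bounded_linear.linear[OF bounded_linear_scaleC]] .

lemma scaleC_diff_right: "c *\<^sub>C (a - b) = c *\<^sub>C a - c *\<^sub>C (b::'a::cstar_algebra)"
  using linear_diff[OF bounded_linear.linear[OF bounded_linear_scaleC]] .

lemma scaleC_zero_right [simp]: "c *\<^sub>C (0::'a::cstar_algebra) = 0"
  using scaleC_diff_right[of c 0 0] by simp

lemma scaleC_minus_left: "(- c) *\<^sub>C a = - (c *\<^sub>C (a::'a::cstar_algebra))"
  using scaleC_scaleC[of c "- 1" a] scaleC_of_real[of "- 1" a] by (simp add: scaleC_minus_right)

lemma scaleC_ii: "\<i> *\<^sub>C (\<i> *\<^sub>C a) = - (a::'a::cstar_algebra)"
  using scaleC_of_real[of "- 1" a] by (simp add: scaleC_scaleC)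

section \<open>Norm-positive elements of a unital C*-algebra\<close>

lemma star_one [simp]: "star (1::'a::{cstar_algebra,monoid_mult}) = 1"
  by (metis mult_1_left mult_1_right star_mult star_star)

lemma norm_one_le: "norm (1::'a::{cstar_algebra,monoid_mult}) \<le> 1"
proof (cases "norm (1::'a) = 0")
  case False
  have "norm (1::'a) = norm (1::'a) * norm (1::'a)"
    using cstar_identity[of "1::'a"] by (simp add: power2_eq_square)
  then show ?thesis using False by simp
qed simp

lemma norm_square_selfadjoint:
  fixes w :: "'a::cstar_algebra"
  assumes "star w = w"
  shows "norm (w * w) = (norm w)\<^sup>2"
  using cstar_identity[of w] assms by simp

text \<open>This is \<open>one_minus_sqrt\<close> for \<open>k = 1 - p\<close>, with
  \<open>q = 1 - r\<close>. The commutation clause replaces the functional calculus: the root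
  commutes with whatever commutes with \<open>p\<close>.\<close>

lemma norm_positive_sqrt:
  fixes p :: "'a::{cstar_algebra,monoid_mult}"
  assumes "norm (1 - p) \<le> 1" "star p = p"
  obtains q where "q * q = p" "star q = q" "norm (1 - q) \<le> 1"
    "\<And>x. p * x = x * p \<Longrightarrow> q * x = x * q"
proof -
  have "star (1 - p) = 1 - p" by (simp add: star_diff assms)
  then obtain r where r: "norm r \<le> 1" "2 *\<^sub>R r - r * r = 1 - p" "star r = r"
    and comm: "\<And>x. (1 - p) * x = x * (1 - p) \<Longrightarrow> r * x = x * r"
    using one_minus_sqrt[OF assms(1)] by metis
  show ?thesis
  proof (rule that[of "1 - r"])
    have "(1 - r) * (1 - r) = 1 - (2 *\<^sub>R r - r * r)" by (simp add: algebra_simps scaleR_2)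
    then show "(1 - r) * (1 - r) = p" by (simp add: r(2))
    show "star (1 - r) = 1 - r" by (simp add: star_diff r(3))
    show "norm (1 - (1 - r)) \<le> 1" by (simp add: r(1))
    show "(1 - r) * x = x * (1 - r)" if "p * x = x * p" for x
      using comm[of x] that by (simp add: left_diff_distrib right_diff_distrib)
  qed
qed

text \<open>With \<open>s = sqrt (1 - w\<^sup>2)\<close> the element \<open>w + \<i> s\<close> is unitary, and \<open>1 - 2 w\<^sup>2\<close> is minus the real part
  of its square.\<close>

lemma norm_one_minus_square:
  fixes w :: "'a::{cstar_algebra,monoid_mult}"
  assumes w: "star w = w" "norm w \<le> 1"
  shows "norm (1 - 2 *\<^sub>R (w * w)) \<le> 1"
proof -
  have "norm (1 - (1 - w * w)) \<le> 1"
    using w by (simp add: norm_square_selfadjoint power_le_one)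
  moreover have "star (1 - w * w) = 1 - w * w" by (simp add: star_diff star_mult w)
  ultimately obtain s where s: "s * s = 1 - w * w" "star s = s"
    and comm: "\<And>x. (1 - w * w) * x = x * (1 - w * w) \<Longrightarrow> s * x = x * s"
    using norm_positive_sqrt by metis
  have sw: "s * w = w * s" by (rule comm) (simp add: algebra_simps)
  define U where "U = w + \<i> *\<^sub>C s"
  have sU: "star U = w - \<i> *\<^sub>C s" by (simp add: U_def star_add star_scaleC w s(2) scaleC_minus_left)
  have "star U * U = w * w + s * s"
    by (simp add: sU) (simp add: U_def algebra_simps mult_scaleC_left mult_scaleC_right scaleC_add_right scaleC_diff_right scaleC_ii sw)
  then have "(norm U)\<^sup>2 = norm (1::'a)" using cstar_identity[of U] by (simp add: s(1))
  then have U1: "(norm U)\<^sup>2 \<le> 1" using norm_one_le[where 'a='a] by simp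
  have "U * U + star U * star U = 2 *\<^sub>R (w * w) - 2 *\<^sub>R (s * s)"
    by (simp add: sU) (simp add: U_def algebra_simps mult_scaleC_left mult_scaleC_right scaleC_add_right scaleC_diff_right scaleC_ii sw scaleR_2)
  also have "\<dots> = - (2 *\<^sub>R (1 - 2 *\<^sub>R (w * w)))" by (simp add: s(1) algebra_simps scaleR_2)
  finally have "2 * norm (1 - 2 *\<^sub>R (w * w)) = norm (U * U + star U * star U)" by simp
  also have "\<dots> \<le> norm U * norm U + norm (star U) * norm (star U)"
    by (intro norm_triangle_mono norm_mult_ineq)
  also have "\<dots> = 2 * (norm U)\<^sup>2" by (simp add: power2_eq_square)
  finally show ?thesis using U1 by simp
qed

text \<open>The preceding bound, rescaled from norm one. In spectral terms it places the spectrum of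
  \<open>w * w\<close> between \<open>0\<close> and \<open>(norm w)\<^sup>2\<close>.\<close>

lemma norm_diff_square:
  fixes w :: "'a::{cstar_algebra,monoid_mult}"
  assumes w: "star w = w"
  shows "norm ((norm w)\<^sup>2 *\<^sub>R 1 - 2 *\<^sub>R (w * w)) \<le> (norm w)\<^sup>2"
proof (cases "w = 0")
  case False
  let ?v = "w /\<^sub>R norm w"
  have "(norm w)\<^sup>2 *\<^sub>R (1 - 2 *\<^sub>R (?v * ?v)) = (norm w)\<^sup>2 *\<^sub>R 1 - 2 *\<^sub>R (w * w)"
    using False by (simp add: scaleR_diff_right power2_eq_square field_simps)
  then have "norm ((norm w)\<^sup>2 *\<^sub>R 1 - 2 *\<^sub>R (w * w)) = (norm w)\<^sup>2 * norm (1 - 2 *\<^sub>R (?v * ?v))"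
    by (metis abs_of_nonneg norm_scaleR zero_le_power2)
  also have "\<dots> \<le> (norm w)\<^sup>2 * 1"
    by (intro mult_left_mono norm_one_minus_square) (simp_all add: star_scaleR w False)
  finally show ?thesis by simp
qed simp

text \<open>Positivity described by the norm alone: these elements visibly form a cone, and it will contain every
  \<open>star b * b\<close>.\<close>

definition norm_positive :: "'a::{cstar_algebra,monoid_mult} \<Rightarrow> bool" where
  "norm_positive p \<longleftrightarrow> (\<exists>N\<ge>0. norm (N *\<^sub>R 1 - p) \<le> N)"

text \<open>Moving the centre of the ball by \<open>\<bar>t\<bar> *\<^sub>R 1\<close> costs at most
  \<open>\<bar>t\<bar>\<close>, since \<open>norm 1 \<le> 1\<close>. A large \<open>N\<close> will
  keep the coefficient \<open>N - t\<close> nonnegative in the monotonicity proof.\<close>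

lemma norm_positive_above:
  assumes "norm_positive p"
  obtains N where "N \<ge> t" "N \<ge> 0" "norm (N *\<^sub>R 1 - p) \<le> N"
proof -
  obtain N where N: "N \<ge> 0" "norm (N *\<^sub>R 1 - p) \<le> N" using assms norm_positive_def by blast
  have "norm ((N + \<bar>t\<bar>) *\<^sub>R 1 - p) \<le> norm (N *\<^sub>R 1 - p) + \<bar>t\<bar> * norm (1::'a)"
    using norm_triangle_ineq[of "N *\<^sub>R 1 - p" "\<bar>t\<bar> *\<^sub>R 1"] by (simp add: algebra_simps)
  also have "\<dots> \<le> N + \<bar>t\<bar> * 1" by (intro add_mono N mult_left_mono norm_one_le) simp
  finally show ?thesis using N by (intro that[of "N + \<bar>t\<bar>"]) auto
qed

lemma norm_positive_add:
  assumes "norm_positive p" "norm_positive q"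
  shows "norm_positive (p + q)"
proof -
  obtain N N' where N: "N \<ge> 0" "norm (N *\<^sub>R 1 - p) \<le> N" "N' \<ge> 0" "norm (N' *\<^sub>R 1 - q) \<le> N'"
    using assms norm_positive_def by blast
  have "norm ((N + N') *\<^sub>R 1 - (p + q)) \<le> N + N'"
    using norm_triangle_mono[OF N(2,4)] by (simp add: algebra_simps)
  then show ?thesis using N unfolding norm_positive_def by (intro exI[of _ "N + N'"]) simp
qed

lemma norm_positive_square:
  assumes "star w = w"
  shows "norm_positive (w * w)"
proof -
  let ?n = "(norm w)\<^sup>2"
  have "norm (2 *\<^sub>R ((?n / 2) *\<^sub>R 1 - w * w)) \<le> ?n"
    using norm_diff_square[OF assms] by (simp add: scaleR_diff_right)
  then show ?thesis unfolding norm_positive_def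
    by (intro exI[of _ "?n / 2"]) simp
qed

text \<open>Kaplansky's argument: \<open>star c * c\<close> and \<open>c * star c\<close> have the same nonzero spectrum, which in norms amounts
  to evaluating \<open>N - 2 t\<close> on both sides of \<open>star c * (N - 2 (c * star c)) * c\<close>.\<close>

lemma star_mult_self_neq_minus_square:
  fixes c :: "'a::{cstar_algebra,monoid_mult}"
  assumes w: "star w = w" and c: "star c * c = - (w * w)"
  shows "c = 0"
proof -
  define h where "h = w * w"
  define n where "n = (norm w)\<^sup>2"
  have nh: "norm h = n" using norm_square_selfadjoint[OF w] by (simp add: h_def n_def)
  have nc: "(norm c)\<^sup>2 = n" using cstar_identity[of c] nh by (simp add: c h_def)
  have n0: "n \<ge> 0" by (simp add: n_def)
  \<comment> \<open>\<open>s\<close> and \<open>d\<close> are twice the real part and minus twice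
    the imaginary part of \<open>c\<close>. Their squares add up to twice
    \<open>c * star c + star c * c\<close>, so the hypothesis on \<open>star c * c\<close> makes
    \<open>2 *\<^sub>R (c * star c)\<close> a sum of self-adjoint squares.\<close>
  define s where "s = c + star c"
  define d where "d = \<i> *\<^sub>C (c - star c)"
  have s: "star s = s" by (simp add: s_def star_add star_star add.commute)
  have d: "star d = d" by (simp add: d_def star_scaleC star_diff star_star scaleC_minus_left scaleC_diff_right)
  have "d * d = - ((c - star c) * (c - star c))"
    by (simp only: d_def mult_scaleC_left mult_scaleC_right scaleC_ii)
  then have "s * s + d * d = 2 *\<^sub>R (c * star c) + 2 *\<^sub>R (star c * c)"
    by (simp add: s_def algebra_simps scaleR_2)
  then have "2 *\<^sub>R (c * star c) = s * s + d * d + (w * w + w * w)"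
    by (simp add: c scaleR_2 algebra_simps)
  then have "norm_positive (2 *\<^sub>R (c * star c))"
    by (simp add: norm_positive_add norm_positive_square w s d)
  then obtain N where N: "N \<ge> 0" "norm (N *\<^sub>R 1 - 2 *\<^sub>R (c * star c)) \<le> N"
    using norm_positive_def by blast
  have eq: "star c * (N *\<^sub>R 1 - 2 *\<^sub>R (c * star c)) * c = - (N *\<^sub>R h + 2 *\<^sub>R (h * h))"
  proof -
    have "star c * (N *\<^sub>R 1 - 2 *\<^sub>R (c * star c)) * c
        = N *\<^sub>R (star c * c) - 2 *\<^sub>R ((star c * c) * (star c * c))"
      by (simp add: algebra_simps)
    then show ?thesis by (simp add: c h_def)
  qed
  have "norm (star c * (N *\<^sub>R 1 - 2 *\<^sub>R (c * star c)) * c) \<le> norm c * N * norm c"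
    by (intro order_trans[OF norm_mult_ineq] mult_mono N) (simp_all add: N)
  then have 1: "norm (N *\<^sub>R h + 2 *\<^sub>R (h * h)) \<le> n * N"
    unfolding eq norm_minus_cancel by (simp add: nc[symmetric] power2_eq_square mult_ac)
  have "norm (n *\<^sub>R 1 - 2 *\<^sub>R h) \<le> n"
    using norm_diff_square[OF w] by (simp add: h_def n_def)
  then have "norm (h * (n *\<^sub>R 1 - 2 *\<^sub>R h)) \<le> n * n"
    by (intro order_trans[OF norm_mult_ineq] mult_mono) (simp_all add: nh n0)
  then have 2: "norm (n *\<^sub>R h - 2 *\<^sub>R (h * h)) \<le> n * n" by (simp add: algebra_simps)
  have "star h = h" by (simp add: h_def star_mult w)
  then have hh: "norm (h * h) = n\<^sup>2" by (simp add: norm_square_selfadjoint nh)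
  \<comment> \<open>This combination cancels the terms linear in \<open>h\<close>. The two bounds
    then give \<open>(2 * n + 2 * N) * n\<^sup>2 \<le> 2 * N * n\<^sup>2\<close>, which forces
    \<open>n = 0\<close>.\<close>
  have "(2 * n + 2 * N) *\<^sub>R (h * h) = n *\<^sub>R (N *\<^sub>R h + 2 *\<^sub>R (h * h)) - N *\<^sub>R (n *\<^sub>R h - 2 *\<^sub>R (h * h))"
    by (simp add: algebra_simps)
  then have "norm ((2 * n + 2 * N) *\<^sub>R (h * h))
      \<le> norm (n *\<^sub>R (N *\<^sub>R h + 2 *\<^sub>R (h * h))) + norm (N *\<^sub>R (n *\<^sub>R h - 2 *\<^sub>R (h * h)))"
    by (metis norm_triangle_ineq4)
  then have "(2 * n + 2 * N) * n\<^sup>2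
      \<le> n * norm (N *\<^sub>R h + 2 *\<^sub>R (h * h)) + N * norm (n *\<^sub>R h - 2 *\<^sub>R (h * h))"
    using n0 N(1) by (simp add: hh)
  also have "\<dots> \<le> n * (n * N) + N * (n * n)"
    using 1 2 n0 N(1) by (intro add_mono mult_left_mono) auto
  finally have "2 * n * n\<^sup>2 \<le> 0" by (simp add: algebra_simps power2_eq_square)
  then have "n = 0" using n0 by (simp add: zero_less_mult_iff mult_le_0_iff power2_eq_square)
  then show ?thesis using nc by simp
qed

text \<open>For \<open>h = star b * b\<close> put \<open>\<bar>h\<bar> = sqrt (h\<^sup>2)\<close>. The negative part \<open>m = \<bar>h\<bar> - h\<close> makes
  \<open>c = b * m\<close> satisfy \<open>star c * c = - m * \<bar>h\<bar> * m\<close>, so it vanishes.\<close>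

lemma star_mult_self_eq_square_contraction:
  fixes b :: "'a::{cstar_algebra,monoid_mult}"
  assumes b: "norm b \<le> 1"
  obtains q where "star q = q" "star b * b = q * q"
proof -
  define h where "h = star b * b"
  have h: "star h = h" by (simp add: h_def star_mult star_star)
  have "norm h \<le> 1" using b by (simp add: h_def cstar_identity power_le_one)
  then have "norm (1 - 2 *\<^sub>R (h * h)) \<le> 1" by (rule norm_one_minus_square[OF h])
  \<comment> \<open>\<open>1 - h * h\<close> is the mean of \<open>1\<close> and
    \<open>1 - 2 *\<^sub>R (h * h)\<close>, hence also in the unit ball, so \<open>h * h\<close> has
    a square root.\<close>
  then have "norm (1 + (1 - 2 *\<^sub>R (h * h))) \<le> 1 + 1"
    by (intro norm_triangle_mono norm_one_le)
  also have "1 + (1 - 2 *\<^sub>R (h * h)) = 2 *\<^sub>R (1 - h * h)" by (simp add: scaleR_diff_right scaleR_2)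
  finally have "norm (1 - h * h) \<le> 1" by simp
  moreover have "star (h * h) = h * h" by (simp add: star_mult h)
  ultimately obtain a where a: "a * a = h * h" "star a = a" "norm (1 - a) \<le> 1"
    and comm_a: "\<And>x. h * h * x = x * (h * h) \<Longrightarrow> a * x = x * a"
    using norm_positive_sqrt by metis
  \<comment> \<open>\<open>a\<close> is the absolute value of \<open>h\<close> and \<open>q\<close>
    is the root of \<open>a\<close>; the commutation clauses make \<open>h\<close>, \<open>a\<close>
    and \<open>q\<close> commute pairwise.\<close>
  have ah: "a * h = h * a" by (rule comm_a) (simp add: mult.assoc)
  obtain q where q: "q * q = a" "star q = q" and comm_q: "\<And>x. a * x = x * a \<Longrightarrow> q * x = x * q"
    using norm_positive_sqrt[OF a(3,2)] by metis
  have qh: "q * h = h * q" by (rule comm_q[OF ah])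
  have qa: "q * a = a * q" by (rule comm_q) simp
  define m where "m = a - h"
  have m: "star m = m" by (simp add: m_def star_diff a(2) h)
  have mh: "h * m = - (a * m)" by (simp add: m_def algebra_simps a(1) ah)
  have qm: "q * m = m * q" by (simp add: m_def algebra_simps qh qa)
  \<comment> \<open>Since \<open>q\<close> commutes with \<open>m\<close>, the square of
    \<open>w\<close> is \<open>m * a * m\<close>. Thus \<open>star (b * m) * (b * m)\<close> is
    minus the square of a self-adjoint element.\<close>
  define w where "w = m * q"
  have w: "star w = w" by (simp add: w_def star_mult m q qm)
  have ww: "w * w = m * a * m" 
    by (metis mult.assoc q(1) qm w_def)
  have "star (b * m) * (b * m) = m * (h * m)" by (simp add: star_mult m h_def mult.assoc)
  also have "\<dots> = - (w * w)" by (simp add: mh ww mult.assoc)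
  finally have "b * m = 0" using star_mult_self_neq_minus_square[OF w] by blast
  \<comment> \<open>From \<open>b * m = 0\<close> follow \<open>h * m = 0\<close> and
    \<open>a * m = 0\<close>. Hence \<open>m * m = 0\<close>, so \<open>m = 0\<close> and
    \<open>h = a = q * q\<close>.\<close>
  then have hm: "h * m = 0" by (simp add: h_def mult.assoc)
  then have am: "a * m = 0" using mh by simp
  have "m * m = a * m - h * m" by (simp add: m_def left_diff_distrib)
  then have "star m * m = 0" using hm am by (simp add: m)
  then have "m = 0" using cstar_identity[of m] by simp
  then show ?thesis using q(1,2) by (intro that[of q]) (simp_all add: m_def h_def)
qed

lemma star_mult_self_eq_square:
  fixes b :: "'a::{cstar_algebra,monoid_mult}"
  obtains q where "star q = q" "star b * b = q * q"
proof (cases "b = 0")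
  case True
  then show ?thesis by (intro that[of 0]) auto
next
  case False
  define v where "v = b /\<^sub>R norm b"
  obtain q where q: "star q = q" "star v * v = q * q"
    using star_mult_self_eq_square_contraction[of v] False by (auto simp: v_def)
  have "b = norm b *\<^sub>R v" using False by (simp add: v_def)
  then have "star b * b = (norm b *\<^sub>R q) * (norm b *\<^sub>R q)"
    by (metis (no_types) mult_scaleR_left mult_scaleR_right q(2) star_scaleR)
  then show ?thesis by (intro that[of "norm b *\<^sub>R q"]) (simp_all add: star_scaleR q)
qed

lemma norm_positive_star_mult_self: "norm_positive (star b * b)"
  by (metis norm_positive_square star_mult_self_eq_square)

text \<open>Put \<open>t = (norm c)\<^sup>2\<close> and \<open>h = star a * a\<close>. Then
  \<open>t *\<^sub>R 1 - h\<close> is \<open>t *\<^sub>R 1 - star c * c\<close> plus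
  \<open>p\<close>, hence norm-positive; together with the bound \<open>norm_diff_square\<close> for
  \<open>h\<close> this forces \<open>norm h \<le> t\<close>.\<close>

lemma norm_star_mult_self_mono:
  fixes a c p :: "'a::{cstar_algebra,monoid_mult}"
  assumes eq: "star c * c = star a * a + p" and p: "norm_positive p"
  shows "norm a \<le> norm c"
proof (cases "a = 0")
  case False
  obtain q where q: "star q = q" "star c * c = q * q" by (rule star_mult_self_eq_square)
  obtain w where w: "star w = w" "star a * a = w * w" by (rule star_mult_self_eq_square)
  define t where "t = (norm c)\<^sup>2"
  define h where "h = w * w"
  define n where "n = (norm a)\<^sup>2"
  have t: "t = (norm q)\<^sup>2" using cstar_identity[of c] by (simp add: t_def q norm_square_selfadjoint)
  have n: "n = (norm w)\<^sup>2" using cstar_identity[of a] by (simp add: n_def w norm_square_selfadjoint)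
  have nh: "norm h = n" by (simp add: h_def n norm_square_selfadjoint w)
  have n0: "n > 0" using False by (simp add: n_def)
  have "norm_positive (t *\<^sub>R 1 - q * q)"
    unfolding norm_positive_def
    by (intro exI[of _ t]) (simp add: t norm_square_selfadjoint q)
  then have "norm_positive (t *\<^sub>R 1 - q * q + p)" using p by (rule norm_positive_add)
  also have "t *\<^sub>R 1 - q * q + p = t *\<^sub>R 1 - h" using eq by (simp add: q w h_def algebra_simps)
  finally obtain N where N: "N \<ge> t" "norm (N *\<^sub>R 1 - (t *\<^sub>R 1 - h)) \<le> N" "N \<ge> 0"
    by (metis norm_positive_above)
  have "norm (h * (N *\<^sub>R 1 - (t *\<^sub>R 1 - h))) \<le> n * N"
    by (intro order_trans[OF norm_mult_ineq] mult_mono N) (use n0 nh in simp_all)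
  then have 1: "norm ((N - t) *\<^sub>R h + h * h) \<le> n * N" by (simp add: algebra_simps)
  have "norm (n *\<^sub>R 1 - 2 *\<^sub>R h) \<le> n"
    using norm_diff_square[OF w(1)] by (simp add: h_def n)
  then have "norm (h * (n *\<^sub>R 1 - 2 *\<^sub>R h)) \<le> n * n"
    using n0 by (intro order_trans[OF norm_mult_ineq] mult_mono) (simp_all add: nh)
  then have 2: "norm (n *\<^sub>R h - 2 *\<^sub>R (h * h)) \<le> n * n" by (simp add: algebra_simps)
  have "star h = h" by (simp add: h_def star_mult w)
  then have hh: "norm (h * h) = n\<^sup>2" by (simp add: norm_square_selfadjoint nh)
  \<comment> \<open>Again the linear terms cancel. What remains after dividing by
    \<open>n\<^sup>2\<close> is \<open>n + 2 * (N - t) \<le> N + (N - t)\<close>, that is,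
    \<open>n \<le> t\<close>.\<close>
  have "(n + 2 * (N - t)) *\<^sub>R (h * h)
      = n *\<^sub>R ((N - t) *\<^sub>R h + h * h) - (N - t) *\<^sub>R (n *\<^sub>R h - 2 *\<^sub>R (h * h))"
    by (simp add: algebra_simps)
  then have "norm ((n + 2 * (N - t)) *\<^sub>R (h * h))
      \<le> norm (n *\<^sub>R ((N - t) *\<^sub>R h + h * h)) + norm ((N - t) *\<^sub>R (n *\<^sub>R h - 2 *\<^sub>R (h * h)))"
    by (metis norm_triangle_ineq4)
  then have "(n + 2 * (N - t)) * n\<^sup>2
      \<le> n * norm ((N - t) *\<^sub>R h + h * h) + (N - t) * norm (n *\<^sub>R h - 2 *\<^sub>R (h * h))"
    using n0 N(1) by (simp add: hh)
  also have "\<dots> \<le> n * (n * N) + (N - t) * (n * n)"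
    using 1 2 n0 N(1) by (intro add_mono mult_left_mono) auto
  finally have "(n + 2 * (N - t)) * n\<^sup>2 \<le> (N + (N - t)) * n\<^sup>2"
    by (simp add: algebra_simps power2_eq_square)
  then have "n \<le> t" using n0 by simp
  then show ?thesis unfolding n_def t_def by (rule power2_le_imp_le) simp
qed simp

section \<open>Return to algebras that may lack a unit\<close>

lemma norm_positive_left_mult: "cstar_positive p \<Longrightarrow> norm_positive (left_mult p)"
  by (auto simp: cstar_positive_def left_mult_mult left_mult_star norm_positive_star_mult_self)

lemma cstar_positive_norm_mono:
  assumes "cstar_positive p" "cstar_positive q" "cstar_positive (p + q)"
  shows "norm p \<le> norm (p + q)"
proof -
  obtain a c where a: "p = star a * a" and c: "p + q = star c * c"
    using assms by (auto simp: cstar_positive_def)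
  have "star (left_mult c) * left_mult c = star (left_mult a) * left_mult a + left_mult q"
    by (metis a c left_mult_add left_mult_mult left_mult_star)
  then have "norm a \<le> norm c"
    using norm_star_mult_self_mono[OF _ norm_positive_left_mult[OF assms(2)]] by fastforce
  moreover have "norm p = (norm a)\<^sup>2" by (simp only: a cstar_identity)
  moreover have "norm (p + q) = (norm c)\<^sup>2" by (simp only: c cstar_identity)
  ultimately show ?thesis by simp
qed

text \<open>The estimate behind the Cauchy--Schwarz inequality: \<open>d\<close> is the square of
  \<open>y - x \<langle>x, y\<rangle>\<close> when \<open>p = \<langle>x, x\<rangle>\<close>, \<open>q = \<langle>y, y\<rangle>\<close> and \<open>a = \<langle>x, y\<rangle>\<close>.\<close>

lemma cstar_cauchy_schwarz_aux:
  fixes a p q d :: "'a::cstar_algebra"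
  assumes pos: "cstar_positive p" "cstar_positive q" "cstar_positive d"
    and p: "norm p \<le> 1" and d: "d = q - 2 *\<^sub>R (star a * a) + star a * p * a"
  shows "(norm a)\<^sup>2 \<le> norm q"
proof -
  obtain b c where b: "p = star b * b" and c: "q = star c * c"
    using pos by (auto simp: cstar_positive_def)
  let ?p = "left_mult p" and ?a = "left_mult a"
  have "star ?p = ?p" by (simp add: b star_mult star_star flip: left_mult_star)
  then have "star (1 - ?p) = 1 - ?p" by (simp add: star_diff)
  moreover have "norm (1 - (1 - ?p)) \<le> 1" using p by simp
  \<comment> \<open>With this root, \<open>?a\<close> gives
    \<open>star ?a * ?a - star ?a * ?p * ?a = star (s * ?a) * (s * ?a)\<close>. So \<open>q\<close>
    exceeds \<open>star a * a\<close> by \<open>d\<close> plus a square, and monotonicity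
    applies.\<close>
  ultimately obtain s where s: "s * s = 1 - ?p" "star s = s"
    using norm_positive_sqrt by metis
  have "star (s * ?a) * (s * ?a) = star ?a * (s * s) * ?a"
    by (simp only: star_mult s(2) mult.assoc)
  also have "\<dots> = star ?a * ?a - star ?a * ?p * ?a" by (simp add: s algebra_simps)
  finally have "star ?a * ?a - star ?a * ?p * ?a = star (s * ?a) * (s * ?a)" ..
  then have "norm_positive (star ?a * ?a - star ?a * ?p * ?a)"
    by (simp only: norm_positive_star_mult_self)
  then have "norm_positive (left_mult d + (star ?a * ?a - star ?a * ?p * ?a))"
    using norm_positive_left_mult[OF pos(3)] norm_positive_add by blast
  moreover have "star (left_mult c) * left_mult c
      = star ?a * ?a + (left_mult d + (star ?a * ?a - star ?a * ?p * ?a))"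
    by (simp add: d c scaleR_2 left_mult_add left_mult_diff flip: left_mult_star left_mult_mult)
  ultimately have "norm ?a \<le> norm (left_mult c)" using norm_star_mult_self_mono by blast
  then have "norm a \<le> norm c" by simp
  then show ?thesis by (simp add: c cstar_identity power_mono)
qed

section \<open>Hilbert modules\<close>

text \<open>The arguments by density and orthogonality use only differences. Scalars and the action
  join later, in \<open>hm_submodule\<close>.\<close>

definition additive_subgroup ::
    "('a, 'x::ab_group_add, 'b) hmod_scheme \<Rightarrow> 'x set \<Rightarrow> bool" where
  "additive_subgroup X S \<longleftrightarrow> S \<subseteq> carr X \<and> 0 \<in> S \<and> (\<forall>x\<in>S. \<forall>y\<in>S. x - y \<in> S)"

definition orthogonal_sets ::
    "('a::zero, 'x, 'b) hmod_scheme \<Rightarrow> 'x set \<Rightarrow> 'x set \<Rightarrow> bool" where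
  "orthogonal_sets X S S' \<longleftrightarrow> (\<forall>x\<in>S. \<forall>y\<in>S'. ip X x y = 0)"

definition set_sum :: "'x::plus set \<Rightarrow> 'x set \<Rightarrow> 'x set" where
  "set_sum S S' = {x + y | x y. x \<in> S \<and> y \<in> S'}"

lemma additive_subgroup_uminus: "additive_subgroup X S \<Longrightarrow> x \<in> S \<Longrightarrow> - x \<in> S"
  unfolding additive_subgroup_def by (metis diff_0)

lemma additive_subgroup_add: "additive_subgroup X S \<Longrightarrow> x \<in> S \<Longrightarrow> y \<in> S \<Longrightarrow> x + y \<in> S"
  using additive_subgroup_uminus[of X S y] unfolding additive_subgroup_def
  by (metis diff_minus_eq_add)

context hilbert_module
begin

lemma diff_closed: "x \<in> carr X \<Longrightarrow> y \<in> carr X \<Longrightarrow> x - y \<in> carr X"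
  using add_closed[of x "- y"] uminus_closed by simp

lemma sum_closed: "(\<And>i. i \<in> I \<Longrightarrow> f i \<in> carr X) \<Longrightarrow> sum f I \<in> carr X"
  by (induction I rule: infinite_finite_induct) (auto simp: zero_closed add_closed)

lemma sum_list_closed: "set xs \<subseteq> carr X \<Longrightarrow> sum_list xs \<in> carr X"
  by (induction xs) (auto simp: zero_closed add_closed)

lemmas closed = zero_closed add_closed uminus_closed diff_closed scal_closed act_closed sum_closed

lemma ip_zero_right [simp]: "x \<in> carr X \<Longrightarrow> ip X x 0 = 0"
  using ip_add[of x 0 0] by (simp add: zero_closed)

lemma ip_minus_right: "x \<in> carr X \<Longrightarrow> y \<in> carr X \<Longrightarrow> ip X x (- y) = - ip X x y"
  using ip_add[of x y "- y"] by (simp add: closed eq_neg_iff_add_eq_0 add.commute)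

lemma ip_diff_right:
  "x \<in> carr X \<Longrightarrow> y \<in> carr X \<Longrightarrow> z \<in> carr X \<Longrightarrow> ip X x (y - z) = ip X x y - ip X x z"
  using ip_add[of x y "- z"] by (simp add: closed ip_minus_right)

lemma ip_zero_left [simp]: "x \<in> carr X \<Longrightarrow> ip X 0 x = 0"
  using ip_star[of x 0] by (simp add: zero_closed)

lemma ip_add_left:
  "x \<in> carr X \<Longrightarrow> y \<in> carr X \<Longrightarrow> z \<in> carr X \<Longrightarrow> ip X (x + y) z = ip X x z + ip X y z"
  using ip_star[of z "x + y"] ip_star[of z x] ip_star[of z y] by (simp add: closed ip_add star_add)

lemma ip_minus_left: "x \<in> carr X \<Longrightarrow> y \<in> carr X \<Longrightarrow> ip X (- x) y = - ip X x y"
  using ip_star[of y "- x"] ip_star[of y x] by (simp add: closed ip_minus_right star_minus)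

lemma ip_diff_left:
  "x \<in> carr X \<Longrightarrow> y \<in> carr X \<Longrightarrow> z \<in> carr X \<Longrightarrow> ip X (x - y) z = ip X x z - ip X y z"
  using ip_add_left[of x "- y" z] by (simp add: closed ip_minus_left)

lemma ip_scal_left:
  "x \<in> carr X \<Longrightarrow> y \<in> carr X \<Longrightarrow> ip X (scal X c x) y = cnj c *\<^sub>C ip X x y"
  using ip_star[of y "scal X c x"] ip_star[of y x] by (simp add: closed ip_scal star_scaleC)

lemma ip_act_left:
  "x \<in> carr X \<Longrightarrow> y \<in> carr X \<Longrightarrow> ip X (act X x a) y = star a * ip X x y"
  using ip_star[of y "act X x a"] ip_star[of y x] by (simp add: closed ip_act star_mult)

lemmas ip_simps = ip_add ip_add_left ip_diff_right ip_diff_left ip_minus_right ip_minus_left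
  ip_scal ip_scal_left ip_act ip_act_left

lemma ip_sum_right:
  "x \<in> carr X \<Longrightarrow> (\<And>i. i \<in> I \<Longrightarrow> f i \<in> carr X) \<Longrightarrow> ip X x (sum f I) = (\<Sum>i\<in>I. ip X x (f i))"
  by (induction I rule: infinite_finite_induct) (auto simp: closed ip_add)

lemma ip_sum_left:
  "x \<in> carr X \<Longrightarrow> (\<And>i. i \<in> I \<Longrightarrow> f i \<in> carr X) \<Longrightarrow> ip X (sum f I) x = (\<Sum>i\<in>I. ip X (f i) x)"
  by (induction I rule: infinite_finite_induct) (auto simp: closed ip_add_left)

lemma ip_commute_zero: "x \<in> carr X \<Longrightarrow> y \<in> carr X \<Longrightarrow> ip X x y = 0 \<longleftrightarrow> ip X y x = 0"
  by (metis ip_star star_zero)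

section \<open>Norm, limits and closures in a Hilbert module\<close>

lemma hnorm_nonneg [simp]: "0 \<le> hnorm X x"
  by (simp add: hnorm_def)

lemma hnorm_square: "(hnorm X x)\<^sup>2 = norm (ip X x x)"
  by (simp add: hnorm_def)

lemma hnorm_zero [simp]: "hnorm X 0 = 0"
  by (simp add: hnorm_def zero_closed)

lemma hnorm_eq_zero: "x \<in> carr X \<Longrightarrow> hnorm X x = 0 \<longleftrightarrow> x = 0"
  by (auto simp: hnorm_def zero_closed dest: ip_definite)

lemma hnorm_minus: "x \<in> carr X \<Longrightarrow> hnorm X (- x) = hnorm X x"
  by (simp add: hnorm_def ip_simps closed)

lemma hnorm_minus_commute: "x \<in> carr X \<Longrightarrow> y \<in> carr X \<Longrightarrow> hnorm X (x - y) = hnorm X (y - x)"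
  using hnorm_minus[of "x - y"] by (simp add: closed)

lemma hnorm_scal: "x \<in> carr X \<Longrightarrow> hnorm X (scal X c x) = cmod c * hnorm X x"
  by (simp add: hnorm_def ip_simps closed norm_scaleC real_sqrt_mult flip: power2_eq_square mult.assoc)

text \<open>The element \<open>ip X x x\<close> need not be invertible, so \<open>y\<close> cannot
  be projected along \<open>x\<close> exactly. A real scaling of \<open>x\<close> to norm one
  suffices for the auxiliary estimate, applied to the residue \<open>z\<close>.\<close>

lemma cauchy_schwarz:
  assumes x: "x \<in> carr X" and y: "y \<in> carr X"
  shows "norm (ip X x y) \<le> hnorm X x * hnorm X y"
proof (cases "x = 0")
  case False
  define r where "r = hnorm X x"
  have r: "r > 0" using False hnorm_eq_zero[OF x] by (simp add: r_def order_less_le)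
  define x' where "x' = scal X (complex_of_real (inverse r)) x"
  have x': "x' \<in> carr X" using x by (simp add: x'_def closed)
  have "hnorm X x' = 1" using r by (simp add: x'_def hnorm_scal x r_def norm_inverse)
  then have n1: "norm (ip X x' x') \<le> 1" using hnorm_square[of x'] by simp
  define a where "a = ip X x' y"
  define z where "z = y - act X x' a"
  have z: "z \<in> carr X" using x' y by (simp add: z_def closed)
  have yx: "ip X y x' = star a" using ip_star[OF x' y] by (simp add: a_def)
  have "ip X z z = ip X y y - 2 *\<^sub>R (star a * a) + star a * ip X x' x' * a"
    by (simp add: z_def ip_simps closed x' y yx algebra_simps scaleR_2 flip: a_def)
  then have "(norm a)\<^sup>2 \<le> norm (ip X y y)"
    using cstar_cauchy_schwarz_aux[OF ip_positive[OF x'] ip_positive[OF y] ip_positive[OF z] n1] by blast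
  then have "(norm a)\<^sup>2 \<le> (hnorm X y)\<^sup>2" by (simp add: hnorm_square)
  then have "norm a \<le> hnorm X y" by (rule power2_le_imp_le) simp
  moreover have "norm a = norm (ip X x y) / r"
    using r by (simp add: a_def x'_def ip_simps x y norm_scaleC norm_inverse divide_inverse mult.commute)
  ultimately show ?thesis using r by (simp add: r_def divide_le_eq mult.commute)
qed (simp add: y)

lemma hnorm_triangle:
  assumes x: "x \<in> carr X" and y: "y \<in> carr X"
  shows "hnorm X (x + y) \<le> hnorm X x + hnorm X y"
proof -
  have "(hnorm X (x + y))\<^sup>2 = norm ((ip X x x + ip X x y) + (ip X y x + ip X y y))"
    by (simp add: hnorm_square ip_simps closed x y algebra_simps)
  also have "\<dots> \<le> ((hnorm X x)\<^sup>2 + hnorm X x * hnorm X y) + (hnorm X y * hnorm X x + (hnorm X y)\<^sup>2)"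
    by (intro norm_triangle_mono cauchy_schwarz x y) (simp_all add: hnorm_square)
  also have "\<dots> = (hnorm X x + hnorm X y)\<^sup>2" by (simp add: power2_eq_square algebra_simps)
  finally show ?thesis by (rule power2_le_imp_le) simp
qed

lemma hnorm_diff_triangle:
  assumes "x \<in> carr X" "y \<in> carr X" "z \<in> carr X"
  shows "hnorm X (x - z) \<le> hnorm X (x - y) + hnorm X (y - z)"
  using hnorm_triangle[of "x - y" "y - z"] assms by (simp add: closed)

text \<open>Pairing \<open>x + y\<close> with \<open>x\<close> returns \<open>ip X x x\<close>, and
  Cauchy--Schwarz divides out one factor \<open>hnorm X x\<close>. This plays the role of
  contractivity of an orthogonal projection.\<close>

lemma hnorm_le_add_orthogonal:
  assumes x: "x \<in> carr X" and y: "y \<in> carr X" and xy: "ip X x y = 0"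
  shows "hnorm X x \<le> hnorm X (x + y)"
proof (cases "hnorm X x = 0")
  case False
  have "hnorm X x * hnorm X x = norm (ip X x (x + y))"
    using hnorm_square[of x] by (simp add: ip_simps x y xy power2_eq_square)
  also have "\<dots> \<le> hnorm X x * hnorm X (x + y)" by (intro cauchy_schwarz closed x y)
  finally show ?thesis using False hnorm_nonneg[of x] by (simp add: mult_le_cancel_left)
qed simp

lemma hm_lim_const: "x \<in> carr X \<Longrightarrow> hm_lim X (\<lambda>_. x) x"
  by (simp add: hm_lim_def)

lemma hm_lim_add:
  assumes f: "hm_lim X f x" "\<And>n. f n \<in> carr X" and g: "hm_lim X g y" "\<And>n. g n \<in> carr X"
  shows "hm_lim X (\<lambda>n. f n + g n) (x + y)"
  unfolding hm_lim_def
proof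
  have xy: "x \<in> carr X" "y \<in> carr X" using f g by (auto simp: hm_lim_def)
  then show "x + y \<in> carr X" by (simp add: closed)
  have "(\<lambda>n. hnorm X (f n - x) + hnorm X (g n - y)) \<longlonglongrightarrow> 0 + 0"
    using f g by (intro tendsto_add) (auto simp: hm_lim_def)
  then have lim: "(\<lambda>n. hnorm X (f n - x) + hnorm X (g n - y)) \<longlonglongrightarrow> 0" by simp
  show "(\<lambda>n. hnorm X (f n + g n - (x + y))) \<longlonglongrightarrow> 0"
  proof (rule tendsto_sandwich[OF _ _ tendsto_const lim])
    have "hnorm X (f n + g n - (x + y)) \<le> hnorm X (f n - x) + hnorm X (g n - y)" for n
      using hnorm_triangle[of "f n - x" "g n - y"] f g xy by (simp add: closed algebra_simps)
    then show "\<forall>\<^sub>F n in sequentially. hnorm X (f n + g n - (x + y)) \<le> hnorm X (f n - x) + hnorm X (g n - y)"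
      by simp
  qed simp
qed

lemma hm_lim_uminus:
  assumes f: "hm_lim X f x" "\<And>n. f n \<in> carr X"
  shows "hm_lim X (\<lambda>n. - f n) (- x)"
proof -
  have x: "x \<in> carr X" using f by (simp add: hm_lim_def)
  have "hnorm X (- f n - - x) = hnorm X (f n - x)" for n
    using hnorm_minus_commute[OF x f(2)] by simp
  then show ?thesis using f x by (simp add: hm_lim_def closed)
qed

lemma hm_lim_diff:
  assumes f: "hm_lim X f x" "\<And>n. f n \<in> carr X" and g: "hm_lim X g y" "\<And>n. g n \<in> carr X"
  shows "hm_lim X (\<lambda>n. f n - g n) (x - y)"
  using hm_lim_add[OF f hm_lim_uminus[OF g]] g by (simp add: closed)

lemma scal_minus_one: "x \<in> carr X \<Longrightarrow> scal X (-1) x = - x"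
proof -
  assume x: "x \<in> carr X"
  have "scal X 0 x = 0" using scal_add_left[OF x, of 0 0] by simp
  then show ?thesis
    using scal_add_left[OF x, of 1 "-1"] scal_one[OF x] by (simp add: eq_neg_iff_add_eq_0 add.commute)
qed

lemma hm_lim_scal:
  assumes f: "hm_lim X f x" "\<And>n. f n \<in> carr X"
  shows "hm_lim X (\<lambda>n. scal X c (f n)) (scal X c x)"
proof -
  have x: "x \<in> carr X" using f by (simp add: hm_lim_def)
  have "hnorm X (scal X c (f n) - scal X c x) = cmod c * hnorm X (f n - x)" for n
  proof -
    have "scal X c (f n - x) = scal X c (f n) + scal X c (scal X (-1) x)"
      using scal_add_right[of "f n" "- x" c] f x by (simp add: closed scal_minus_one)
    also have "scal X c (scal X (-1) x) = - scal X c x"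
      using scal_scal[OF x, of "-1" c] scal_scal[OF x, of c "-1"] x by (simp add: scal_minus_one closed)
    finally show ?thesis using hnorm_scal[of "f n - x" c] f x by (simp add: closed)
  qed
  then show ?thesis
    using f x tendsto_mult_left[of "\<lambda>n. hnorm X (f n - x)" 0 sequentially "cmod c"]
    by (simp add: hm_lim_def closed)
qed

lemma hm_lim_act:
  assumes f: "hm_lim X f x" "\<And>n. f n \<in> carr X"
  shows "hm_lim X (\<lambda>n. act X (f n) a) (act X x a)"
proof -
  have x: "x \<in> carr X" using f by (simp add: hm_lim_def)
  have le: "hnorm X (act X (f n) a - act X x a) \<le> norm a * hnorm X (f n - x)" for n
  proof -
    have c: "f n - x \<in> carr X" using f x by (simp add: closed)
    have "act X (f n) a = act X (f n - x) a + act X x a"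
      using act_add_left[OF c x, of a] by simp
    then have eq: "act X (f n) a - act X x a = act X (f n - x) a" by simp
    have "(hnorm X (act X (f n - x) a))\<^sup>2 = norm (star a * ip X (f n - x) (f n - x) * a)"
      by (simp only: hnorm_square ip_act ip_act_left c closed)
    also have "\<dots> \<le> norm a * norm (ip X (f n - x) (f n - x)) * norm a"
      using norm_mult_ineq[of "star a * ip X (f n - x) (f n - x)" a]
        mult_right_mono[OF norm_mult_ineq[of "star a" "ip X (f n - x) (f n - x)"], of "norm a"]
      by simp
    also have "\<dots> = (norm a * hnorm X (f n - x))\<^sup>2"
      by (simp add: power_mult_distrib hnorm_square power2_eq_square[of "norm a"])
    finally show ?thesis unfolding eq by (rule power2_le_imp_le) simp
  qed
  have lim: "(\<lambda>n. norm a * hnorm X (f n - x)) \<longlonglongrightarrow> 0"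
    using f tendsto_mult_left[of "\<lambda>n. hnorm X (f n - x)" 0 sequentially "norm a"]
    by (simp add: hm_lim_def)
  have "(\<lambda>n. hnorm X (act X (f n) a - act X x a)) \<longlonglongrightarrow> 0"
    by (rule tendsto_sandwich[OF _ _ tendsto_const lim]) (simp_all add: le)
  then show ?thesis using x by (simp add: hm_lim_def closed)
qed

lemma hm_lim_Cauchy:
  assumes f: "hm_lim X f x" "\<And>n. f n \<in> carr X"
  shows "hm_Cauchy X f"
  unfolding hm_Cauchy_def
proof (intro allI impI)
  fix e :: real assume "e > 0"
  have x: "x \<in> carr X" using f by (simp add: hm_lim_def)
  obtain N where N: "hnorm X (f n - x) < e / 2" if "n \<ge> N" for n
    using f(1) \<open>e > 0\<close> LIMSEQ_D[of "\<lambda>n. hnorm X (f n - x)" 0 "e / 2"] by (auto simp: hm_lim_def)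
  have "hnorm X (f m - f n) < e" if "m \<ge> N" "n \<ge> N" for m n
    using hnorm_diff_triangle[of "f m" x "f n"] N[OF that(1)] N[OF that(2)]
      hnorm_minus_commute[of x "f n"] f x by simp
  then show "\<exists>N. \<forall>m\<ge>N. \<forall>n\<ge>N. hnorm X (f m - f n) < e" by blast
qed

lemma ip_tendsto:
  assumes f: "hm_lim X f x" "\<And>n. f n \<in> carr X" and g: "hm_lim X g y" "\<And>n. g n \<in> carr X"
  shows "(\<lambda>n. ip X (f n) (g n)) \<longlonglongrightarrow> ip X x y"
proof -
  have x: "x \<in> carr X" and y: "y \<in> carr X" using f g by (auto simp: hm_lim_def)
  have le: "norm (ip X (f n) (g n) - ip X x y)
      \<le> hnorm X (f n - x) * hnorm X (g n - y) + hnorm X (f n - x) * hnorm X y + hnorm X x * hnorm X (g n - y)" for n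
  proof -
    have "ip X (f n) (g n) - ip X x y = ip X (f n - x) (g n - y) + ip X (f n - x) y + ip X x (g n - y)"
      by (simp add: ip_simps closed x y f g)
    also have "norm \<dots> \<le> hnorm X (f n - x) * hnorm X (g n - y) + hnorm X (f n - x) * hnorm X y + hnorm X x * hnorm X (g n - y)"
      by (intro norm_triangle_mono cauchy_schwarz closed x y f g)
    finally show ?thesis .
  qed
  have "(\<lambda>n. hnorm X (f n - x) * hnorm X (g n - y) + hnorm X (f n - x) * hnorm X y + hnorm X x * hnorm X (g n - y))
      \<longlonglongrightarrow> 0 * 0 + 0 * hnorm X y + hnorm X x * 0"
    using f g by (intro tendsto_intros) (auto simp: hm_lim_def)
  then have lim: "(\<lambda>n. hnorm X (f n - x) * hnorm X (g n - y) + hnorm X (f n - x) * hnorm X y + hnorm X x * hnorm X (g n - y)) \<longlonglongrightarrow> 0"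
    by simp
  have "(\<lambda>n. ip X (f n) (g n) - ip X x y) \<longlonglongrightarrow> 0"
    by (rule Lim_null_comparison[OF _ lim]) (simp add: le)
  then show ?thesis by (simp add: LIM_zero_iff)
qed

lemma hm_lim_unique:
  assumes f: "hm_lim X f x" "hm_lim X f y" "\<And>n. f n \<in> carr X"
  shows "x = y"
proof -
  have xy: "x \<in> carr X" "y \<in> carr X" using f by (auto simp: hm_lim_def)
  have "hm_lim X (\<lambda>n. f n - f n) (x - y)" by (intro hm_lim_diff f)
  then have "(\<lambda>n::nat. hnorm X (- (x - y))) \<longlonglongrightarrow> 0" by (simp add: hm_lim_def)
  then have "hnorm X (- (x - y)) = 0" using LIMSEQ_const_iff by blast
  then show ?thesis using hnorm_eq_zero[of "y - x"] xy by (simp add: closed)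
qed

lemma hm_suminf_eq:
  assumes "hm_sums X f s" "\<And>n. f n \<in> carr X"
  shows "hm_suminf X f = s"
  unfolding hm_suminf_def
proof (rule the_equality)
  show "t = s" if "hm_sums X f t" for t
    using that assms hm_lim_unique[of "\<lambda>n. sum f {..<n}"] by (auto simp: hm_sums_def closed)
qed (rule assms)

lemma hm_closure_iff:
  assumes S: "S \<subseteq> carr X"
  shows "x \<in> hm_closure X S \<longleftrightarrow> (\<exists>f. (\<forall>n. f n \<in> S) \<and> hm_lim X f x)"
proof
  assume x: "x \<in> hm_closure X S"
  then have "\<exists>s\<in>S. hnorm X (x - s) < inverse (real (Suc n))" for n
    by (simp add: hm_closure_def)
  then obtain f where f: "\<And>n. f n \<in> S" "\<And>n. hnorm X (x - f n) < inverse (real (Suc n))" by metis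
  have le: "hnorm X (f n - x) \<le> inverse (real (Suc n))" for n
    using f[of n] S x hnorm_minus_commute[of x "f n"] by (auto simp: hm_closure_def)
  have "(\<lambda>n. hnorm X (f n - x)) \<longlonglongrightarrow> 0"
    by (rule tendsto_sandwich[OF _ _ tendsto_const LIMSEQ_inverse_real_of_nat])
       (simp_all add: le del: of_nat_Suc)
  then show "\<exists>f. (\<forall>n. f n \<in> S) \<and> hm_lim X f x"
    using f x by (auto simp: hm_lim_def hm_closure_def)
next
  assume "\<exists>f. (\<forall>n. f n \<in> S) \<and> hm_lim X f x"
  then obtain f where f: "\<And>n. f n \<in> S" "hm_lim X f x" by blast
  have x: "x \<in> carr X" using f by (simp add: hm_lim_def)
  have "\<exists>s\<in>S. hnorm X (x - s) < e" if "e > 0" for e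
  proof -
    obtain n where "hnorm X (f n - x) < e"
      using f(2) \<open>e > 0\<close> LIMSEQ_D[of "\<lambda>n. hnorm X (f n - x)" 0 e] by (auto simp: hm_lim_def)
    moreover have "f n \<in> carr X" using f(1) S by blast
    ultimately show ?thesis using f(1) hnorm_minus_commute[OF x] by (intro bexI[of _ "f n"]) auto
  qed
  then show "x \<in> hm_closure X S" using x by (simp add: hm_closure_def)
qed

lemma hm_closureI:
  "S \<subseteq> carr X \<Longrightarrow> (\<And>n. f n \<in> S) \<Longrightarrow> hm_lim X f x \<Longrightarrow> x \<in> hm_closure X S"
  using hm_closure_iff by metis

lemma hm_closureE:
  assumes "x \<in> hm_closure X S" "S \<subseteq> carr X"
  obtains f where "\<And>n. f n \<in> S" "hm_lim X f x"
  using assms hm_closure_iff by metis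

lemma hm_closure_subset: "hm_closure X S \<subseteq> carr X"
  by (auto simp: hm_closure_def)

lemma hm_closure_mono: "S \<subseteq> S' \<Longrightarrow> hm_closure X S \<subseteq> hm_closure X S'"
  by (fastforce simp: hm_closure_def)

lemma subset_hm_closure: "S \<subseteq> carr X \<Longrightarrow> S \<subseteq> hm_closure X S"
  by (auto simp: hm_closure_def intro!: bexI)

lemma hm_closure_idem:
  assumes S: "S \<subseteq> carr X"
  shows "hm_closure X (hm_closure X S) = hm_closure X S"
proof
  show "hm_closure X (hm_closure X S) \<subseteq> hm_closure X S"
  proof
    fix x assume x: "x \<in> hm_closure X (hm_closure X S)"
    have "\<exists>s\<in>S. hnorm X (x - s) < e" if "e > 0" for e
    proof -
      have e2: "e / 2 > 0" using \<open>e > 0\<close> by simp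
      have "\<exists>y\<in>hm_closure X S. hnorm X (x - y) < e / 2"
        using x e2 unfolding hm_closure_def[of _ "hm_closure X S"] by blast
      then obtain y where y: "y \<in> hm_closure X S" "hnorm X (x - y) < e / 2" by blast
      have "\<exists>s\<in>S. hnorm X (y - s) < e / 2"
        using y(1) e2 unfolding hm_closure_def by blast
      then obtain s where s: "s \<in> S" "hnorm X (y - s) < e / 2" by blast
      have "hnorm X (x - s) < e"
        using hnorm_diff_triangle[of x y s] x y s S by (auto simp: hm_closure_def)
      then show ?thesis using s by blast
    qed
    then show "x \<in> hm_closure X S" using x by (auto simp: hm_closure_def)
  qed
  show "hm_closure X S \<subseteq> hm_closure X (hm_closure X S)"
    by (rule subset_hm_closure[OF hm_closure_subset])
qed

lemma hm_closure_minimal: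
  "S \<subseteq> hm_closure X S' \<Longrightarrow> S' \<subseteq> carr X \<Longrightarrow> hm_closure X S \<subseteq> hm_closure X S'"
  using hm_closure_mono hm_closure_idem by metis

lemma additive_subgroup_closure:
  assumes S: "additive_subgroup X S"
  shows "additive_subgroup X (hm_closure X S)"
proof -
  have SX: "S \<subseteq> carr X" using S by (simp add: additive_subgroup_def)
  have "x - y \<in> hm_closure X S" if x: "x \<in> hm_closure X S" and y: "y \<in> hm_closure X S" for x y
  proof -
    obtain f g where f: "\<And>n. f n \<in> S" "hm_lim X f x" and g: "\<And>n. g n \<in> S" "hm_lim X g y"
      using x y hm_closureE[OF _ SX] by metis
    have "hm_lim X (\<lambda>n. f n - g n) (x - y)" using f g SX by (intro hm_lim_diff) auto
    moreover have "f n - g n \<in> S" for n using f g S by (simp add: additive_subgroup_def)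
    ultimately show ?thesis by (intro hm_closureI[OF SX])
  qed
  then show ?thesis
    using S subset_hm_closure[OF SX] hm_closure_subset by (auto simp: additive_subgroup_def)
qed

lemma orthogonal_sets_closure:
  assumes S: "S \<subseteq> carr X" "S' \<subseteq> carr X" and orth: "orthogonal_sets X S S'"
  shows "orthogonal_sets X (hm_closure X S) (hm_closure X S')"
  unfolding orthogonal_sets_def
proof (intro ballI)
  fix x y assume x: "x \<in> hm_closure X S" and y: "y \<in> hm_closure X S'"
  obtain f g where f: "\<And>n. f n \<in> S" "hm_lim X f x" and g: "\<And>n. g n \<in> S'" "hm_lim X g y"
    using x y hm_closureE S by metis
  have "(\<lambda>n. ip X (f n) (g n)) \<longlonglongrightarrow> ip X x y" using f g S by (intro ip_tendsto) auto
  moreover have "ip X (f n) (g n) = 0" for n using f g orth by (simp add: orthogonal_sets_def)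
  ultimately show "ip X x y = 0" by (simp add: LIMSEQ_const_iff)
qed

lemma set_sum_closed: "S \<subseteq> carr X \<Longrightarrow> S' \<subseteq> carr X \<Longrightarrow> set_sum S S' \<subseteq> carr X"
  by (auto simp: set_sum_def intro!: add_closed)

text \<open>The two components of a sum of orthogonal elements are controlled by the sum, so approximations of
  the sum converge componentwise.\<close>

lemma closure_orthogonal_sum:
  assumes S: "additive_subgroup X S" "additive_subgroup X S'" and orth: "orthogonal_sets X S S'"
  shows "hm_closure X (set_sum S S') = set_sum (hm_closure X S) (hm_closure X S')"
proof
  have SX: "S \<subseteq> carr X" "S' \<subseteq> carr X" using S by (simp_all add: additive_subgroup_def)
  note sumX = set_sum_closed[OF SX]
  show "set_sum (hm_closure X S) (hm_closure X S') \<subseteq> hm_closure X (set_sum S S')"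
  proof
    fix v assume "v \<in> set_sum (hm_closure X S) (hm_closure X S')"
    then obtain x y where v: "v = x + y" and x: "x \<in> hm_closure X S" and y: "y \<in> hm_closure X S'"
      by (auto simp: set_sum_def)
    obtain f g where f: "\<And>n. f n \<in> S" "hm_lim X f x" and g: "\<And>n. g n \<in> S'" "hm_lim X g y"
      using x y hm_closureE SX by metis
    have "hm_lim X (\<lambda>n. f n + g n) v" unfolding v using f g SX by (intro hm_lim_add) auto
    moreover have "f n + g n \<in> set_sum S S'" for n using f g by (auto simp: set_sum_def)
    ultimately show "v \<in> hm_closure X (set_sum S S')" by (intro hm_closureI[OF sumX])
  qed
  show "hm_closure X (set_sum S S') \<subseteq> set_sum (hm_closure X S) (hm_closure X S')"
  proof
    fix v assume "v \<in> hm_closure X (set_sum S S')"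
    then obtain h where h: "\<And>n. h n \<in> set_sum S S'" "hm_lim X h v"
      using hm_closureE[OF _ sumX] by metis
    obtain f g where fg: "\<And>n. f n \<in> S" "\<And>n. g n \<in> S'" "\<And>n. h n = f n + g n"
      using h(1) unfolding set_sum_def mem_Collect_eq by metis
    have hX: "h n \<in> carr X" and fX: "f n \<in> carr X" and gX: "g n \<in> carr X" for n
      using h(1) sumX fg SX by auto
    have le: "hnorm X (f m - f n) \<le> hnorm X (h m - h n)" for m n
    proof -
      have "f m - f n \<in> S" "g m - g n \<in> S'" using fg S by (simp_all add: additive_subgroup_def)
      then have "ip X (f m - f n) (g m - g n) = 0" using orth by (simp add: orthogonal_sets_def)
      then have "hnorm X (f m - f n) \<le> hnorm X ((f m - f n) + (g m - g n))"
        by (intro hnorm_le_add_orthogonal closed fX gX)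
      then show ?thesis by (simp add: fg(3) algebra_simps)
    qed
    have "hm_Cauchy X h" by (rule hm_lim_Cauchy[OF h(2) hX])
    then have "hm_Cauchy X f" unfolding hm_Cauchy_def by (meson le order_le_less_trans)
    then obtain x where x: "hm_lim X f x" using complete[of f] fX by blast
    have "hm_lim X (\<lambda>n. h n - f n) (v - x)" by (intro hm_lim_diff h x hX fX)
    moreover have "(\<lambda>n. h n - f n) = g" using fg(3) by auto
    ultimately have "hm_lim X g (v - x)" by simp
    then have "v - x \<in> hm_closure X S'" "x \<in> hm_closure X S"
      by (auto intro: hm_closureI[OF SX(2) fg(2)] hm_closureI[OF SX(1) fg(1) x])
    moreover have "v = x + (v - x)" by simp
    ultimately show "v \<in> set_sum (hm_closure X S) (hm_closure X S')"
      unfolding set_sum_def by blast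
  qed
qed

text \<open>The component of \<open>v\<close> in \<open>S\<close> is orthogonal to itself, hence
  zero.\<close>

lemma orthogonal_part_of_sum:
  assumes S: "additive_subgroup X S" "additive_subgroup X S'" and orth: "orthogonal_sets X S S'"
    and v: "v \<in> set_sum S S'" "\<And>x. x \<in> S \<Longrightarrow> ip X x v = 0"
  shows "v \<in> S'"
proof -
  obtain x y where xy: "v = x + y" "x \<in> S" "y \<in> S'" using v(1) by (auto simp: set_sum_def)
  have X: "x \<in> carr X" "y \<in> carr X" using S xy by (auto simp: additive_subgroup_def)
  have "ip X x y = 0" using orth xy by (simp add: orthogonal_sets_def)
  then have "ip X x x = 0" using v(2)[OF xy(2)] xy(1) X by (simp add: ip_add)
  then show ?thesis using ip_definite[OF X(1)] xy by simp
qed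

end

section \<open>Inner-product preserving maps\<close>

locale hm_isometry = X: hilbert_module X + Y: hilbert_module Y
  for X :: "('a::cstar_algebra, 'x::ab_group_add, 'b) hmod_scheme"
    and Y :: "('a, 'y::ab_group_add, 'c) hmod_scheme" +
  fixes S :: "'x \<Rightarrow> 'y"
  assumes isometric: "ip_preserving X Y S"
begin

lemma maps_closed: "x \<in> carr X \<Longrightarrow> S x \<in> carr Y"
  using isometric by (auto simp: ip_preserving_def)

lemma ip_image: "x \<in> carr X \<Longrightarrow> y \<in> carr X \<Longrightarrow> ip Y (S x) (S y) = ip X x y"
  using isometric by (auto simp: ip_preserving_def)

lemma hnorm_image: "x \<in> carr X \<Longrightarrow> hnorm Y (S x) = hnorm X x"
  by (simp add: hnorm_def ip_image)

text \<open>Linearity comes from the inner products alone: the one of the defect with itself can be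
  computed in \<open>X\<close>, where it is zero. The same device handles scalars and the
  action.\<close>

lemma map_add:
  assumes "x \<in> carr X" "y \<in> carr X"
  shows "S (x + y) = S x + S y"
proof -
  have "ip Y (S (x + y) - (S x + S y)) (S (x + y) - (S x + S y)) = 0"
    by (simp add: X.ip_simps Y.ip_simps ip_image maps_closed X.closed Y.closed assms algebra_simps)
  then have "S (x + y) - (S x + S y) = 0"
    using assms by (intro Y.ip_definite Y.closed maps_closed X.closed)
  then show ?thesis by simp
qed

lemma map_scal:
  assumes "x \<in> carr X"
  shows "S (scal X c x) = scal Y c (S x)"
proof -
  have "ip Y (S (scal X c x) - scal Y c (S x)) (S (scal X c x) - scal Y c (S x)) = 0"
    by (simp add: scaleC_scaleC mult.commute[of c] X.ip_simps Y.ip_simps ip_image maps_closed X.closed Y.closed assms)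
  then have "S (scal X c x) - scal Y c (S x) = 0"
    using assms by (intro Y.ip_definite Y.closed maps_closed X.closed)
  then show ?thesis by simp
qed

lemma map_act:
  assumes "x \<in> carr X"
  shows "S (act X x a) = act Y (S x) a"
proof -
  have "ip Y (S (act X x a) - act Y (S x) a) (S (act X x a) - act Y (S x) a) = 0"
    by (simp add: mult.assoc X.ip_simps Y.ip_simps ip_image maps_closed X.closed Y.closed assms)
  then have "S (act X x a) - act Y (S x) a = 0"
    using assms by (intro Y.ip_definite Y.closed maps_closed X.closed)
  then show ?thesis by simp
qed

lemma map_zero: "S 0 = 0"
  using map_add[of 0 0] by (simp add: X.closed)

lemma map_diff:
  assumes "x \<in> carr X" "y \<in> carr X"
  shows "S (x - y) = S x - S y"
  using map_add[of "x - y" y] assms by (simp add: X.closed)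

lemma map_sum_list: "set xs \<subseteq> carr X \<Longrightarrow> S (sum_list xs) = sum_list (map S xs)"
  by (induction xs) (auto simp: map_zero map_add X.sum_list_closed)

lemma bounded_linear: "hm_bounded_linear X Y S"
  unfolding hm_bounded_linear_def
  by (intro conjI exI[of _ 1]) (auto simp: maps_closed map_add map_scal hnorm_image)

lemma hm_lim_image:
  assumes "hm_lim X f x" "\<And>n. f n \<in> carr X"
  shows "hm_lim Y (\<lambda>n. S (f n)) (S x)"
proof -
  have x: "x \<in> carr X" using assms by (simp add: hm_lim_def)
  have "hnorm Y (S (f n) - S x) = hnorm X (f n - x)" for n
    using hnorm_image[of "f n - x"] assms x by (simp add: map_diff X.closed)
  then show ?thesis using assms x by (simp add: hm_lim_def maps_closed)
qed

text \<open>One inclusion is continuity. For the other, a convergent sequence of images pulls back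
  to a Cauchy sequence, whose limit exists by completeness of \<open>X\<close>.\<close>

lemma image_closure:
  assumes G: "G \<subseteq> carr X"
  shows "S ` hm_closure X G = hm_closure Y (S ` G)"
proof
  have SG: "S ` G \<subseteq> carr Y" using G maps_closed by auto
  show "S ` hm_closure X G \<subseteq> hm_closure Y (S ` G)"
  proof
    fix y assume "y \<in> S ` hm_closure X G"
    then obtain x where x: "y = S x" "x \<in> hm_closure X G" by blast
    then obtain f where f: "\<And>n. f n \<in> G" "hm_lim X f x" using X.hm_closureE[OF _ G] by metis
    then have "hm_lim Y (\<lambda>n. S (f n)) y" using G x(1) by (auto intro: hm_lim_image)
    then show "y \<in> hm_closure Y (S ` G)" using f(1) by (intro Y.hm_closureI[OF SG]) auto
  qed
  show "hm_closure Y (S ` G) \<subseteq> S ` hm_closure X G"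
  proof
    fix y assume "y \<in> hm_closure Y (S ` G)"
    then obtain h where h: "\<And>n. h n \<in> S ` G" "hm_lim Y h y" using Y.hm_closureE[OF _ SG] by metis
    obtain f where f: "\<And>n. f n \<in> G" "\<And>n. h n = S (f n)" using h(1) unfolding image_iff by metis
    have fX: "f n \<in> carr X" for n using f G by auto
    have "hm_Cauchy Y h" using h SG by (intro Y.hm_lim_Cauchy) auto
    moreover have "hnorm Y (h m - h n) = hnorm X (f m - f n)" for m n
      using hnorm_image[of "f m - f n"] fX by (simp add: f map_diff X.closed)
    ultimately have "hm_Cauchy X f" by (simp add: hm_Cauchy_def)
    then obtain x where x: "hm_lim X f x" using X.complete[of f] fX by blast
    have "h = (\<lambda>n. S (f n))" using f(2) by auto
    then have "hm_lim Y h (S x)" using hm_lim_image[OF x fX] by simp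
    then have "y = S x" using h SG by (intro Y.hm_lim_unique[OF h(2)]) auto
    then show "y \<in> S ` hm_closure X G" using X.hm_closureI[OF G f(1) x] by blast
  qed
qed

lemma additive_subgroup_image:
  assumes "additive_subgroup X G"
  shows "additive_subgroup Y (S ` G)"
  unfolding additive_subgroup_def
proof (intro conjI ballI)
  have G: "G \<subseteq> carr X" using assms by (simp add: additive_subgroup_def)
  then show "S ` G \<subseteq> carr Y" using maps_closed by auto
  show "0 \<in> S ` G" using assms map_zero unfolding additive_subgroup_def by (metis imageI)
  fix y y' assume "y \<in> S ` G" "y' \<in> S ` G"
  then obtain x x' where x: "x \<in> G" "x' \<in> G" "y = S x" "y' = S x'" by blast
  then have "y - y' = S (x - x')" using subsetD[OF G] map_diff[of x x'] by simp
  then show "y - y' \<in> S ` G" using x assms by (auto simp: additive_subgroup_def)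
qed

end

lemma hm_isometry_compose:
  assumes "hm_isometry X Y S" "hm_isometry Y Z S'"
  shows "hm_isometry X Z (S' \<circ> S)"
proof -
  interpret S: hm_isometry X Y S by fact
  interpret S': hm_isometry Y Z S' by fact
  show ?thesis
    by unfold_locales (auto simp: ip_preserving_def S.maps_closed S'.maps_closed S.ip_image S'.ip_image)
qed

lemma (in hilbert_module) additive_subgroup_carr: "additive_subgroup X (carr X)"
  by (simp add: additive_subgroup_def closed)

section \<open>Finite sums of generators\<close>

lemma finite_sums_base: "G \<subseteq> finite_sums G"
  by (auto simp: finite_sums_def intro!: exI[of _ "[_]"])

lemma finite_sums_zero: "0 \<in> finite_sums G"
  by (auto simp: finite_sums_def intro!: exI[of _ "[]"])

lemma finite_sums_add:
  assumes "x \<in> finite_sums G" "y \<in> finite_sums G"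
  shows "x + y \<in> finite_sums G"
proof -
  obtain xs ys where "x = sum_list xs" "set xs \<subseteq> G" "y = sum_list ys" "set ys \<subseteq> G"
    using assms by (auto simp: finite_sums_def)
  then show ?thesis by (auto simp: finite_sums_def intro!: exI[of _ "xs @ ys"])
qed

lemma finite_sums_induct [consumes 1, case_names zero add]:
  assumes "x \<in> finite_sums G" and "P 0"
    and "\<And>g y. g \<in> G \<Longrightarrow> y \<in> finite_sums G \<Longrightarrow> P y \<Longrightarrow> P (g + y)"
  shows "P x"
proof -
  obtain xs where xs: "x = sum_list xs" "set xs \<subseteq> G" using assms(1) by (auto simp: finite_sums_def)
  have "P (sum_list xs)"
    using xs(2)
  proof (induction xs)
    case (Cons g xs)
    then show ?case using assms(3)[of g "sum_list xs"] by (auto simp: finite_sums_def)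
  qed (simp add: assms)
  then show ?thesis using xs by simp
qed

lemma finite_sums_subset:
  assumes S: "additive_subgroup X S" and G: "G \<subseteq> S"
  shows "finite_sums G \<subseteq> S"
proof
  show "x \<in> S" if "x \<in> finite_sums G" for x
    using that S G
    by (induction rule: finite_sums_induct) (auto simp: additive_subgroup_def intro: additive_subgroup_add)
qed

lemma (in hilbert_module) finite_sums_closed: "G \<subseteq> carr X \<Longrightarrow> finite_sums G \<subseteq> carr X"
  using finite_sums_subset additive_subgroup_carr by blast

lemma (in hilbert_module) finite_sums_subgroup:
  assumes G: "G \<subseteq> carr X" "\<And>g. g \<in> G \<Longrightarrow> - g \<in> G"
  shows "additive_subgroup X (finite_sums G)"
proof -
  have neg: "- x \<in> finite_sums G" if "x \<in> finite_sums G" for x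
    using that
  proof (induction rule: finite_sums_induct)
    case (add g y)
    have "- g \<in> finite_sums G" using G(2)[OF add(1)] finite_sums_base by blast
    then have "- g + - y \<in> finite_sums G" using add.IH by (rule finite_sums_add)
    then show ?case by simp
  qed (simp add: finite_sums_zero)
  have "x - y \<in> finite_sums G" if "x \<in> finite_sums G" "y \<in> finite_sums G" for x y
    using finite_sums_add[OF that(1) neg[OF that(2)]] by simp
  then show ?thesis
    using finite_sums_closed[OF G(1)] finite_sums_zero by (auto simp: additive_subgroup_def)
qed

lemma (in hilbert_module) orthogonal_finite_sums:
  assumes G: "G \<subseteq> carr X" "G' \<subseteq> carr X" and orth: "orthogonal_sets X G G'"
  shows "orthogonal_sets X (finite_sums G) (finite_sums G')"
proof -
  have 1: "ip X g y = 0" if "g \<in> G" "y \<in> finite_sums G'" for g y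
    using that(2)
  proof (induction rule: finite_sums_induct)
    case (add g' y)
    moreover have "g \<in> carr X" "g' \<in> carr X" "y \<in> carr X"
      using that(1) add G finite_sums_closed by auto
    ultimately show ?case using orth that(1) by (simp add: ip_add orthogonal_sets_def)
  qed (use that G in auto)
  have "ip X x y = 0" if "x \<in> finite_sums G" "y \<in> finite_sums G'" for x y
    using that(1)
  proof (induction rule: finite_sums_induct)
    case (add g x)
    moreover have "g \<in> carr X" "x \<in> carr X" "y \<in> carr X"
      using that(2) add G finite_sums_closed by auto
    ultimately show ?case using 1[OF add(1) that(2)] by (simp add: ip_add_left)
  qed (use that finite_sums_closed[OF G(2)] in auto)
  then show ?thesis by (simp add: orthogonal_sets_def)
qed

lemma (in hm_isometry) image_finite_sums:
  assumes G: "G \<subseteq> carr X"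
  shows "S ` finite_sums G = finite_sums (S ` G)"
proof
  show "S ` finite_sums G \<subseteq> finite_sums (S ` G)"
    using map_sum_list G by (fastforce simp: finite_sums_def)
  show "finite_sums (S ` G) \<subseteq> S ` finite_sums G"
  proof
    fix y assume "y \<in> finite_sums (S ` G)"
    then show "y \<in> S ` finite_sums G"
    proof (induction rule: finite_sums_induct)
      case zero
      show ?case using map_zero finite_sums_zero by (metis imageI)
    next
      case (add g y)
      then obtain g' y' where g': "g = S g'" "g' \<in> G" "y = S y'" "y' \<in> finite_sums G" by blast
      then have "g + y = S (g' + y')" 
        using subsetD[OF G] subsetD[OF X.finite_sums_closed[OF G]] map_add[of g' y'] by simp
      moreover have "g' + y' \<in> finite_sums G" using g' finite_sums_base finite_sums_add by blast
      ultimately show ?case by blast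
    qed
  qed
qed

text \<open>\<open>F v\<close> is the limit of the sums of \<open>g'\<close> along lists of indices whose sums of \<open>g\<close> tend to \<open>v\<close>. Equality
  of the Gram matrices makes the limit exist and independent of the lists.\<close>

lemma isometric_extension:
  fixes g :: "'i \<Rightarrow> 'x::ab_group_add" and g' :: "'i \<Rightarrow> 'y::ab_group_add"
  assumes X: "hilbert_module X" and Y: "hilbert_module Y"
    and g: "g ` I \<subseteq> carr X" and g': "g' ` I \<subseteq> carr Y"
    and gram: "\<And>i j. i \<in> I \<Longrightarrow> j \<in> I \<Longrightarrow> ip Y (g' i) (g' j) = ip X (g i) (g j)"
    and dense: "hm_closure X (finite_sums (g ` I)) = carr X"
  obtains F where "hm_isometry X Y F" "\<And>i. i \<in> I \<Longrightarrow> F (g i) = g' i"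
proof -
  interpret X: hilbert_module X by fact
  interpret Y: hilbert_module Y by fact
  define s where "s is = sum_list (map g is)" for "is"
  define s' where "s' is = sum_list (map g' is)" for "is"
  have sX: "s is \<in> carr X" and sY: "s' is \<in> carr Y" if "set is \<subseteq> I" for "is"
    unfolding s_def s'_def
    by (intro X.sum_list_closed Y.sum_list_closed; use that g g' in fastforce)+
  have gram_list: "ip Y (s' is) (s' js) = ip X (s is) (s js)" if ij: "set is \<subseteq> I" "set js \<subseteq> I" for "is" js
    using ij(1)
  proof (induction "is")
    case Nil
    then show ?case using sX[OF ij(2)] sY[OF ij(2)] by (simp add: s_def[of "[]"] s'_def[of "[]"])
  next
    case (Cons i "is")
    have i: "i \<in> I" using Cons by simp
    have gi: "g i \<in> carr X" "g' i \<in> carr Y" using i g g' by auto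
    have row: "ip Y (g' i) (s' js) = ip X (g i) (s js)"
      using ij(2)
    proof (induction js)
      case Nil
      then show ?case using gi by (simp add: s_def s'_def)
    next
      case (Cons j js)
      have "g j \<in> carr X" "g' j \<in> carr Y" using Cons.prems g g' by auto
      moreover have "s (j # js) = g j + s js" "s' (j # js) = g' j + s' js" by (simp_all add: s_def s'_def)
      ultimately show ?case
        using Cons sX[of js] sY[of js] gi gram[OF i, of j] by (simp add: X.ip_add Y.ip_add)
    qed
    have "s (i # is) = g i + s is" "s' (i # is) = g' i + s' is" by (simp_all add: s_def s'_def)
    then show ?case
      using Cons sX[of "is"] sY[of "is"] sX[OF ij(2)] sY[OF ij(2)] gi row by (simp add: X.ip_add_left Y.ip_add_left)
  qed
  \<comment> \<open>\<open>rel\<close> is the graph of the map to be built; one sequence of index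
    lists has to serve both sides. \<open>rel_ip\<close> makes every choice of values isometric and,
    by definiteness, the value unique.\<close>
  define rel where "rel v w \<longleftrightarrow>
    (\<exists>l. (\<forall>n. set (l n) \<subseteq> I) \<and> hm_lim X (\<lambda>n. s (l n)) v \<and> hm_lim Y (\<lambda>n. s' (l n)) w)" for v w
  have rel_ip: "ip Y w w' = ip X v v'" if r: "rel v w" "rel v' w'" for v w v' w'
  proof -
    obtain l where l: "\<And>n. set (l n) \<subseteq> I" "hm_lim X (\<lambda>n. s (l n)) v" "hm_lim Y (\<lambda>n. s' (l n)) w"
      using r(1) unfolding rel_def by metis
    obtain l' where l': "\<And>n. set (l' n) \<subseteq> I" "hm_lim X (\<lambda>n. s (l' n)) v'" "hm_lim Y (\<lambda>n. s' (l' n)) w'"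
      using r(2) unfolding rel_def by metis
    have "(\<lambda>n. ip X (s (l n)) (s (l' n))) \<longlonglongrightarrow> ip X v v'"
      by (intro X.ip_tendsto l l' sX)
    moreover have "(\<lambda>n. ip X (s (l n)) (s (l' n))) \<longlonglongrightarrow> ip Y w w'"
      unfolding gram_list[OF l(1) l'(1), symmetric] by (intro Y.ip_tendsto l l' sY)
    ultimately show ?thesis using LIMSEQ_unique by blast
  qed
  have rel_ex: "\<exists>w. rel v w" if v: "v \<in> carr X" for v
  proof -
    have fsX: "finite_sums (g ` I) \<subseteq> carr X" by (rule X.finite_sums_closed[OF g])
    obtain f where f: "\<And>n. f n \<in> finite_sums (g ` I)" "hm_lim X f v"
      using v dense X.hm_closureE[OF _ fsX] by metis
    have "\<exists>is. set is \<subseteq> I \<and> f n = s is" for n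
      using f(1)[of n]
    proof (induction rule: finite_sums_induct)
      case zero
      show ?case by (rule exI[of _ "[]"]) (simp add: s_def)
    next
      case (add u y)
      then obtain i "is" where "i \<in> I" "u = g i" "set is \<subseteq> I" "y = s is" by blast
      then show ?case by (intro exI[of _ "i # is"]) (simp add: s_def)
    qed
    then obtain l where l: "\<And>n. set (l n) \<subseteq> I" "\<And>n. f n = s (l n)" by metis
    have fl: "f = (\<lambda>n. s (l n))" using l(2) by auto
    have lX: "hm_lim X (\<lambda>n. s (l n)) v" using f(2) fl by simp
    have "hnorm Y (s' (l m) - s' (l n)) = hnorm X (s (l m) - s (l n))" for m n
      by (simp add: hnorm_def X.ip_simps Y.ip_simps X.closed Y.closed sX sY l(1) gram_list)
    moreover have "hm_Cauchy X (\<lambda>n. s (l n))" using X.hm_lim_Cauchy[OF lX] sX l(1) by blast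
    ultimately have "hm_Cauchy Y (\<lambda>n. s' (l n))" by (simp add: hm_Cauchy_def)
    then obtain w where "hm_lim Y (\<lambda>n. s' (l n)) w" 
      using Y.complete[of "\<lambda>n. s' (l n)"] sY[OF l(1)] by blast
    then show ?thesis using lX l(1) unfolding rel_def by (intro exI[of _ w] exI[of _ l]) blast
  qed
  define F where "F v = (SOME w. rel v w)" for v
  have relF: "rel v (F v)" if "v \<in> carr X" for v
    unfolding F_def using rel_ex[OF that] by (rule someI_ex)
  have relY: "w \<in> carr Y" if "rel v w" for v w
    using that by (auto simp: rel_def hm_lim_def)
  have "hm_isometry X Y F"
    by unfold_locales (auto simp: ip_preserving_def intro: relY relF rel_ip)
  moreover have "F (g i) = g' i" if i: "i \<in> I" for i
  proof -
    have gi: "g i \<in> carr X" "g' i \<in> carr Y" using i g g' by auto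
    have r: "rel (g i) (g' i)"
      unfolding rel_def
      by (rule exI[of _ "\<lambda>_. [i]"]) (simp add: s_def s'_def i gi X.hm_lim_const Y.hm_lim_const)
    note rF = relF[OF gi(1)]
    have FY: "F (g i) \<in> carr Y" by (rule relY[OF rF])
    have "ip Y (F (g i) - g' i) (F (g i) - g' i) = 0"
      using rel_ip[OF r r] rel_ip[OF rF r] rel_ip[OF r rF] rel_ip[OF rF rF]
      by (simp add: Y.ip_simps Y.closed gi FY)
    then show ?thesis using Y.ip_definite[of "F (g i) - g' i"] FY gi by (simp add: Y.closed)
  qed
  ultimately show ?thesis by (rule that)
qed

lemma hm_limI:
  assumes "x \<in> carr X" "\<And>n. hnorm X (f n - x) \<le> g n" "g \<longlonglongrightarrow> 0"
  shows "hm_lim X f x"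
proof -
  have "\<forall>\<^sub>F n in sequentially. norm (hnorm X (f n - x)) \<le> g n"
    using assms(2) by (simp add: hnorm_def)
  then have "(\<lambda>n. hnorm X (f n - x)) \<longlonglongrightarrow> 0"
    by (rule Lim_null_comparison[OF _ assms(3)])
  then show ?thesis by (simp add: hm_lim_def assms(1))
qed

lemma bounded_linear_lim:
  assumes X: "hilbert_module X" and Y: "hilbert_module Y" and F: "hm_bounded_linear X Y F"
    and f: "hm_lim X f x" "\<And>n. f n \<in> carr X"
  shows "hm_lim Y (\<lambda>n. F (f n)) (F x)"
proof -
  interpret X: hilbert_module X by fact
  interpret Y: hilbert_module Y by fact
  have add: "F (u + v) = F u + F v" if "u \<in> carr X" "v \<in> carr X" for u v
    using F that by (simp add: hm_bounded_linear_def)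
  obtain C where C: "\<And>u. u \<in> carr X \<Longrightarrow> hnorm Y (F u) \<le> C * hnorm X u"
    using F unfolding hm_bounded_linear_def by blast
  have x: "x \<in> carr X" using f by (simp add: hm_lim_def)
  have "hnorm Y (F (f n) - F x) \<le> C * hnorm X (f n - x)" for n
    using C[of "f n - x"] add[of "f n - x" x] f x by (simp add: X.closed)
  moreover have "(\<lambda>n. C * hnorm X (f n - x)) \<longlonglongrightarrow> 0"
    using f tendsto_mult_left[of "\<lambda>n. hnorm X (f n - x)" 0 sequentially C] by (simp add: hm_lim_def)
  moreover have "F x \<in> carr Y" using F x by (auto simp: hm_bounded_linear_def)
  ultimately show ?thesis by (intro hm_limI)
qed

text \<open>Provides the uniqueness half of the definite description in
  \<open>tensor_id\<close>.\<close>

lemma bounded_linear_eq_on_dense: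
  assumes X: "hilbert_module X" and Y: "hilbert_module Y"
    and F: "hm_bounded_linear X Y F" and F': "hm_bounded_linear X Y F'"
    and G: "G \<subseteq> carr X" "hm_closure X (finite_sums G) = carr X"
    and eq: "\<And>g. g \<in> G \<Longrightarrow> F g = F' g" and x: "x \<in> carr X"
  shows "F x = F' x"
proof -
  interpret X: hilbert_module X by fact
  interpret Y: hilbert_module Y by fact
  have add: "F (u + v) = F u + F v" "F' (u + v) = F' u + F' v" if "u \<in> carr X" "v \<in> carr X" for u v
    using F F' that by (simp_all add: hm_bounded_linear_def)
  have zero: "F 0 = 0" "F' 0 = 0" using add[of 0 0] by (simp_all add: X.closed)
  note fsX = X.finite_sums_closed[OF G(1)]
  have eq': "F y = F' y" if "y \<in> finite_sums G" for y
    using that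
  proof (induction rule: finite_sums_induct)
    case step: (add g y)
    then have "g \<in> carr X" "y \<in> carr X" using G fsX by auto
    then show ?case using add eq[OF step.hyps(1)] step.IH by simp
  qed (simp add: zero)
  obtain f where f: "\<And>n. f n \<in> finite_sums G" "hm_lim X f x"
    using x G(2) X.hm_closureE[OF _ fsX] by metis
  have fX: "f n \<in> carr X" for n using f(1) fsX by auto
  have "hm_lim Y (\<lambda>n. F (f n)) (F x)" by (rule bounded_linear_lim[OF X Y F f(2) fX])
  moreover have "hm_lim Y (\<lambda>n. F (f n)) (F' x)"
    unfolding eq'[OF f(1)] by (rule bounded_linear_lim[OF X Y F' f(2) fX])
  moreover have "F (f n) \<in> carr Y" for n using F fX by (auto simp: hm_bounded_linear_def)
  ultimately show ?thesis by (rule Y.hm_lim_unique)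
qed

section \<open>Internal tensor products\<close>

context correspondence
begin

lemma lact_closed: "m \<in> carr M \<Longrightarrow> lact M a m \<in> carr M"
  using lact_adjoint[of a] by (auto simp: is_adjoint_def)

lemma ip_lact: "m \<in> carr M \<Longrightarrow> n \<in> carr M \<Longrightarrow> ip M (lact M a m) n = ip M m (lact M (star a) n)"
  using lact_adjoint[of a] by (auto simp: is_adjoint_def)

lemma lact_zero: "m \<in> carr M \<Longrightarrow> lact M 0 m = 0"
  using lact_add[of m 0 0] by simp

lemma lact_minus: "m \<in> carr M \<Longrightarrow> lact M (- a) m = - lact M a m"
  using lact_add[of m a "- a"] by (simp add: lact_zero eq_neg_iff_add_eq_0 add.commute)

lemma ip_lact_square: "m \<in> carr M \<Longrightarrow> ip M m (lact M (star b * b) m) = ip M (lact M b m) (lact M b m)"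
  by (simp add: ip_lact lact_closed lact_mult)

text \<open>If \<open>1 - star b * b = (1 - r)\<^sup>2\<close> with self-adjoint \<open>r\<close>, then
  \<open>\<langle>m, m\<rangle> = \<langle>b m, b m\<rangle> + \<langle>m - r m, m - r m\<rangle>\<close>.\<close>

lemma lact_contraction:
  assumes b: "norm b \<le> 1" and m: "m \<in> carr M"
  shows "hnorm M (lact M b m) \<le> hnorm M m"
proof -
  have "norm (star b * b) \<le> 1" using b by (simp add: cstar_identity power_le_one)
  moreover have "star (star b * b) = star b * b" by (simp add: star_mult star_star)
  ultimately obtain r where r: "2 *\<^sub>R r - r * r = star b * b" "star r = r"
    using one_minus_sqrt by metis
  note c = closed lact_closed m
  have "lact M (star b * b) m = lact M (r + r + - (r * r)) m"
    by (simp add: r(1)[symmetric] scaleR_2)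
  also have "\<dots> = lact M r m + lact M r m - lact M r (lact M r m)"
    by (simp only: lact_add[OF m] lact_minus[OF m] lact_mult[OF m]) simp
  finally have eq: "lact M (star b * b) m = lact M r m + lact M r m - lact M r (lact M r m)" .
  have rr: "ip M (lact M r m) x = ip M m (lact M r x)" if "x \<in> carr M" for x
    using ip_lact[OF m that, of r] r(2) by simp
  have "ip M (lact M b m) (lact M b m) + ip M (m - lact M r m) (m - lact M r m) = ip M m m"
    unfolding ip_lact_square[OF m, symmetric] eq by (simp add: ip_simps c rr)
  then have "norm (ip M (lact M b m) (lact M b m)) \<le> norm (ip M m m)"
    using cstar_positive_norm_mono[of "ip M (lact M b m) (lact M b m)" "ip M (m - lact M r m) (m - lact M r m)"]
      ip_positive[of m] ip_positive[of "lact M b m"] ip_positive[of "m - lact M r m"] c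
    by simp
  then show ?thesis by (simp add: hnorm_def)
qed

lemma lact_bound:
  assumes m: "m \<in> carr M"
  shows "hnorm M (lact M b m) \<le> norm b * hnorm M m"
proof (cases "b = 0")
  case False
  let ?r = "inverse (norm b)"
  have "hnorm M (lact M (?r *\<^sub>R b) m) \<le> hnorm M m"
    using False by (intro lact_contraction m) simp
  moreover have "lact M (?r *\<^sub>R b) m = scal M (complex_of_real ?r) (lact M b m)"
    using lact_scaleC[OF m, of "complex_of_real ?r" b] by (simp add: scaleC_of_real del: of_real_inverse)
  ultimately have "cmod (complex_of_real ?r) * hnorm M (lact M b m) \<le> hnorm M m"
    by (simp only: hnorm_scal lact_closed m)
  then show ?thesis using False by (simp add: norm_inverse field_simps norm_divide)
qed (simp add: m lact_zero)

end

locale tensor_product = X: hilbert_module X + M: correspondence M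
  for X :: "('a::cstar_algebra, 'x::ab_group_add) hmod"
    and M :: "('a, 'm::ab_group_add) corr" +
  fixes P :: "('a, 'p::ab_group_add) hmod" and t :: "'x \<Rightarrow> 'm \<Rightarrow> 'p"
  assumes tensor: "internal_tensor X M P t"
begin

sublocale P: hilbert_module P
  using tensor by (simp add: internal_tensor_def)

lemma tensor_closed: "x \<in> carr X \<Longrightarrow> m \<in> carr M \<Longrightarrow> t x m \<in> carr P"
  using tensor by (simp add: internal_tensor_def)

lemma tensor_add_left:
  "x \<in> carr X \<Longrightarrow> y \<in> carr X \<Longrightarrow> m \<in> carr M \<Longrightarrow> t (x + y) m = t x m + t y m"
  using tensor by (simp add: internal_tensor_def)

lemma tensor_ip:
  "x \<in> carr X \<Longrightarrow> y \<in> carr X \<Longrightarrow> m \<in> carr M \<Longrightarrow> n \<in> carr M \<Longrightarrow>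
    ip P (t x m) (t y n) = ip M m (lact M (ip X x y) n)"
  using tensor by (simp add: internal_tensor_def)

lemma tensor_dense: "hm_closure P (finite_sums {t x m | x m. x \<in> carr X \<and> m \<in> carr M}) = carr P"
  using tensor by (simp add: internal_tensor_def)

lemma tensor_zero_left: "m \<in> carr M \<Longrightarrow> t 0 m = 0"
  using tensor_add_left[of 0 0 m] by (simp add: X.closed)

text \<open>Writing \<open>ip X x x = star b * b\<close> turns \<open>hnorm P (t x m)\<close> into
  \<open>hnorm M (lact M b m)\<close>. The resulting continuity in the first factor lets
  approximations pass through a tensor product.\<close>

lemma tensor_bound:
  assumes x: "x \<in> carr X" and m: "m \<in> carr M"
  shows "hnorm P (t x m) \<le> hnorm X x * hnorm M m"
proof -
  obtain b where b: "ip X x x = star b * b" using X.ip_positive[OF x] by (auto simp: cstar_positive_def)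
  have "(hnorm P (t x m))\<^sup>2 = (hnorm M (lact M b m))\<^sup>2"
    by (simp add: P.hnorm_square M.hnorm_square tensor_ip x m b M.ip_lact_square)
  also have "\<dots> \<le> (norm b * hnorm M m)\<^sup>2" by (intro power_mono M.lact_bound m) simp
  also have "norm b = hnorm X x" by (simp add: hnorm_def b cstar_identity)
  finally show ?thesis by (rule power2_le_imp_le) simp
qed

lemma tensor_lim:
  assumes f: "hm_lim X f x" "\<And>n. f n \<in> carr X" and m: "m \<in> carr M"
  shows "hm_lim P (\<lambda>n. t (f n) m) (t x m)"
proof -
  have x: "x \<in> carr X" using f by (simp add: hm_lim_def)
  have "hnorm P (t (f n) m - t x m) \<le> hnorm X (f n - x) * hnorm M m" for n
    using tensor_bound[of "f n - x" m] tensor_add_left[of "f n - x" x m] f x m by (simp add: X.closed)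
  moreover have "(\<lambda>n. hnorm X (f n - x) * hnorm M m) \<longlonglongrightarrow> 0"
    using f tendsto_mult_right[of "\<lambda>n. hnorm X (f n - x)" 0 sequentially "hnorm M m"] by (simp add: hm_lim_def)
  ultimately show ?thesis using x m by (intro hm_limI tensor_closed)
qed

end

text \<open>The recursion takes factors from the front of the list, whereas a new level of the tower
  adds a factor at the end. Inductions over levels therefore run over
  \<open>ms @ [m]\<close>.\<close>

lemma elem_tensor_snoc:
  "elem_tensor P x (ms @ [m]) = tmul P (length ms) (elem_tensor P x ms) m"
  by (induction ms arbitrary: P x) (simp_all add: tower_shift_def)

lemma tower_shift_simps [simp]:
  "tpow (tower_shift j P) k = tpow P (j + k)" "tmul (tower_shift j P) k = tmul P (j + k)"
  by (simp_all add: tower_shift_def)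

lemma tower_shift_shift: "tower_shift i (tower_shift j P) = tower_shift (j + i) P"
  by (simp add: tower_shift_def add.assoc)

definition elem_tensors ::
    "('a, 'm) corr \<Rightarrow> ('a, 'p, 'm) tower \<Rightarrow> 'p set \<Rightarrow> nat \<Rightarrow> 'p set" where
  "elem_tensors M P S k = {elem_tensor P x ms | x ms. x \<in> S \<and> length ms = k \<and> set ms \<subseteq> carr M}"

text \<open>The carrier of \<open>sub_tensor\<close>, but for an arbitrary set, so that ranges and
  orthogonal parts can be inserted directly.\<close>

definition tensor_span ::
    "('a::cstar_algebra, 'm) corr \<Rightarrow> ('a, 'p::ab_group_add, 'm) tower \<Rightarrow> 'p set \<Rightarrow> nat \<Rightarrow> 'p set" where
  "tensor_span M P S k = hm_closure (tpow P k) (finite_sums (elem_tensors M P S k))"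

lemma carr_sub_tensor: "carr (sub_tensor M P N k) = tensor_span M P (carr N) k"
  by (simp add: sub_tensor_def submod_def tensor_span_def elem_tensors_def)

text \<open>\<open>tensor_tower\<close> with the base module left unnamed, so that each
  \<open>tower_shift\<close> is again an instance.\<close>

locale hm_tower = M: correspondence M
  for M :: "('a::cstar_algebra, 'm::ab_group_add) corr" +
  fixes P :: "('a, 'p::ab_group_add, 'm) tower"
  assumes hilbert_base: "hilbert_module (tpow P 0)"
    and tower_tensor: "\<And>k. internal_tensor (tpow P k) M (tpow P (Suc k)) (tmul P k)"
begin

lemma hilbert_tpow: "hilbert_module (tpow P k)"
  using hilbert_base tower_tensor by (cases k) (auto simp: internal_tensor_def)

lemma tensor_product_tpow: "tensor_product (tpow P k) M (tpow P (Suc k)) (tmul P k)"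
  by (intro tensor_product.intro tensor_product_axioms.intro hilbert_tpow M.correspondence_axioms tower_tensor)

lemma hm_tower_shift: "hm_tower M (tower_shift j P)"
  by (intro hm_tower.intro hm_tower_axioms.intro M.correspondence_axioms)
     (simp_all add: hilbert_tpow tower_tensor)

lemma elem_tensor_closed:
  assumes "x \<in> carr (tpow P 0)" "set ms \<subseteq> carr M"
  shows "elem_tensor P x ms \<in> carr (tpow P (length ms))"
  using assms(2)
proof (induction ms rule: rev_induct)
  case (snoc m ms)
  interpret T: tensor_product "tpow P (length ms)" M "tpow P (Suc (length ms))" "tmul P (length ms)"
    by (rule tensor_product_tpow)
  show ?case using snoc by (simp add: elem_tensor_snoc T.tensor_closed)
qed (simp add: assms)

lemma elem_tensor_add:
  assumes "x \<in> carr (tpow P 0)" "y \<in> carr (tpow P 0)" "set ms \<subseteq> carr M"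
  shows "elem_tensor P (x + y) ms = elem_tensor P x ms + elem_tensor P y ms"
  using assms(3)
proof (induction ms rule: rev_induct)
  case (snoc m ms)
  interpret T: tensor_product "tpow P (length ms)" M "tpow P (Suc (length ms))" "tmul P (length ms)"
    by (rule tensor_product_tpow)
  show ?case using snoc assms by (simp add: elem_tensor_snoc T.tensor_add_left elem_tensor_closed)
qed simp

lemma elem_tensor_zero: "set ms \<subseteq> carr M \<Longrightarrow> elem_tensor P 0 ms = 0"
  using elem_tensor_add[of 0 0 ms] hilbert_module.zero_closed[OF hilbert_base] by simp

lemma elem_tensor_uminus:
  assumes "x \<in> carr (tpow P 0)" "set ms \<subseteq> carr M"
  shows "elem_tensor P (- x) ms = - elem_tensor P x ms"
  using elem_tensor_add[of x "- x" ms] elem_tensor_zero[of ms] assms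
    hilbert_module.uminus_closed[OF hilbert_base]
  by (simp add: eq_neg_iff_add_eq_0 add.commute)

lemma elem_tensors_closed: "S \<subseteq> carr (tpow P 0) \<Longrightarrow> elem_tensors M P S k \<subseteq> carr (tpow P k)"
  using elem_tensor_closed by (auto simp: elem_tensors_def)

lemma elem_tensors_subgroup:
  assumes "additive_subgroup (tpow P 0) S"
  shows "additive_subgroup (tpow P k) (finite_sums (elem_tensors M P S k))"
proof -
  interpret H: hilbert_module "tpow P k" by (rule hilbert_tpow)
  have S: "S \<subseteq> carr (tpow P 0)" using assms by (simp add: additive_subgroup_def)
  show ?thesis
  proof (rule H.finite_sums_subgroup[OF elem_tensors_closed[OF S]])
    fix g assume "g \<in> elem_tensors M P S k"
    then obtain x ms where x: "x \<in> S" "length ms = k" "set ms \<subseteq> carr M" "g = elem_tensor P x ms"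
      by (auto simp: elem_tensors_def)
    then have "- g = elem_tensor P (- x) ms" using elem_tensor_uminus S by auto
    then show "- g \<in> elem_tensors M P S k"
      using x additive_subgroup_uminus[OF assms x(1)] unfolding elem_tensors_def by blast
  qed
qed

lemma tensor_span_subgroup:
  "additive_subgroup (tpow P 0) S \<Longrightarrow> additive_subgroup (tpow P k) (tensor_span M P S k)"
  unfolding tensor_span_def
  by (intro hilbert_module.additive_subgroup_closure hilbert_tpow elem_tensors_subgroup)

text \<open>Density at the next level is given for products \<open>w \<otimes> m\<close> with
  arbitrary \<open>w\<close> in \<open>tpow P k\<close>. By induction \<open>w\<close> is a limit of
  sums of elementary tensors, and \<open>tensor_lim\<close> preserves the limit after multiplication
  by \<open>m\<close>.\<close>

lemma tensor_span_carr: "tensor_span M P (carr (tpow P 0)) k = carr (tpow P k)"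
proof (induction k)
  case 0
  interpret H: hilbert_module "tpow P 0" by (rule hilbert_base)
  have "elem_tensors M P (carr (tpow P 0)) 0 = carr (tpow P 0)" by (auto simp: elem_tensors_def)
  then show ?case
    using H.subset_hm_closure[of "finite_sums (carr (tpow P 0))"] H.hm_closure_subset
      H.finite_sums_closed[of "carr (tpow P 0)"] finite_sums_base[of "carr (tpow P 0)"]
    by (auto simp: tensor_span_def)
next
  case (Suc k)
  interpret T: tensor_product "tpow P k" M "tpow P (Suc k)" "tmul P k"
    by (rule tensor_product_tpow)
  let ?G = "elem_tensors M P (carr (tpow P 0)) k" and ?G' = "elem_tensors M P (carr (tpow P 0)) (Suc k)"
  have G: "?G \<subseteq> carr (tpow P k)" and G': "?G' \<subseteq> carr (tpow P (Suc k))"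
    by (intro elem_tensors_closed order_refl)+
  note fs = T.X.finite_sums_closed[OF G]
  note fs' = T.P.finite_sums_closed[OF G']
  have gen: "tmul P k g m \<in> ?G'" if g: "g \<in> ?G" and m: "m \<in> carr M" for g m
  proof -
    obtain x ms where x: "x \<in> carr (tpow P 0)" "length ms = k" "set ms \<subseteq> carr M" "g = elem_tensor P x ms"
      using g unfolding elem_tensors_def by blast
    then show ?thesis
      using m unfolding elem_tensors_def
      by (auto simp: elem_tensor_snoc intro!: exI[of _ x] exI[of _ "ms @ [m]"])
  qed
  have sums: "tmul P k w m \<in> finite_sums ?G'" if "w \<in> finite_sums ?G" "m \<in> carr M" for w m
    using that(1)
  proof (induction rule: finite_sums_induct)
    case zero
    then show ?case using that by (simp add: T.tensor_zero_left finite_sums_zero)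
  next
    case (add g y)
    have "tmul P k (g + y) m = tmul P k g m + tmul P k y m"
      using add that(2) G fs by (intro T.tensor_add_left) auto
    moreover have "tmul P k g m \<in> finite_sums ?G'"
      using gen[OF add(1) that(2)] finite_sums_base by blast
    ultimately show ?case using add.IH by (simp add: finite_sums_add)
  qed
  have "tmul P k w m \<in> tensor_span M P (carr (tpow P 0)) (Suc k)"
    if w: "w \<in> carr (tpow P k)" and m: "m \<in> carr M" for w m
  proof -
    obtain f where f: "\<And>n. f n \<in> finite_sums ?G" "hm_lim (tpow P k) f w"
      using w Suc.IH T.X.hm_closureE[OF _ fs] unfolding tensor_span_def by metis
    have "hm_lim (tpow P (Suc k)) (\<lambda>n. tmul P k (f n) m) (tmul P k w m)"
      using f fs m by (intro T.tensor_lim) auto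
    then show ?thesis
      unfolding tensor_span_def by (rule T.P.hm_closureI[OF fs' sums[OF f(1) m]])
  qed
  moreover have "additive_subgroup (tpow P (Suc k)) (tensor_span M P (carr (tpow P 0)) (Suc k))"
    by (intro tensor_span_subgroup hilbert_module.additive_subgroup_carr hilbert_base)
  ultimately have "finite_sums {tmul P k x m | x m. x \<in> carr (tpow P k) \<and> m \<in> carr M}
      \<subseteq> tensor_span M P (carr (tpow P 0)) (Suc k)"
    by (intro finite_sums_subset) auto
  then have "carr (tpow P (Suc k)) \<subseteq> tensor_span M P (carr (tpow P 0)) (Suc k)"
    unfolding T.tensor_dense[symmetric] unfolding tensor_span_def
    by (rule T.P.hm_closure_minimal[OF _ fs'])
  then show ?case
    using T.P.hm_closure_subset by (auto simp: tensor_span_def)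
qed

end

text \<open>\<open>tensor_ip\<close> computes each level from the one below, so the base vectors
  enter only through their inner product. Isometries compare two towers; orthogonality compares
  different base vectors in one tower.\<close>

lemma elem_tensor_gram:
  fixes M :: "('a::cstar_algebra, 'm::ab_group_add) corr"
    and P :: "('a, 'p::ab_group_add, 'm) tower" and Q :: "('a, 'q::ab_group_add, 'm) tower"
  assumes P: "hm_tower M P" and Q: "hm_tower M Q"
    and x: "x \<in> carr (tpow P 0)" "y \<in> carr (tpow P 0)" and x': "x' \<in> carr (tpow Q 0)" "y' \<in> carr (tpow Q 0)"
    and eq: "ip (tpow Q 0) x' y' = ip (tpow P 0) x y"
    and ms: "set ms \<subseteq> carr M" "set ns \<subseteq> carr M" "length ms = length ns"
  shows "ip (tpow Q (length ms)) (elem_tensor Q x' ms) (elem_tensor Q y' ns)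
    = ip (tpow P (length ms)) (elem_tensor P x ms) (elem_tensor P y ns)"
  using ms
proof (induction ms arbitrary: ns rule: rev_induct)
  case Nil
  then show ?case by (simp add: eq)
next
  case (snoc m ms)
  interpret P: hm_tower M P by fact
  interpret Q: hm_tower M Q by fact
  obtain ns' n where ns: "ns = ns' @ [n]" using snoc(4) by (cases ns rule: rev_cases) auto
  then have l: "length ms = length ns'" "set ms \<subseteq> carr M" "set ns' \<subseteq> carr M" "m \<in> carr M" "n \<in> carr M"
    using snoc by auto
  interpret TP: tensor_product "tpow P (length ms)" M "tpow P (Suc (length ms))" "tmul P (length ms)"
    by (rule P.tensor_product_tpow)
  interpret TQ: tensor_product "tpow Q (length ms)" M "tpow Q (Suc (length ms))" "tmul Q (length ms)"
    by (rule Q.tensor_product_tpow)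
  have c: "elem_tensor P x ms \<in> carr (tpow P (length ms))" "elem_tensor P y ns' \<in> carr (tpow P (length ms))"
    "elem_tensor Q x' ms \<in> carr (tpow Q (length ms))" "elem_tensor Q y' ns' \<in> carr (tpow Q (length ms))"
    using P.elem_tensor_closed Q.elem_tensor_closed x x' l by metis+
  show ?case
    using snoc.IH[OF l(2,3,1)] l(2-5) c
    by (simp add: ns elem_tensor_snoc TP.tensor_ip TQ.tensor_ip flip: l(1))
qed

lemma (in hm_tower) orthogonal_elem_tensors:
  assumes S: "S \<subseteq> carr (tpow P 0)" "S' \<subseteq> carr (tpow P 0)" and orth: "orthogonal_sets (tpow P 0) S S'"
  shows "orthogonal_sets (tpow P k) (elem_tensors M P S k) (elem_tensors M P S' k)"
  unfolding orthogonal_sets_def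
proof (intro ballI)
  interpret H0: hilbert_module "tpow P 0" by (rule hilbert_base)
  interpret H: hilbert_module "tpow P k" by (rule hilbert_tpow)
  fix g g' assume "g \<in> elem_tensors M P S k" "g' \<in> elem_tensors M P S' k"
  then obtain x ms y ns where g: "g = elem_tensor P x ms" "x \<in> S" "length ms = k" "set ms \<subseteq> carr M"
    "g' = elem_tensor P y ns" "y \<in> S'" "length ns = k" "set ns \<subseteq> carr M"
    unfolding elem_tensors_def by blast
  have xy: "x \<in> carr (tpow P 0)" "y \<in> carr (tpow P 0)" using g S by auto
  \<comment> \<open>Orthogonality means that \<open>x\<close> and \<open>0\<close> have the same
    inner product with \<open>y\<close>. The Gram identity thus allows \<open>x\<close> to be
    replaced by \<open>0\<close>, whose elementary tensors vanish.\<close>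
  have "ip (tpow P (length ms)) (elem_tensor P x ms) (elem_tensor P y ns)
      = ip (tpow P (length ms)) (elem_tensor P 0 ms) (elem_tensor P y ns)"
    using g xy orth
    by (intro elem_tensor_gram[OF hm_tower_axioms hm_tower_axioms] H0.zero_closed)
       (auto simp: orthogonal_sets_def)
  also have "\<dots> = 0"
    using g xy elem_tensor_closed[OF xy(2), of ns] by (simp add: elem_tensor_zero)
  finally show "ip (tpow P k) g g' = 0" using g by simp
qed

context hm_tower
begin

lemma orthogonal_tensor_span:
  assumes S: "S \<subseteq> carr (tpow P 0)" "S' \<subseteq> carr (tpow P 0)" and orth: "orthogonal_sets (tpow P 0) S S'"
  shows "orthogonal_sets (tpow P k) (tensor_span M P S k) (tensor_span M P S' k)"
proof -
  interpret H: hilbert_module "tpow P k" by (rule hilbert_tpow)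
  show ?thesis
    unfolding tensor_span_def
    by (intro H.orthogonal_sets_closure H.orthogonal_finite_sums H.finite_sums_closed
        orthogonal_elem_tensors elem_tensors_closed assms)
qed

lemma tensor_span_mono:
  "S \<subseteq> S' \<Longrightarrow> tensor_span M P S k \<subseteq> tensor_span M P S' k"
proof -
  assume "S \<subseteq> S'"
  then have "finite_sums (elem_tensors M P S k) \<subseteq> finite_sums (elem_tensors M P S' k)"
    by (fastforce simp: elem_tensors_def finite_sums_def)
  then show ?thesis
    unfolding tensor_span_def by (intro hilbert_module.hm_closure_mono hilbert_tpow)
qed

text \<open>On finite sums the splitting is additivity in the base vector. Orthogonality lets the
  closure be taken componentwise, giving one inclusion; the other holds because the left side is a
  subgroup containing both spans.\<close>

lemma tensor_span_orthogonal_sum: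
  assumes S: "additive_subgroup (tpow P 0) S" "additive_subgroup (tpow P 0) S'"
    and orth: "orthogonal_sets (tpow P 0) S S'"
  shows "tensor_span M P (set_sum S S') k = set_sum (tensor_span M P S k) (tensor_span M P S' k)"
proof -
  interpret H0: hilbert_module "tpow P 0" by (rule hilbert_base)
  interpret H: hilbert_module "tpow P k" by (rule hilbert_tpow)
  have SX: "S \<subseteq> carr (tpow P 0)" "S' \<subseteq> carr (tpow P 0)" using S by (simp_all add: additive_subgroup_def)
  let ?F = "\<lambda>S. finite_sums (elem_tensors M P S k)"
  have sub: "?F (set_sum S S') \<subseteq> set_sum (?F S) (?F S')"
  proof
    fix v assume "v \<in> ?F (set_sum S S')"
    then show "v \<in> set_sum (?F S) (?F S')"
    proof (induction rule: finite_sums_induct)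
      case zero
      have "0 = 0 + (0::'p)" by simp
      then show ?case unfolding set_sum_def using finite_sums_zero by blast
    next
      case (add g v)
      then obtain x y ms where g: "g = elem_tensor P (x + y) ms" "x \<in> S" "y \<in> S'"
        "length ms = k" "set ms \<subseteq> carr M"
        unfolding elem_tensors_def set_sum_def by blast
      obtain a b where v: "v = a + b" "a \<in> ?F S" "b \<in> ?F S'" using add.IH by (auto simp: set_sum_def)
      have "elem_tensor P x ms \<in> elem_tensors M P S k" "elem_tensor P y ms \<in> elem_tensors M P S' k"
        using g unfolding elem_tensors_def by blast+
      then have "elem_tensor P x ms + a \<in> ?F S" "elem_tensor P y ms + b \<in> ?F S'"
        using v finite_sums_base finite_sums_add by blast+
      moreover have "g + v = (elem_tensor P x ms + a) + (elem_tensor P y ms + b)"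
        using g v SX elem_tensor_add[of x y ms] by (auto simp: algebra_simps)
      ultimately show ?case unfolding set_sum_def by blast
    qed
  qed
  have "hm_closure (tpow P k) (?F (set_sum S S')) \<subseteq> hm_closure (tpow P k) (set_sum (?F S) (?F S'))"
    by (rule H.hm_closure_mono[OF sub])
  also have "\<dots> = set_sum (tensor_span M P S k) (tensor_span M P S' k)"
    unfolding tensor_span_def
    by (intro H.closure_orthogonal_sum elem_tensors_subgroup S H.orthogonal_finite_sums
        orthogonal_elem_tensors elem_tensors_closed SX orth)
  finally have 1: "tensor_span M P (set_sum S S') k \<subseteq> set_sum (tensor_span M P S k) (tensor_span M P S' k)"
    by (simp add: tensor_span_def)
  have "0 \<in> S" "0 \<in> S'" using S by (simp_all add: additive_subgroup_def)
  then have "S \<subseteq> set_sum S S'" "S' \<subseteq> set_sum S S'"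
    unfolding set_sum_def by (force intro: exI[of _ 0])+
  then have "tensor_span M P S k \<subseteq> tensor_span M P (set_sum S S') k"
    "tensor_span M P S' k \<subseteq> tensor_span M P (set_sum S S') k"
    by (auto dest: tensor_span_mono)
  moreover have "additive_subgroup (tpow P 0) (set_sum S S')"
    unfolding additive_subgroup_def
  proof (intro conjI ballI)
    show "set_sum S S' \<subseteq> carr (tpow P 0)" by (rule H0.set_sum_closed[OF SX])
    show "0 \<in> set_sum S S'" using \<open>0 \<in> S\<close> \<open>S \<subseteq> set_sum S S'\<close> by blast
    fix v w assume "v \<in> set_sum S S'" "w \<in> set_sum S S'"
    then obtain a b c d where "v = a + b" "w = c + d" "a \<in> S" "c \<in> S" "b \<in> S'" "d \<in> S'"
      by (auto simp: set_sum_def)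
    moreover from this have "v - w = (a - c) + (b - d)" by simp
    ultimately show "v - w \<in> set_sum S S'" using S unfolding set_sum_def additive_subgroup_def by blast
  qed
  ultimately have "set_sum (tensor_span M P S k) (tensor_span M P S' k) \<subseteq> tensor_span M P (set_sum S S') k"
    using tensor_span_subgroup[of "set_sum S S'" k] additive_subgroup_add
    unfolding set_sum_def by blast
  with 1 show ?thesis by blast
qed

end

section \<open>The maps \<open>S \<otimes> id\<^sub>k\<close> for inner-product preserving
  \<open>S\<close>\<close>

locale tower_isometry = P: hm_tower M P + Q: hm_tower M Q + S: hm_isometry "tpow P 0" "tpow Q 0" S
  for M :: "('a::cstar_algebra, 'm::ab_group_add) corr"
    and P :: "('a, 'p::ab_group_add, 'm) tower" and Q :: "('a, 'q::ab_group_add, 'm) tower"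
    and S :: "'p \<Rightarrow> 'q"
begin

abbreviation "idx k \<equiv> {(x, ms). x \<in> carr (tpow P 0) \<and> length ms = k \<and> set ms \<subseteq> carr M}"

lemma elem_tensors_image: "(\<lambda>(x, ms). elem_tensor P x ms) ` idx k = elem_tensors M P (carr (tpow P 0)) k"
  by (auto simp: elem_tensors_def image_iff)

lemma isometry_unique:
  assumes F: "hm_bounded_linear (tpow P k) (tpow Q k) F" and F': "hm_bounded_linear (tpow P k) (tpow Q k) F'"
    and eq: "\<And>x ms. x \<in> carr (tpow P 0) \<Longrightarrow> length ms = k \<Longrightarrow> set ms \<subseteq> carr M \<Longrightarrow>
      F (elem_tensor P x ms) = F' (elem_tensor P x ms)"
    and v: "v \<in> carr (tpow P k)"
  shows "F v = F' v"
proof (rule bounded_linear_eq_on_dense[OF P.hilbert_tpow Q.hilbert_tpow F F'])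
  show "elem_tensors M P (carr (tpow P 0)) k \<subseteq> carr (tpow P k)" by (rule P.elem_tensors_closed) simp
  show "hm_closure (tpow P k) (finite_sums (elem_tensors M P (carr (tpow P 0)) k)) = carr (tpow P k)"
    using P.tensor_span_carr by (simp add: tensor_span_def)
qed (use eq v in \<open>auto simp: elem_tensors_def\<close>)

text \<open>Resolves the definite description. Existence is \<open>isometric_extension\<close> for
  the elementary tensors, indexed by base vector and list of factors; uniqueness is density.\<close>

lemma tensor_id_spec:
  "hm_isometry (tpow P k) (tpow Q k) (tensor_id M P Q S k) \<and>
    (\<forall>x ms. x \<in> carr (tpow P 0) \<longrightarrow> length ms = k \<longrightarrow> set ms \<subseteq> carr M \<longrightarrow>
      tensor_id M P Q S k (elem_tensor P x ms) = elem_tensor Q (S x) ms)"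
proof -
  obtain F where F: "hm_isometry (tpow P k) (tpow Q k) F"
    and F_elem: "\<And>i. i \<in> idx k \<Longrightarrow>
      F ((\<lambda>(x, ms). elem_tensor P x ms) i) = (\<lambda>(x, ms). elem_tensor Q (S x) ms) i"
  proof (rule isometric_extension[OF P.hilbert_tpow Q.hilbert_tpow])
    show "(\<lambda>(x, ms). elem_tensor P x ms) ` idx k \<subseteq> carr (tpow P k)"
      unfolding elem_tensors_image by (rule P.elem_tensors_closed) simp
    show "(\<lambda>(x, ms). elem_tensor Q (S x) ms) ` idx k \<subseteq> carr (tpow Q k)"
      using Q.elem_tensor_closed S.maps_closed by auto
    show "hm_closure (tpow P k) (finite_sums ((\<lambda>(x, ms). elem_tensor P x ms) ` idx k)) = carr (tpow P k)"
      unfolding elem_tensors_image using P.tensor_span_carr by (simp add: tensor_span_def)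
    fix i j assume i: "i \<in> idx k" and j: "j \<in> idx k"
    obtain x ms y ns where "i = (x, ms)" "j = (y, ns)" by fastforce
    with i j show "ip (tpow Q k) ((\<lambda>(x, ms). elem_tensor Q (S x) ms) i) ((\<lambda>(x, ms). elem_tensor Q (S x) ms) j)
        = ip (tpow P k) ((\<lambda>(x, ms). elem_tensor P x ms) i) ((\<lambda>(x, ms). elem_tensor P x ms) j)"
      using elem_tensor_gram[OF P.hm_tower_axioms Q.hm_tower_axioms, of x y "S x" "S y" ms ns]
      by (simp add: S.maps_closed S.ip_image)
  qed blast
  \<comment> \<open>Restriction makes the map \<open>undefined\<close> off the carrier, as the
    description demands.\<close>
  define F' where "F' = restrict F (carr (tpow P k))"
  have elemP: "elem_tensor P x ms \<in> carr (tpow P k)"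
    if "x \<in> carr (tpow P 0)" "length ms = k" "set ms \<subseteq> carr M" for x ms
    using P.elem_tensor_closed that by blast
  have F'_iso: "hm_isometry (tpow P k) (tpow Q k) F'"
  proof (intro hm_isometry.intro hm_isometry_axioms.intro P.hilbert_tpow Q.hilbert_tpow)
    show "ip_preserving (tpow P k) (tpow Q k) F'"
      using hm_isometry.isometric[OF F] by (auto simp: ip_preserving_def F'_def)
  qed
  have F'_elem: "F' (elem_tensor P x ms) = elem_tensor Q (S x) ms"
    if "x \<in> carr (tpow P 0)" "length ms = k" "set ms \<subseteq> carr M" for x ms
    using F_elem[of "(x, ms)"] that elemP by (simp add: F'_def)
  have "tensor_id M P Q S k = F'"
    unfolding tensor_id_def
  proof (rule the_equality)
    show "F' \<in> extensional (carr (tpow P k)) \<and> hm_bounded_linear (tpow P k) (tpow Q k) F' \<and>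
      (\<forall>x\<in>carr (tpow P 0). \<forall>ms. length ms = k \<and> set ms \<subseteq> carr M \<longrightarrow>
        F' (elem_tensor P x ms) = elem_tensor Q (S x) ms)"
      using F'_elem hm_isometry.bounded_linear[OF F'_iso] by (simp add: F'_def)
    fix H assume H: "H \<in> extensional (carr (tpow P k)) \<and> hm_bounded_linear (tpow P k) (tpow Q k) H \<and>
      (\<forall>x\<in>carr (tpow P 0). \<forall>ms. length ms = k \<and> set ms \<subseteq> carr M \<longrightarrow>
        H (elem_tensor P x ms) = elem_tensor Q (S x) ms)"
    show "H = F'"
    proof (rule extensionalityI)
      show "H \<in> extensional (carr (tpow P k))" using H by blast
      show "F' \<in> extensional (carr (tpow P k))" by (simp add: F'_def)
      show "H v = F' v" if v: "v \<in> carr (tpow P k)" for v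
      proof (rule isometry_unique[OF _ hm_isometry.bounded_linear[OF F'_iso] _ v])
        show "hm_bounded_linear (tpow P k) (tpow Q k) H" using H by blast
        show "H (elem_tensor P x ms) = F' (elem_tensor P x ms)"
          if "x \<in> carr (tpow P 0)" "length ms = k" "set ms \<subseteq> carr M" for x ms
          using H that F'_elem[OF that] by simp
      qed
    qed
  qed
  then show ?thesis using F'_iso F'_elem by simp
qed

lemma tensor_id_isometry: "hm_isometry (tpow P k) (tpow Q k) (tensor_id M P Q S k)"
  using tensor_id_spec by blast

lemma tensor_id_elem:
  "x \<in> carr (tpow P 0) \<Longrightarrow> length ms = k \<Longrightarrow> set ms \<subseteq> carr M \<Longrightarrow>
    tensor_id M P Q S k (elem_tensor P x ms) = elem_tensor Q (S x) ms"
  using tensor_id_spec by blast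

text \<open>An isometry on a complete module carries closed spans onto closed spans, so only the
  images of the generators have to be identified.\<close>

lemma tensor_id_range: "tensor_id M P Q S k ` carr (tpow P k) = tensor_span M Q (S ` carr (tpow P 0)) k"
proof -
  interpret F: hm_isometry "tpow P k" "tpow Q k" "tensor_id M P Q S k" by (rule tensor_id_isometry)
  let ?G = "elem_tensors M P (carr (tpow P 0)) k"
  have G: "?G \<subseteq> carr (tpow P k)" by (rule P.elem_tensors_closed) simp
  have img: "tensor_id M P Q S k ` ?G = elem_tensors M Q (S ` carr (tpow P 0)) k"
  proof
    show "tensor_id M P Q S k ` ?G \<subseteq> elem_tensors M Q (S ` carr (tpow P 0)) k"
      using tensor_id_elem unfolding elem_tensors_def by blast
    show "elem_tensors M Q (S ` carr (tpow P 0)) k \<subseteq> tensor_id M P Q S k ` ?G"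
    proof
      fix g assume "g \<in> elem_tensors M Q (S ` carr (tpow P 0)) k"
      then obtain x ms where x: "x \<in> carr (tpow P 0)" "length ms = k" "set ms \<subseteq> carr M" "g = elem_tensor Q (S x) ms"
        unfolding elem_tensors_def by blast
      then have "g = tensor_id M P Q S k (elem_tensor P x ms)" by (simp add: tensor_id_elem)
      moreover have "elem_tensor P x ms \<in> ?G" using x unfolding elem_tensors_def by blast
      ultimately show "g \<in> tensor_id M P Q S k ` ?G" by blast
    qed
  qed
  have "tensor_id M P Q S k ` carr (tpow P k) = tensor_id M P Q S k ` hm_closure (tpow P k) (finite_sums ?G)"
    using P.tensor_span_carr by (simp add: tensor_span_def)
  also have "\<dots> = hm_closure (tpow Q k) (finite_sums (tensor_id M P Q S k ` ?G))"
    by (simp add: F.image_closure F.X.finite_sums_closed G F.image_finite_sums)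
  finally show ?thesis by (simp add: img tensor_span_def)
qed

end

section \<open>Orthogonal direct sums\<close>

definition hm_submodule :: "('a::cstar_algebra, 'x::ab_group_add, 'b) hmod_scheme \<Rightarrow> 'x set \<Rightarrow> bool" where
  "hm_submodule X S \<longleftrightarrow> additive_subgroup X S \<and>
    (\<forall>x\<in>S. \<forall>c. scal X c x \<in> S) \<and> (\<forall>x\<in>S. \<forall>a. act X x a \<in> S)"

definition orthogonal_part ::
    "('a::zero, 'x, 'b) hmod_scheme \<Rightarrow> 'x set \<Rightarrow> 'x set \<Rightarrow> 'x set" where
  "orthogonal_part X S S' = {x \<in> S. \<forall>n\<in>S'. ip X n x = 0}"

lemma submod_ominus: "submod X S \<ominus>\<^sub>H submod X S' = submod X (orthogonal_part X S S')"
  by (simp add: hm_ominus_def submod_def orthogonal_part_def)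

context hilbert_module
begin

lemma scal_zero: "scal X c 0 = 0"
  using scal_add_right[of 0 0 c] by (simp add: closed)

lemma act_zero: "act X 0 a = 0"
  using act_add_left[of 0 0 a] by (simp add: closed)

lemma scal_sum: "(\<And>i. i \<in> I \<Longrightarrow> f i \<in> carr X) \<Longrightarrow> scal X c (sum f I) = (\<Sum>i\<in>I. scal X c (f i))"
  by (induction I rule: infinite_finite_induct) (auto simp: closed scal_zero scal_add_right)

lemma act_sum: "(\<And>i. i \<in> I \<Longrightarrow> f i \<in> carr X) \<Longrightarrow> act X (sum f I) a = (\<Sum>i\<in>I. act X (f i) a)"
  by (induction I rule: infinite_finite_induct) (auto simp: closed act_zero act_add_left)

lemma hm_submodule_orthogonal_part:
  assumes S: "hm_submodule X S" and S': "S' \<subseteq> carr X"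
  shows "hm_submodule X (orthogonal_part X S S')"
proof -
  have c: "x \<in> carr X" if "x \<in> S" for x using that S by (auto simp: hm_submodule_def additive_subgroup_def)
  then show ?thesis
    using S subsetD[OF S']
    by (auto simp: hm_submodule_def additive_subgroup_def orthogonal_part_def ip_simps)
qed

lemma hm_sums_add:
  assumes "hm_sums X f s" "\<And>n. f n \<in> carr X" "hm_sums X g t" "\<And>n. g n \<in> carr X"
  shows "hm_sums X (\<lambda>n. f n + g n) (s + t)"
  unfolding hm_sums_def sum.distrib
  using assms by (intro hm_lim_add) (auto simp: hm_sums_def closed)

lemma hm_sums_scal:
  assumes "hm_sums X f s" "\<And>n. f n \<in> carr X"
  shows "hm_sums X (\<lambda>n. scal X c (f n)) (scal X c s)"
  using hm_lim_scal[of "\<lambda>n. sum f {..<n}" s c] assms by (simp add: hm_sums_def scal_sum closed)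

lemma hm_sums_act:
  assumes "hm_sums X f s" "\<And>n. f n \<in> carr X"
  shows "hm_sums X (\<lambda>n. act X (f n) a) (act X s a)"
  using hm_lim_act[of "\<lambda>n. sum f {..<n}" s a] assms by (simp add: hm_sums_def act_sum closed)

end

text \<open>\<open>spanning\<close> asks for a convergent expansion of each element, not just for
  density; surjectivity of \<open>total\<close> is then immediate.\<close>

locale orthogonal_decomposition = hilbert_module X
  for X :: "('a::cstar_algebra, 'l::ab_group_add) hmod" +
  fixes U :: "'l set" and W :: "nat \<Rightarrow> 'l set"
  assumes U: "hm_submodule X U" and W: "\<And>k. hm_submodule X (W k)"
    and U_orth: "\<And>k x y. x \<in> U \<Longrightarrow> y \<in> W k \<Longrightarrow> ip X x y = 0"
    and W_orth: "\<And>j k x y. j \<noteq> k \<Longrightarrow> x \<in> W j \<Longrightarrow> y \<in> W k \<Longrightarrow> ip X x y = 0"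
    and spanning: "\<And>x. x \<in> carr X \<Longrightarrow> \<exists>y\<in>U. \<exists>z. (\<forall>k. z k \<in> W k) \<and> hm_sums X z (x - y)"
begin

definition D :: "('a, 'l \<times> (nat \<Rightarrow> 'l)) hmod" where
  "D = hm_direct_sum (submod X U) (\<lambda>k. submod X (W k))"

definition total :: "'l \<times> (nat \<Rightarrow> 'l) \<Rightarrow> 'l" where
  "total = (\<lambda>(y, z). y + hm_suminf X z)"

lemma U_carr: "y \<in> U \<Longrightarrow> y \<in> carr X"
  using U by (auto simp: hm_submodule_def additive_subgroup_def)

lemma W_carr: "z \<in> W k \<Longrightarrow> z \<in> carr X"
  using W[of k] by (auto simp: hm_submodule_def additive_subgroup_def)

lemma ip_partial_sum:
  assumes z: "\<And>k. z k \<in> W k" and z': "\<And>k. z' k \<in> W k"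
  shows "ip X (\<Sum>i\<in>I. z i) (\<Sum>i\<in>I. z' i) = (\<Sum>i\<in>I. ip X (z i) (z' i))"
proof (cases "finite I")
  case True
  have "ip X (\<Sum>i\<in>I. z i) (\<Sum>i\<in>I. z' i) = (\<Sum>i\<in>I. \<Sum>j\<in>I. ip X (z j) (z' i))"
    using W_carr[OF z] W_carr[OF z'] by (simp add: ip_sum_left ip_sum_right closed)
  also have "\<dots> = (\<Sum>i\<in>I. \<Sum>j\<in>I. if j = i then ip X (z i) (z' i) else 0)"
    using W_orth[OF _ z z'] by (intro sum.cong refl) auto
  finally show ?thesis using True by simp
qed (simp add: closed)

text \<open>By orthogonality, the squared norm of a block of the series is the norm of the same
  block of \<open>ip X (z k) (z k)\<close>. The two Cauchy criteria coincide.\<close>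

lemma hm_sums_exists:
  assumes z: "\<And>k. z k \<in> W k" and s: "summable (\<lambda>k. ip X (z k) (z k))"
  shows "\<exists>s. hm_sums X z s"
proof -
  have zX: "z k \<in> carr X" for k using z W_carr by blast
  have "hm_Cauchy X (\<lambda>n. \<Sum>i<n. z i)"
    unfolding hm_Cauchy_def
  proof (intro allI impI)
    fix e :: real assume "e > 0"
    then obtain N where N: "\<And>m n. m \<ge> N \<Longrightarrow> norm (\<Sum>i=m..<n. ip X (z i) (z i)) < e\<^sup>2"
      using s unfolding summable_Cauchy by (meson zero_less_power)
    have *: "hnorm X ((\<Sum>i<n. z i) - (\<Sum>i<m. z i)) < e" if "N \<le> m" "m \<le> n" for m n
    proof -
      have "(\<Sum>i<n. z i) - (\<Sum>i<m. z i) = (\<Sum>i=m..<n. z i)"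
        using that by (simp add: sum_diff_nat_ivl lessThan_atLeast0)
      then have "(hnorm X ((\<Sum>i<n. z i) - (\<Sum>i<m. z i)))\<^sup>2 < e\<^sup>2"
        using N[OF that(1), of n] by (simp add: hnorm_square ip_partial_sum z)
      then show ?thesis using \<open>e > 0\<close> by (simp add: power2_less_imp_less)
    qed
    have "hnorm X ((\<Sum>i<m. z i) - (\<Sum>i<n. z i)) < e" if "N \<le> m" "N \<le> n" for m n
      using *[of m n] *[of n m] that hnorm_minus_commute[of "\<Sum>i<m. z i" "\<Sum>i<n. z i"] zX
      by (cases "m \<le> n") (auto simp: closed)
    then show "\<exists>N. \<forall>m\<ge>N. \<forall>n\<ge>N. hnorm X ((\<Sum>i<m. z i) - (\<Sum>i<n. z i)) < e" by blast
  qed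
  then show ?thesis using complete[of "\<lambda>n. \<Sum>i<n. z i"] zX by (simp add: closed hm_sums_def)
qed

lemma ip_total_sums:
  assumes z: "\<And>k. z k \<in> W k" "hm_sums X z s" and z': "\<And>k. z' k \<in> W k" "hm_sums X z' s'"
  shows "(\<lambda>k. ip X (z k) (z' k)) sums ip X s s'"
  unfolding sums_def ip_partial_sum[OF z(1) z'(1), symmetric]
  using z z' W_carr by (intro ip_tendsto) (auto simp: hm_sums_def intro!: closed)

lemma ip_U_sums:
  assumes z: "\<And>k. z k \<in> W k" "hm_sums X z s" and y: "y \<in> U"
  shows "ip X y s = 0"
proof -
  have zX: "z k \<in> carr X" for k using z W_carr by blast
  have "(\<lambda>n. ip X y (\<Sum>i<n. z i)) \<longlonglongrightarrow> ip X y s"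
    using z(2) zX U_carr[OF y] by (intro ip_tendsto hm_lim_const) (auto simp: hm_sums_def closed)
  moreover have "ip X y (\<Sum>i<n. z i) = 0" for n
    using U_orth[OF y z(1)] zX U_carr[OF y] by (simp add: ip_sum_right)
  ultimately show ?thesis by (simp add: LIMSEQ_const_iff)
qed

text \<open>Convergence in \<open>X\<close> replaces summability in the algebra. Closure under
  addition then needs no estimate of cross terms.\<close>

lemma D_carr: "(y, z) \<in> carr D \<longleftrightarrow> y \<in> U \<and> (\<forall>k. z k \<in> W k) \<and> (\<exists>s. hm_sums X z s)"
proof -
  have "summable (\<lambda>k. ip X (z k) (z k)) \<longleftrightarrow> (\<exists>s. hm_sums X z s)" if "\<forall>k. z k \<in> W k"
  proof
    show "\<exists>s. hm_sums X z s" if "summable (\<lambda>k. ip X (z k) (z k))"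
      using that \<open>\<forall>k. z k \<in> W k\<close> hm_sums_exists by blast
    show "summable (\<lambda>k. ip X (z k) (z k))" if "\<exists>s. hm_sums X z s"
      using that \<open>\<forall>k. z k \<in> W k\<close> ip_total_sums sums_summable by blast
  qed
  then show ?thesis by (auto simp: D_def hm_direct_sum_def submod_def)
qed

lemma D_carrE:
  assumes "d \<in> carr D"
  obtains y z s where "d = (y, z)" "y \<in> U" "y \<in> carr X" "\<And>k. z k \<in> W k" "\<And>k. z k \<in> carr X"
    "hm_sums X z s" "s \<in> carr X" "total d = y + s"
proof -
  obtain y z where d: "d = (y, z)" by fastforce
  then obtain s where s: "y \<in> U" "\<And>k. z k \<in> W k" "hm_sums X z s" using assms D_carr by blast
  then have zX: "\<And>k. z k \<in> carr X" using W_carr by blast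
  have "total d = y + s" using hm_suminf_eq[OF s(3) zX] by (simp add: total_def d)
  then show ?thesis using that d s zX U_carr by (auto simp: hm_sums_def hm_lim_def)
qed

lemma total_eq:
  assumes "y \<in> U" "\<And>k. z k \<in> W k" "hm_sums X z s"
  shows "(y, z) \<in> carr D" "total (y, z) = y + s"
proof -
  have "\<And>k. z k \<in> carr X" using assms W_carr by blast
  then show "total (y, z) = y + s" using hm_suminf_eq[OF assms(3)] by (simp add: total_def)
qed (use assms D_carr in blast)

lemma total_closed: "d \<in> carr D \<Longrightarrow> total d \<in> carr X"
  by (erule D_carrE) (simp add: closed)

lemma D_ip: "ip D d d' = ip X (fst d) (fst d') + (\<Sum>k. ip X (snd d k) (snd d' k))"
  by (simp add: D_def hm_direct_sum_def submod_def split_beta)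

lemma D_scal: "scal D c d = (scal X c (fst d), \<lambda>k. scal X c (snd d k))"
  by (simp add: D_def hm_direct_sum_def submod_def split_beta)

lemma D_act: "act D d a = (act X (fst d) a, \<lambda>k. act X (snd d k) a)"
  by (simp add: D_def hm_direct_sum_def submod_def split_beta)

lemma total_ip:
  assumes d: "d \<in> carr D" "d' \<in> carr D"
  shows "ip D d d' = ip X (total d) (total d')"
proof -
  obtain y z s where 1: "d = (y, z)" "y \<in> U" "y \<in> carr X" "\<And>k. z k \<in> W k" "\<And>k. z k \<in> carr X"
    "hm_sums X z s" "s \<in> carr X" "total d = y + s" using d(1) by (rule D_carrE) blast
  obtain y' z' s' where 2: "d' = (y', z')" "y' \<in> U" "y' \<in> carr X" "\<And>k. z' k \<in> W k" "\<And>k. z' k \<in> carr X"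
    "hm_sums X z' s'" "s' \<in> carr X" "total d' = y' + s'" using d(2) by (rule D_carrE) blast
  have "ip X y s' = 0" "ip X s y' = 0"
    using ip_U_sums[OF 2(4,6) 1(2)] ip_U_sums[OF 1(4,6) 2(2)] ip_commute_zero[OF 1(7) 2(3)] by simp_all
  moreover have "(\<Sum>k. ip X (z k) (z' k)) = ip X s s'"
    using ip_total_sums[OF 1(4,6) 2(4,6)] by (simp add: sums_iff)
  moreover have "ip D d d' = ip X y y' + (\<Sum>k. ip X (z k) (z' k))" by (simp add: D_ip 1(1) 2(1))
  ultimately show ?thesis using 1(3,7,8) 2(3,7,8) by (simp add: ip_add ip_add_left closed)
qed

lemma U_closed: "0 \<in> U" "y \<in> U \<Longrightarrow> y' \<in> U \<Longrightarrow> y + y' \<in> U" "y \<in> U \<Longrightarrow> scal X c y \<in> U" "y \<in> U \<Longrightarrow> act X y a \<in> U"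
  using U additive_subgroup_add[of X U] by (auto simp: hm_submodule_def additive_subgroup_def)

lemma W_closed: "0 \<in> W k" "z \<in> W k \<Longrightarrow> z' \<in> W k \<Longrightarrow> z + z' \<in> W k" "z \<in> W k \<Longrightarrow> scal X c z \<in> W k"
  "z \<in> W k \<Longrightarrow> act X z a \<in> W k"
  using W[of k] additive_subgroup_add[of X "W k"] by (auto simp: hm_submodule_def additive_subgroup_def)

lemma D_zero: "0 \<in> carr D"
proof -
  have "hm_sums X (\<lambda>_. 0) 0" by (simp add: hm_sums_def hm_lim_const closed)
  then have "(0, \<lambda>_. 0) \<in> carr D" by (intro total_eq U_closed W_closed)
  then show ?thesis by (simp add: zero_prod_def zero_fun_def)
qed

lemma D_add:
  assumes d: "d \<in> carr D" "d' \<in> carr D"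
  shows "d + d' \<in> carr D" "total (d + d') = total d + total d'"
proof -
  obtain y z s where 1: "d = (y, z)" "y \<in> U" "y \<in> carr X" "\<And>k. z k \<in> W k" "\<And>k. z k \<in> carr X"
    "hm_sums X z s" "s \<in> carr X" "total d = y + s" using d(1) by (rule D_carrE) blast
  obtain y' z' s' where 2: "d' = (y', z')" "y' \<in> U" "y' \<in> carr X" "\<And>k. z' k \<in> W k" "\<And>k. z' k \<in> carr X"
    "hm_sums X z' s'" "s' \<in> carr X" "total d' = y' + s'" using d(2) by (rule D_carrE) blast
  have eq: "d + d' = (y + y', \<lambda>k. z k + z' k)" by (simp add: 1(1) 2(1) plus_fun_def)
  have s: "hm_sums X (\<lambda>k. z k + z' k) (s + s')" by (intro hm_sums_add 1 2)
  note t = total_eq[OF U_closed(2)[OF 1(2) 2(2)] W_closed(2)[OF 1(4) 2(4)] s]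
  show "d + d' \<in> carr D" using t(1) by (simp add: eq)
  show "total (d + d') = total d + total d'" using t(2) by (simp add: eq 1(8) 2(8) add_ac)
qed

lemma D_scal_closed:
  assumes d: "d \<in> carr D"
  shows "scal D c d \<in> carr D" "total (scal D c d) = scal X c (total d)"
proof -
  obtain y z s where 1: "d = (y, z)" "y \<in> U" "y \<in> carr X" "\<And>k. z k \<in> W k" "\<And>k. z k \<in> carr X"
    "hm_sums X z s" "s \<in> carr X" "total d = y + s" using d by (rule D_carrE) blast
  have s: "hm_sums X (\<lambda>k. scal X c (z k)) (scal X c s)" by (intro hm_sums_scal 1)
  note t = total_eq[OF U_closed(3)[OF 1(2)] W_closed(3)[OF 1(4)] s]
  show "scal D c d \<in> carr D" using t(1) by (simp add: D_scal 1(1))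
  have "total (scal D c d) = scal X c y + scal X c s" using t(2) by (simp add: D_scal 1(1))
  also have "\<dots> = scal X c (total d)" using 1(3,7,8) by (simp add: scal_add_right)
  finally show "total (scal D c d) = scal X c (total d)" .
qed

lemma D_act_closed:
  assumes d: "d \<in> carr D"
  shows "act D d a \<in> carr D" "total (act D d a) = act X (total d) a"
proof -
  obtain y z s where 1: "d = (y, z)" "y \<in> U" "y \<in> carr X" "\<And>k. z k \<in> W k" "\<And>k. z k \<in> carr X"
    "hm_sums X z s" "s \<in> carr X" "total d = y + s" using d by (rule D_carrE) blast
  have s: "hm_sums X (\<lambda>k. act X (z k) a) (act X s a)" by (intro hm_sums_act 1)
  note t = total_eq[OF U_closed(4)[OF 1(2)] W_closed(4)[OF 1(4)] s]
  show "act D d a \<in> carr D" using t(1) by (simp add: D_act 1(1))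
  have "total (act D d a) = act X y a + act X s a" using t(2) by (simp add: D_act 1(1))
  also have "\<dots> = act X (total d) a" using 1(3,7,8) by (simp add: act_add_left)
  finally show "total (act D d a) = act X (total d) a" .
qed

lemma D_uminus:
  assumes d: "d \<in> carr D"
  shows "- d \<in> carr D" "total (- d) = - total d"
proof -
  obtain y z s where 1: "d = (y, z)" "y \<in> U" "y \<in> carr X" "\<And>k. z k \<in> W k" "\<And>k. z k \<in> carr X"
    "hm_sums X z s" "s \<in> carr X" "total d = y + s" using d by (rule D_carrE) blast
  have "scal D (-1) d = - d"
    using 1(3,5) by (auto simp: D_scal 1(1) scal_minus_one fun_eq_iff)
  then show "- d \<in> carr D" "total (- d) = - total d"
    using D_scal_closed[OF d, of "-1"] scal_minus_one[OF total_closed[OF d]] by simp_all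
qed

lemma D_diff:
  assumes d: "d \<in> carr D" "d' \<in> carr D"
  shows "d - d' \<in> carr D" "total (d - d') = total d - total d'"
  using D_add[OF d(1) D_uminus(1)[OF d(2)]] D_uminus(2)[OF d(2)] by simp_all

text \<open>The components are recovered by pairing: \<open>total d\<close> with \<open>y\<close>
  gives \<open>ip X y y\<close>, and the partial sums paired with \<open>z k\<close> are constant
  from \<open>n > k\<close> on.\<close>

lemma total_eq_zero:
  assumes d: "d \<in> carr D" and t: "total d = 0"
  shows "d = 0"
proof -
  obtain y z s where 1: "d = (y, z)" "y \<in> U" "y \<in> carr X" "\<And>k. z k \<in> W k" "\<And>k. z k \<in> carr X"
    "hm_sums X z s" "s \<in> carr X" "total d = y + s" using d by (rule D_carrE) blast
  have "ip X y y = ip X y (total d)" using 1 ip_U_sums[OF 1(4,6,2)] by (simp add: ip_add)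
  then have y: "y = 0" using t 1(3) ip_definite by simp
  then have s: "s = 0" using 1(8) t by simp
  have "z k = 0" for k
  proof -
    have "(\<lambda>n. ip X (z k) (\<Sum>i<n. z i)) \<longlonglongrightarrow> ip X (z k) s"
      using 1(5,6) by (intro ip_tendsto hm_lim_const) (auto simp: hm_sums_def closed)
    moreover have "ip X (z k) (\<Sum>i<n. z i) = ip X (z k) (z k)" if "n > k" for n
    proof -
      have "ip X (z k) (\<Sum>i<n. z i) = (\<Sum>i<n. ip X (z k) (z i))"
        using 1(5) by (simp add: ip_sum_right)
      also have "\<dots> = (\<Sum>i<n. if i = k then ip X (z k) (z k) else 0)"
        using W_orth[OF _ 1(4) 1(4)] by (intro sum.cong) auto
      finally show ?thesis using that by simp
    qed
    then have "(\<lambda>n. ip X (z k) (\<Sum>i<n. z i)) \<longlonglongrightarrow> ip X (z k) (z k)"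
      by (intro tendsto_eventually eventually_mono[OF eventually_gt_at_top[of k]])
    ultimately have "ip X (z k) (z k) = ip X (z k) s" by (rule LIMSEQ_unique[symmetric])
    then show ?thesis using 1(5) s ip_definite by simp
  qed
  then show ?thesis using y by (auto simp: 1(1) zero_prod_def fun_eq_iff)
qed

lemma total_image: "total ` carr D = carr X"
proof
  show "total ` carr D \<subseteq> carr X" using total_closed by auto
  show "carr X \<subseteq> total ` carr D"
  proof
    fix x assume x: "x \<in> carr X"
    obtain y z where yz: "y \<in> U" "\<And>k. z k \<in> W k" "hm_sums X z (x - y)" using spanning[OF x] by blast
    have "x = total (y, z)" using total_eq(2)[OF yz] by simp
    then show "x \<in> total ` carr D" using total_eq(1)[OF yz] by (rule image_eqI)
  qed
qed

lemma D_hnorm: "d \<in> carr D \<Longrightarrow> hnorm D d = hnorm X (total d)"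
  by (simp add: hnorm_def total_ip)

text \<open>Everything about the inner product of the direct sum is read off from \<open>X\<close> through the isometry
  \<open>total\<close>; in particular positivity needs no argument about sums of positive elements.\<close>

lemma D_hilbert: "hilbert_module D"
proof
  show "0 \<in> carr D" by (rule D_zero)
  fix d assume d: "d \<in> carr D"
  obtain y z s where 1: "d = (y, z)" "y \<in> U" "y \<in> carr X" "\<And>k. z k \<in> W k" "\<And>k. z k \<in> carr X"
    "hm_sums X z s" "s \<in> carr X" "total d = y + s" using d by (rule D_carrE) blast
  note t = total_closed[OF d]
  show "- d \<in> carr D" by (rule D_uminus(1)[OF d])
  show "scal D c d \<in> carr D" for c by (rule D_scal_closed(1)[OF d])
  show "act D d a \<in> carr D" for a by (rule D_act_closed(1)[OF d])
  show "scal D 1 d = d" using 1(3,5) by (simp add: D_scal 1(1) scal_one)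
  show "scal D c (scal D c' d) = scal D (c * c') d" for c c'
    using 1(3,5) by (simp add: D_scal 1(1) scal_scal)
  show "scal D (c + c') d = scal D c d + scal D c' d" for c c'
    using 1(3,5) by (simp add: D_scal 1(1) scal_add_left plus_fun_def)
  show "act D d (a + b) = act D d a + act D d b" for a b
    using 1(3,5) by (simp add: D_act 1(1) act_add_right plus_fun_def)
  show "act D d (a * b) = act D (act D d a) b" for a b
    using 1(3,5) by (simp add: D_act 1(1) act_mult)
  show "act D (scal D c d) a = scal D c (act D d a)" for c a
    using 1(3,5) by (simp add: D_act D_scal 1(1) act_scal)
  show "act D d (c *\<^sub>C a) = scal D c (act D d a)" for c a
    using 1(3,5) by (simp add: D_act D_scal 1(1) act_scaleC)
  show "cstar_positive (ip D d d)" using ip_positive[OF t] by (simp add: total_ip d)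
  show "d = 0" if "ip D d d = 0"
    using that ip_definite[OF t] by (intro total_eq_zero d) (simp add: total_ip d)
  fix d' assume d': "d' \<in> carr D"
  obtain y' z' s' where 2: "d' = (y', z')" "y' \<in> U" "y' \<in> carr X" "\<And>k. z' k \<in> W k" "\<And>k. z' k \<in> carr X"
    "hm_sums X z' s'" "s' \<in> carr X" "total d' = y' + s'" using d' by (rule D_carrE) blast
  note t' = total_closed[OF d']
  show "d + d' \<in> carr D" by (rule D_add(1)[OF d d'])
  show "scal D c (d + d') = scal D c d + scal D c d'" for c
    using 1(3,5) 2(3,5) by (simp add: D_scal 1(1) 2(1) scal_add_right plus_fun_def)
  show "act D (d + d') a = act D d a + act D d' a" for a
    using 1(3,5) 2(3,5) by (simp add: D_act 1(1) 2(1) act_add_left plus_fun_def)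
  show "ip D d (scal D c d') = c *\<^sub>C ip D d d'" for c
    by (simp add: total_ip d d' D_scal_closed ip_scal t t')
  show "ip D d (act D d' a) = ip D d d' * a" for a
    by (simp add: total_ip d d' D_act_closed ip_act t t')
  show "ip D d' d = star (ip D d d')"
    using ip_star[OF t t'] by (simp add: total_ip d d')
  fix d'' assume d'': "d'' \<in> carr D"
  show "ip D d (d' + d'') = ip D d d' + ip D d d''"
    using total_closed[OF d''] by (simp add: total_ip d d' d'' D_add ip_add t t')
next
  fix f assume f: "\<And>n. f n \<in> carr D" and C: "hm_Cauchy D f"
  have n: "hnorm D (d - d') = hnorm X (total d - total d')" if "d \<in> carr D" "d' \<in> carr D" for d d'
    using that by (simp add: D_hnorm D_diff)
  have "hm_Cauchy X (\<lambda>n. total (f n))" using C f by (simp add: hm_Cauchy_def n)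
  then obtain x where x: "hm_lim X (\<lambda>n. total (f n)) x"
    using complete[of "\<lambda>n. total (f n)"] f total_closed by blast
  then have "x \<in> total ` carr D" unfolding total_image by (simp add: hm_lim_def)
  then obtain d where d: "d \<in> carr D" "x = total d" by blast
  have "hm_lim D f d" using x f d by (simp add: hm_lim_def n)
  then show "\<exists>d. hm_lim D f d" by blast
qed

lemma direct_sum_isomorphism:
  shows "hilbert_module (hm_direct_sum (submod X U) (\<lambda>k. submod X (W k)))"
    and "\<forall>(y, z) \<in> carr (hm_direct_sum (submod X U) (\<lambda>k. submod X (W k))). \<exists>s. hm_sums X z s"
    and "hm_iso (hm_direct_sum (submod X U) (\<lambda>k. submod X (W k))) X (\<lambda>(y, z). y + hm_suminf X z)"
  using D_hilbert D_carr total_image total_closed total_ip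
  unfolding hm_iso_def ip_preserving_def D_def[symmetric] total_def[symmetric] by auto

end

text \<open>The projections of \<open>x\<close> onto the \<open>V k\<close> converge to \<open>x\<close>, and their increments are the components
  of \<open>x\<close>.\<close>

lemma (in hilbert_module) filtration_spanning:
  assumes V: "\<And>k. additive_subgroup X (V k)" and V_closed: "\<And>k. hm_closure X (V k) = V k"
    and V_mono: "\<And>k. V k \<subseteq> V (Suc k)" and V_dense: "hm_closure X (\<Union>k. V k) = carr X"
    and V_compl: "\<And>k v. v \<in> V (Suc k) \<Longrightarrow> \<exists>a\<in>V k. \<forall>n\<in>V k. ip X n (v - a) = 0"
    and x: "x \<in> carr X"
  shows "\<exists>y\<in>V 0. \<exists>z. (\<forall>k. z k \<in> orthogonal_part X (V (Suc k)) (V k)) \<and> hm_sums X z (x - y)"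
proof -
  have VX: "v \<in> carr X" if "v \<in> V k" for v k using V that by (auto simp: additive_subgroup_def)
  have V_le: "V k \<subseteq> V n" if "k \<le> n" for k n using lift_Suc_mono_le[of V] V_mono that by blast
  \<comment> \<open>One-step complements compose: whatever is orthogonal to \<open>V (k + m)\<close>
    is orthogonal to \<open>V k\<close>. Induction on \<open>m\<close> projects onto
    \<open>V k\<close> from any later stage.\<close>
  have stage: "\<exists>a\<in>V k. \<forall>n\<in>V k. ip X n (v - a) = 0" if "v \<in> V (k + m)" for v k m
    using that
  proof (induction m arbitrary: v)
    case 0
    then show ?case using VX by (intro bexI[of _ v]) auto
  next
    case (Suc m)
    then obtain a where a: "a \<in> V (k + m)" "\<And>n. n \<in> V (k + m) \<Longrightarrow> ip X n (v - a) = 0"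
      using V_compl[of v "k + m"] by auto
    obtain b where b: "b \<in> V k" "\<And>n. n \<in> V k \<Longrightarrow> ip X n (a - b) = 0" using Suc.IH[OF a(1)] by blast
    have "ip X n (v - b) = 0" if n: "n \<in> V k" for n
    proof -
      have "n \<in> V (k + m)" using n V_le[of k "k + m"] by auto
      moreover have "ip X n (v - b) = ip X n (v - a) + ip X n (a - b)"
        using VX[OF n] VX[OF Suc.prems] VX[OF a(1)] VX[OF b(1)] by (simp add: ip_simps)
      ultimately show ?thesis using a(2) b(2)[OF n] by simp
    qed
    then show ?case using b(1) by blast
  qed
  \<comment> \<open>Every stage lies in the sum of \<open>V k\<close> and its orthogonal part, so
    this sum is dense. Its closure is again an orthogonal sum with first summand \<open>V k\<close>,
    and it is all of \<open>carr X\<close>.\<close>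
  have proj: "\<exists>a\<in>V k. \<forall>n\<in>V k. ip X n (x - a) = 0" for k
  proof -
    let ?S = "V k" and ?S' = "orthogonal_part X (carr X) (V k)"
    have S': "additive_subgroup X ?S'"
      using VX by (auto simp: additive_subgroup_def orthogonal_part_def ip_simps closed)
    have S'X: "?S' \<subseteq> carr X" by (auto simp: orthogonal_part_def)
    have SX: "?S \<subseteq> carr X" using VX by blast
    have orth: "orthogonal_sets X ?S ?S'" by (auto simp: orthogonal_sets_def orthogonal_part_def)
    have "V n \<subseteq> set_sum ?S ?S'" for n
    proof
      fix v assume v: "v \<in> V n"
      then have "v \<in> V (k + n)" using V_le[of n "k + n"] by auto
      then obtain a where a: "a \<in> V k" "\<forall>n\<in>V k. ip X n (v - a) = 0" using stage by blast
      then have "v - a \<in> ?S'" using VX v by (auto simp: orthogonal_part_def closed)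
      moreover have "v = a + (v - a)" by simp
      ultimately show "v \<in> set_sum ?S ?S'" using a(1) unfolding set_sum_def by blast
    qed
    then have "(\<Union>n. V n) \<subseteq> set_sum ?S ?S'" by blast
    then have "carr X \<subseteq> hm_closure X (set_sum ?S ?S')" using hm_closure_mono V_dense by metis
    also have "\<dots> = set_sum (V k) (hm_closure X ?S')"
      using closure_orthogonal_sum[OF V S' orth] V_closed by simp
    finally obtain a b where ab: "x = a + b" "a \<in> V k" "b \<in> hm_closure X ?S'"
      using x unfolding set_sum_def by blast
    have "orthogonal_sets X (V k) (hm_closure X ?S')"
      using orthogonal_sets_closure[OF SX S'X orth] V_closed by simp
    then show ?thesis using ab unfolding orthogonal_sets_def by (intro bexI[of _ a]) auto
  qed
  then obtain a where a: "\<And>k. a k \<in> V k" "\<And>k n. n \<in> V k \<Longrightarrow> ip X n (x - a k) = 0" by metis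
  have aX: "a k \<in> carr X" for k using a(1) VX by blast
  define z where "z k = a (Suc k) - a k" for k
  have "z k \<in> orthogonal_part X (V (Suc k)) (V k)" for k
  proof -
    have "z k \<in> V (Suc k)"
      using a(1)[of k] a(1)[of "Suc k"] V_mono[of k] V[of "Suc k"] by (auto simp: z_def additive_subgroup_def)
    moreover have "ip X n (z k) = 0" if n: "n \<in> V k" for n
    proof -
      have "ip X n (z k) = ip X n (x - a k) - ip X n (x - a (Suc k))"
        using VX[OF n] aX x by (simp add: z_def ip_simps)
      then show ?thesis using a(2)[OF n] a(2)[of n "Suc k"] n V_mono by auto
    qed
    ultimately show ?thesis by (simp add: orthogonal_part_def)
  qed
  moreover have "hm_sums X z (x - a 0)"
  proof -
    \<comment> \<open>\<open>a n\<close> is a best approximation of \<open>x\<close> in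
      \<open>V n\<close>. A single \<open>v\<close> in \<open>V N\<close> within \<open>e\<close> of
      \<open>x\<close> therefore bounds the error of every \<open>a n\<close> with
      \<open>n \<ge> N\<close>.\<close>
    have lim: "(\<lambda>n. hnorm X (x - a n)) \<longlonglongrightarrow> 0"
    proof (rule LIMSEQ_I)
      fix e :: real assume e: "e > 0"
      obtain v N where v: "v \<in> V N" "hnorm X (x - v) < e"
        using x e V_dense[symmetric] unfolding hm_closure_def by blast
      have "hnorm X (x - a n) < e" if n: "n \<ge> N" for n
      proof -
        have "v \<in> V n" using v V_le[OF n] by blast
        then have "a n - v \<in> V n" using a(1) V[of n] by (simp add: additive_subgroup_def)
        then have "ip X (a n - v) (x - a n) = 0" by (rule a(2))
        then have "ip X (x - a n) (a n - v) = 0"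
          using ip_commute_zero[of "a n - v" "x - a n"] aX x VX[OF v(1)] by (simp add: closed)
        then have "hnorm X (x - a n) \<le> hnorm X ((x - a n) + (a n - v))"
          using aX x VX[OF v(1)] by (intro hnorm_le_add_orthogonal closed)
        then show ?thesis using v(2) by simp
      qed
      then show "\<exists>no. \<forall>n\<ge>no. norm (hnorm X (x - a n) - 0) < e" by auto
    qed
    have tele: "(\<Sum>i<n. z i) = a n - a 0" for n
      unfolding z_def by (rule sum_lessThan_telescope)
    have "hnorm X ((\<Sum>i<n. z i) - (x - a 0)) = hnorm X (x - a n)" for n
      using hnorm_minus_commute[OF x aX, of n] by (simp add: tele)
    then show ?thesis using lim x aX by (simp add: hm_sums_def hm_lim_def closed)
  qed
  ultimately show ?thesis using a(1)[of 0] by blast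
qed

lemma filtration_decomposition:
  fixes X :: "('a::cstar_algebra, 'l::ab_group_add) hmod"
  assumes X: "hilbert_module X"
    and V: "\<And>k. hm_submodule X (V k)" and V_closed: "\<And>k. hm_closure X (V k) = V k"
    and V_mono: "\<And>k. V k \<subseteq> V (Suc k)" and V_dense: "hm_closure X (\<Union>k. V k) = carr X"
    and V_compl: "\<And>k v. v \<in> V (Suc k) \<Longrightarrow> \<exists>a\<in>V k. \<forall>n\<in>V k. ip X n (v - a) = 0"
  shows "orthogonal_decomposition X (V 0) (\<lambda>k. orthogonal_part X (V (Suc k)) (V k))"
proof -
  interpret hilbert_module X by fact
  have sub: "additive_subgroup X (V k)" for k using V by (simp add: hm_submodule_def)
  then have VX: "V k \<subseteq> carr X" for k by (simp add: additive_subgroup_def)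
  have V_le: "V k \<subseteq> V n" if "k \<le> n" for k n using lift_Suc_mono_le[of V] V_mono that by blast
  have lt: "ip X x y = 0"
    if "j < k" "x \<in> orthogonal_part X (V (Suc j)) (V j)" "y \<in> orthogonal_part X (V (Suc k)) (V k)" for j k x y
    using that V_le[of "Suc j" k] by (auto simp: orthogonal_part_def)
  show ?thesis
  proof (intro orthogonal_decomposition.intro orthogonal_decomposition_axioms.intro X)
    show "hm_submodule X (V 0)" by (rule V)
    show "hm_submodule X (orthogonal_part X (V (Suc k)) (V k))" for k
      by (intro hm_submodule_orthogonal_part V VX)
    show "ip X x y = 0" if "x \<in> V 0" "y \<in> orthogonal_part X (V (Suc k)) (V k)" for k x y
      using that V_le[of 0 k] by (auto simp: orthogonal_part_def)
    show "ip X x y = 0"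
      if "j \<noteq> k" "x \<in> orthogonal_part X (V (Suc j)) (V j)" "y \<in> orthogonal_part X (V (Suc k)) (V k)" for j k x y
    proof (cases "j < k")
      case False
      have "x \<in> carr X" "y \<in> carr X" using that VX by (auto simp: orthogonal_part_def)
      then show ?thesis using lt[OF _ that(3,2)] ip_commute_zero that(1) False by auto
    qed (use lt that in blast)
    show "\<exists>y\<in>V 0. \<exists>z. (\<forall>k. z k \<in> orthogonal_part X (V (Suc k)) (V k)) \<and> hm_sums X z (x - y)"
      if "x \<in> carr X" for x
      by (rule filtration_spanning[OF sub V_closed V_mono V_dense V_compl that])
  qed
qed

section \<open>The shift on the direct limit\<close>

text \<open>The base splits into the range of \<open>S\<close> and its orthogonal part. Tensoring
  this splitting gives the claim, as \<open>tensor_id_range\<close> identifies the first summand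
  with the range of \<open>S \<otimes> id\<^sub>k\<close>.\<close>

lemma (in tower_isometry) tensor_id_complemented:
  assumes compl: "\<And>v. v \<in> carr (tpow Q 0) \<Longrightarrow>
      \<exists>u\<in>carr (tpow P 0). \<forall>x\<in>carr (tpow P 0). ip (tpow Q 0) (S x) (v - S u) = 0"
    and v: "v \<in> carr (tpow Q k)"
  shows "\<exists>u\<in>carr (tpow P k). \<forall>x\<in>carr (tpow P k).
    ip (tpow Q k) (tensor_id M P Q S k x) (v - tensor_id M P Q S k u) = 0"
proof -
  let ?N = "S ` carr (tpow P 0)"
  let ?N' = "orthogonal_part (tpow Q 0) (carr (tpow Q 0)) ?N"
  have N: "additive_subgroup (tpow Q 0) ?N"
    by (intro S.additive_subgroup_image S.X.additive_subgroup_carr)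
  then have NX: "?N \<subseteq> carr (tpow Q 0)" by (simp add: additive_subgroup_def)
  have N': "additive_subgroup (tpow Q 0) ?N'"
    using NX by (auto simp: additive_subgroup_def orthogonal_part_def S.Y.ip_simps S.Y.closed S.maps_closed)
  have N'X: "?N' \<subseteq> carr (tpow Q 0)" by (auto simp: orthogonal_part_def)
  have orth: "orthogonal_sets (tpow Q 0) ?N ?N'" by (auto simp: orthogonal_sets_def orthogonal_part_def)
  have "carr (tpow Q 0) \<subseteq> set_sum ?N ?N'"
  proof
    fix w assume w: "w \<in> carr (tpow Q 0)"
    obtain u where u: "u \<in> carr (tpow P 0)" "\<forall>x\<in>carr (tpow P 0). ip (tpow Q 0) (S x) (w - S u) = 0"
      using compl[OF w] by blast
    have "w - S u \<in> ?N'" using u w by (auto simp: orthogonal_part_def S.Y.closed S.maps_closed)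
    moreover have "w = S u + (w - S u)" by simp
    ultimately show "w \<in> set_sum ?N ?N'" using u(1) unfolding set_sum_def by blast
  qed
  then have "carr (tpow Q 0) = set_sum ?N ?N'" using S.Y.set_sum_closed[OF NX N'X] by blast
  then have "carr (tpow Q k) = set_sum (tensor_span M Q ?N k) (tensor_span M Q ?N' k)"
    using Q.tensor_span_orthogonal_sum[OF N N' orth, of k] Q.tensor_span_carr[of k] by simp
  then obtain a b where ab: "v = a + b" "a \<in> tensor_span M Q ?N k" "b \<in> tensor_span M Q ?N' k"
    using v unfolding set_sum_def by blast
  obtain u where u: "u \<in> carr (tpow P k)" "a = tensor_id M P Q S k u"
    using ab(2) unfolding tensor_id_range[symmetric] by blast
  have "ip (tpow Q k) (tensor_id M P Q S k x) b = 0" if "x \<in> carr (tpow P k)" for x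
    using Q.orthogonal_tensor_span[OF NX N'X orth, of k] ab(3) that
    unfolding tensor_id_range[symmetric] orthogonal_sets_def by blast
  then show ?thesis using u ab(1) by (intro bexI[of _ u]) auto
qed

theorem proposition2p4:
  fixes M :: "('a::cstar_algebra, 'm::ab_group_add) corr"
    and Y :: "('a, 'p::ab_group_add) hmod"
    and YM :: "('a, 'p, 'm) tower"
    and T :: "'p \<Rightarrow> 'p"
    and Yinf :: "('a, 'l::ab_group_add) hmod"
    and \<iota> :: "nat \<Rightarrow> 'p \<Rightarrow> 'l"
    and YinfM :: "('a, 'l, 'm) tower"
    and R :: "'l \<Rightarrow> 'l"
    and Yk Z :: "nat \<Rightarrow> ('a, 'l) hmod"
  assumes "correspondence M"
    and "hilbert_module Y"
    and "tensor_tower Y M YM"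
    and "ip_preserving Y (tpow YM 1) T"
    and "adjointable Y (tpow YM 1) T"
    and "direct_limit (tpow YM) (tensor_id M YM (tower_shift 1 YM) T) Yinf \<iota>"
    and "tensor_tower Yinf M YinfM"
    and "hm_iso Yinf (tpow YinfM 1) R"
    and "\<And>k u. u \<in> carr (tpow YM (Suc k)) \<Longrightarrow>
           R (\<iota> (Suc k) u) = tensor_id M (tower_shift k YM) YinfM (\<iota> k) 1 u"
    and "\<And>k. Yk k = submod Yinf (\<iota> k ` carr (tpow YM k))"
    and "\<And>k. Z k = Yk (Suc k) \<ominus>\<^sub>H Yk k"
  shows "hilbert_module (hm_direct_sum (Yk 0) Z)
    \<and> (\<forall>(y, z) \<in> carr (hm_direct_sum (Yk 0) Z). \<exists>s. hm_sums Yinf z s)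
    \<and> hm_iso (hm_direct_sum (Yk 0) Z) Yinf (\<lambda>(y, z). y + hm_suminf Yinf z)
    \<and> (\<forall>k. hm_iso Yinf (tpow YinfM k) (tensor_power_map M YinfM R k)
          \<and> hm_iso (Z k) (sub_tensor M YinfM (Z 0) k) (tensor_power_map M YinfM R k))"
proof -
  interpret M: correspondence M by fact
  have tower: "tpow YM 0 = Y" "\<And>k. internal_tensor (tpow YM k) M (tpow YM (Suc k)) (tmul YM k)"
    using assms(3) by (simp_all add: tensor_tower_def)
  have tower_inf: "tpow YinfM 0 = Yinf"
    "\<And>k. internal_tensor (tpow YinfM k) M (tpow YinfM (Suc k)) (tmul YinfM k)"
    using assms(7) by (simp_all add: tensor_tower_def)
  have lim: "hilbert_module Yinf" "\<And>k. ip_preserving (tpow YM k) Yinf (\<iota> k)"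
    "\<And>k x. x \<in> carr (tpow YM k) \<Longrightarrow> \<iota> (Suc k) (tensor_id M YM (tower_shift 1 YM) T k x) = \<iota> k x"
    "hm_closure Yinf (\<Union>k. \<iota> k ` carr (tpow YM k)) = carr Yinf"
    using assms(6) by (simp_all add: direct_limit_def)
  interpret Yinf: hilbert_module Yinf by (rule lim)
  interpret P: hm_tower M YM
    by (intro hm_tower.intro hm_tower_axioms.intro assms(1) tower(2)) (simp add: tower(1) assms(2))
  interpret Q: hm_tower M YinfM
    by (intro hm_tower.intro hm_tower_axioms.intro assms(1) tower_inf(2)) (simp add: tower_inf(1) lim(1))
  have P_shift: "hm_tower M (tower_shift j YM)" for j by (rule P.hm_tower_shift)

  interpret T: tower_isometry M YM "tower_shift 1 YM" T
  proof (intro tower_isometry.intro P.hm_tower_axioms P_shift hm_isometry.intro hm_isometry_axioms.intro)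
    show "ip_preserving (tpow YM 0) (tpow (tower_shift 1 YM) 0) T" using assms(4) by (simp add: tower(1))
  qed (simp_all add: P.hilbert_tpow)
  have I: "hm_isometry (tpow YM k) Yinf (\<iota> k)" for k
    by (intro hm_isometry.intro hm_isometry_axioms.intro P.hilbert_tpow lim(1,2))
  have I_tower: "tower_isometry M (tower_shift k YM) YinfM (\<iota> k)" for k
    by (intro tower_isometry.intro P_shift Q.hm_tower_axioms) (simp add: tower_inf(1) I)
  have R_iso: "ip_preserving Yinf (tpow YinfM 1) R" "R ` carr Yinf = carr (tpow YinfM 1)"
    using assms(8) by (simp_all add: hm_iso_def)
  interpret R: tower_isometry M YinfM "tower_shift 1 YinfM" R
  proof (intro tower_isometry.intro Q.hm_tower_axioms Q.hm_tower_shift hm_isometry.intro hm_isometry_axioms.intro)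
    show "ip_preserving (tpow YinfM 0) (tpow (tower_shift 1 YinfM) 0) R"
      using R_iso by (simp add: tower_inf(1))
  qed (simp_all add: Q.hilbert_tpow)

  \<comment> \<open>The filtration of the limit by the \<open>V k\<close>\<close>
  let ?T = "\<lambda>k. tensor_id M YM (tower_shift 1 YM) T k"
  define V where "V k = \<iota> k ` carr (tpow YM k)" for k
  have V_sub: "hm_submodule Yinf (V k)" for k
  proof -
    interpret I: hm_isometry "tpow YM k" Yinf "\<iota> k" by (rule I)
    have "scal Yinf c v \<in> V k" "act Yinf v a \<in> V k" if "v \<in> V k" for v c a
      using that by (auto simp: V_def I.X.closed simp flip: I.map_scal I.map_act)
    then show ?thesis
      by (simp add: hm_submodule_def V_def I.additive_subgroup_image I.X.additive_subgroup_carr)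
  qed
  have V_closed: "hm_closure Yinf (V k) = V k" for k
  proof -
    interpret I: hm_isometry "tpow YM k" Yinf "\<iota> k" by (rule I)
    have "hm_closure (tpow YM k) (carr (tpow YM k)) = carr (tpow YM k)"
      using I.X.hm_closure_subset I.X.subset_hm_closure by blast
    then show ?thesis using I.image_closure[of "carr (tpow YM k)"] by (simp add: V_def)
  qed
  have T_maps: "?T k x \<in> carr (tpow YM (Suc k))" if "x \<in> carr (tpow YM k)" for k x
    using hm_isometry.maps_closed[OF T.tensor_id_isometry that] by simp
  have V_mono: "V k \<subseteq> V (Suc k)" for k
  proof
    fix v assume "v \<in> V k"
    then obtain x where x: "x \<in> carr (tpow YM k)" "v = \<iota> k x" by (auto simp: V_def)
    then have "v = \<iota> (Suc k) (?T k x)" using lim(3)[OF x(1)] by simp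
    then show "v \<in> V (Suc k)" using T_maps[OF x(1)] by (auto simp: V_def)
  qed
  obtain T' where T': "is_adjoint Y (tpow YM 1) T T'" using assms(5) by (auto simp: adjointable_def)
  have V_compl: "\<exists>a\<in>V k. \<forall>n\<in>V k. ip Yinf n (v - a) = 0" if v: "v \<in> V (Suc k)" for v k
  proof -
    interpret I: hm_isometry "tpow YM (Suc k)" Yinf "\<iota> (Suc k)" by (rule I)
    obtain w where w: "w \<in> carr (tpow YM (Suc k))" "v = \<iota> (Suc k) w" using v by (auto simp: V_def)
    have "\<exists>u\<in>carr (tpow YM k). \<forall>x\<in>carr (tpow YM k).
      ip (tpow (tower_shift 1 YM) k) (?T k x) (w - ?T k u) = 0"
    proof (rule T.tensor_id_complemented)
      show "w \<in> carr (tpow (tower_shift 1 YM) k)" using w by simp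
      fix b assume b: "b \<in> carr (tpow (tower_shift 1 YM) 0)"
      have b1: "b \<in> carr (tpow YM 1)" using b by simp
      have u: "T' b \<in> carr (tpow YM 0)" using T' b1 by (auto simp: is_adjoint_def tower(1))
      \<comment> \<open>\<open>T (T' b)\<close> is the projection of \<open>b\<close> onto the range
        of \<open>T\<close>: both \<open>b\<close> and \<open>T (T' b)\<close> have the inner
        product \<open>ip Y x (T' b)\<close> with \<open>T x\<close>, the first by adjointness and
        the second by isometry.\<close>
      have "ip (tpow (tower_shift 1 YM) 0) (T x) (b - T (T' b)) = 0" if x: "x \<in> carr (tpow YM 0)" for x
      proof -
        have "ip (tpow (tower_shift 1 YM) 0) (T x) b = ip (tpow YM 0) x (T' b)"
          using T' b1 x by (simp add: is_adjoint_def tower(1))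
        moreover have "ip (tpow (tower_shift 1 YM) 0) (T x) (T (T' b)) = ip (tpow YM 0) x (T' b)"
          by (rule T.S.ip_image[OF x u])
        ultimately show ?thesis
          using T.S.Y.ip_diff_right[OF T.S.maps_closed[OF x] b T.S.maps_closed[OF u]] by simp
      qed
      then show "\<exists>u\<in>carr (tpow YM 0). \<forall>x\<in>carr (tpow YM 0).
        ip (tpow (tower_shift 1 YM) 0) (T x) (b - T u) = 0" using u by blast
    qed
    then obtain u where u: "u \<in> carr (tpow YM k)"
      "\<And>x. x \<in> carr (tpow YM k) \<Longrightarrow> ip (tpow YM (Suc k)) (?T k x) (w - ?T k u) = 0" by auto
    have "ip Yinf n (v - \<iota> k u) = 0" if n: "n \<in> V k" for n
    proof -
      \<comment> \<open>The connecting map lifts elements of \<open>V k\<close> to level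
        \<open>Suc k\<close>, so that all inner products are compared under the single isometry
        \<open>\<iota> (Suc k)\<close>.\<close>
      obtain x where x: "x \<in> carr (tpow YM k)" "n = \<iota> (Suc k) (?T k x)"
        using n lim(3)[symmetric] unfolding V_def by blast
      have "v - \<iota> k u = \<iota> (Suc k) (w - ?T k u)"
        using I.map_diff[OF w(1) T_maps[OF u(1)]] w(2) lim(3)[OF u(1)] by simp
      then show ?thesis
        using I.ip_image[OF T_maps[OF x(1)] I.X.diff_closed[OF w(1) T_maps[OF u(1)]]] u(2)[OF x(1)] x(2)
        by simp
    qed
    moreover have "\<iota> k u \<in> V k" using u(1) by (simp add: V_def)
    ultimately show ?thesis by blast
  qed
  have V_dense: "hm_closure Yinf (\<Union>k. V k) = carr Yinf" using lim(4) by (simp add: V_def)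

  define W where "W k = orthogonal_part Yinf (V (Suc k)) (V k)" for k
  have Yk: "Yk k = submod Yinf (V k)" for k using assms(10) by (simp add: V_def)
  have Z: "Z k = submod Yinf (W k)" for k
    using assms(11) by (simp add: Yk submod_ominus W_def)
  interpret dec: orthogonal_decomposition Yinf "V 0" W
    unfolding W_def[abs_def]
    by (rule filtration_decomposition[OF lim(1) V_sub V_closed V_mono V_dense V_compl])
  have Z_eq: "Z = (\<lambda>k. submod Yinf (W k))" using Z by auto

  \<comment> \<open>The powers of \<open>R\<close> and their effect on the canonical maps\<close>
  let ?R = "tensor_power_map M YinfM R"
  have R_pow: "hm_isometry Yinf (tpow YinfM k) (?R k) \<and> ?R k ` carr Yinf = carr (tpow YinfM k)" for k
  proof (induction k)
    case 0
    have "hm_isometry Yinf Yinf id"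
      by (intro hm_isometry.intro hm_isometry_axioms.intro lim(1)) (simp add: ip_preserving_def)
    then show ?case by (simp add: tower_inf(1) id_def)
  next
    case (Suc k)
    have iso: "hm_isometry (tpow YinfM k) (tpow YinfM (Suc k)) (tensor_id M YinfM (tower_shift 1 YinfM) R k)"
      using R.tensor_id_isometry[of k] by simp
    \<comment> \<open>Since \<open>R\<close> is onto, the range of
      \<open>R \<otimes> id\<^sub>k\<close> is the span over the full base of the shifted tower,
      hence everything.\<close>
    have "carr (tpow (tower_shift 1 YinfM) 0) = R ` carr (tpow YinfM 0)"
      using R_iso(2) by (simp add: tower_inf(1))
    then have "tensor_id M YinfM (tower_shift 1 YinfM) R k ` carr (tpow YinfM k) = carr (tpow YinfM (Suc k))"
      using R.tensor_id_range[of k] R.Q.tensor_span_carr[of k] by simp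
    then have "?R (Suc k) ` carr Yinf = carr (tpow YinfM (Suc k))"
      using Suc by (simp flip: image_image add: image_comp[symmetric])
    moreover have "hm_isometry Yinf (tpow YinfM (Suc k)) (?R (Suc k))"
      using hm_isometry_compose[OF conjunct1[OF Suc] iso] by simp
    ultimately show ?case by blast
  qed

  \<comment> \<open>\<open>j\<close> has to vary: as \<open>j + Suc k = Suc j + k\<close>, the
    induction hypothesis is used at \<open>Suc j\<close> and leaves
    \<open>R \<otimes> id\<^sub>k\<close> applied after
    \<open>\<iota> (Suc j) \<otimes> id\<^sub>k\<close>.\<close>
  have R_iota: "?R k (\<iota> (j + k) u) = tensor_id M (tower_shift j YM) YinfM (\<iota> j) k u"
    if "u \<in> carr (tpow YM (j + k))" for j k u
    using that
  proof (induction k arbitrary: j u)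
    case 0
    interpret J: tower_isometry M "tower_shift j YM" YinfM "\<iota> j" by (rule I_tower)
    show ?case using J.tensor_id_elem[of u "[]" 0] 0 by simp
  next
    case (Suc k)
    interpret J: tower_isometry M "tower_shift j YM" YinfM "\<iota> j" by (rule I_tower)
    interpret J': tower_isometry M "tower_shift (Suc j) YM" YinfM "\<iota> (Suc j)" by (rule I_tower)
    let ?F = "tensor_id M YinfM (tower_shift 1 YinfM) R k
      \<circ> tensor_id M (tower_shift (Suc j) YM) YinfM (\<iota> (Suc j)) k"
    have F: "hm_isometry (tpow (tower_shift j YM) (Suc k)) (tpow YinfM (Suc k)) ?F"
      using hm_isometry_compose[OF J'.tensor_id_isometry[of k] R.tensor_id_isometry[of k]] by simp
    have "?R (Suc k) (\<iota> (j + Suc k) u) = ?F u"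
      using Suc.IH[of u "Suc j"] Suc.prems by simp
    also have "\<dots> = tensor_id M (tower_shift j YM) YinfM (\<iota> j) (Suc k) u"
    proof (rule J.isometry_unique[OF hm_isometry.bounded_linear[OF F]
          hm_isometry.bounded_linear[OF J.tensor_id_isometry]])
      show "u \<in> carr (tpow (tower_shift j YM) (Suc k))" using Suc.prems by simp
      fix x ms assume x: "x \<in> carr (tpow (tower_shift j YM) 0)" and "length ms = Suc k" "set ms \<subseteq> carr M"
      then obtain m ns where ms: "ms = m # ns" "length ns = k" "m \<in> carr M" "set ns \<subseteq> carr M"
        by (cases ms) auto
      \<comment> \<open>The first factor is absorbed into the base vector, which moves it to level
        \<open>Suc j\<close>. There the defining relation of \<open>R\<close>, for one tensor
        factor, turns it into \<open>\<iota> j x \<otimes> m\<close>.\<close>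
      let ?xm = "tmul YM j x m"
      have xm: "?xm \<in> carr (tpow YM (Suc j))"
        using tensor_product.tensor_closed[OF P.tensor_product_tpow[of j]] x ms(3) by simp
      have "R (\<iota> (Suc j) ?xm) = tensor_id M (tower_shift j YM) YinfM (\<iota> j) 1 ?xm"
        by (rule assms(9)[OF xm])
      also have "\<dots> = tmul YinfM 0 (\<iota> j x) m"
        using J.tensor_id_elem[OF x, of "[m]" 1] ms(3) by simp
      finally have Rxm: "R (\<iota> (Suc j) ?xm) = tmul YinfM 0 (\<iota> j x) m" .
      have "elem_tensor (tower_shift j YM) x ms = elem_tensor (tower_shift (Suc j) YM) ?xm ns"
        by (simp add: ms(1) tower_shift_shift)
      moreover have "?F (elem_tensor (tower_shift (Suc j) YM) ?xm ns)
          = elem_tensor (tower_shift 1 YinfM) (R (\<iota> (Suc j) ?xm)) ns"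
        using xm hm_isometry.maps_closed[OF I xm] ms(2,4)
          J'.tensor_id_elem[of ?xm ns k] R.tensor_id_elem[of "\<iota> (Suc j) ?xm" ns k]
        by (simp add: tower_inf(1))
      moreover have "elem_tensor (tower_shift 1 YinfM) (R (\<iota> (Suc j) ?xm)) ns = elem_tensor YinfM (\<iota> j x) ms"
        by (simp add: Rxm ms(1))
      ultimately show "?F (elem_tensor (tower_shift j YM) x ms)
          = tensor_id M (tower_shift j YM) YinfM (\<iota> j) (Suc k) (elem_tensor (tower_shift j YM) x ms)"
        using J.tensor_id_elem[OF x, of ms "Suc k"] ms by simp
    qed
    finally show ?case .
  qed

  \<comment> \<open>Images of the filtration and of its complements under the powers of
    \<open>R\<close>\<close>
  have R_V: "?R k ` V (j + k) = tensor_span M YinfM (V j) k" for j k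
  proof -
    interpret J: tower_isometry M "tower_shift j YM" YinfM "\<iota> j" by (rule I_tower)
    have "?R k ` V (j + k) = tensor_id M (tower_shift j YM) YinfM (\<iota> j) k ` carr (tpow YM (j + k))"
      unfolding V_def image_image using R_iota by (intro image_cong refl)
    then show ?thesis using J.tensor_id_range[of k] by (simp add: V_def)
  qed
  have VX: "V k \<subseteq> carr Yinf" for k using dec.U_carr V_sub by (auto simp: hm_submodule_def additive_subgroup_def)
  have V_grp: "additive_subgroup (tpow YinfM 0) (V k)" for k using V_sub by (simp add: tower_inf(1) hm_submodule_def)
  have W_grp: "additive_subgroup (tpow YinfM 0) (W k)" for k
    using dec.W by (simp add: tower_inf(1) hm_submodule_def)
  have VW: "orthogonal_sets (tpow YinfM 0) (V 0) (W 0)"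
    by (auto simp: orthogonal_sets_def W_def orthogonal_part_def tower_inf(1))
  have V1: "V 1 = set_sum (V 0) (W 0)"
  proof
    show "V 1 \<subseteq> set_sum (V 0) (W 0)"
    proof
      fix v assume v: "v \<in> V 1"
      then obtain a where a: "a \<in> V 0" "\<forall>n\<in>V 0. ip Yinf n (v - a) = 0" using V_compl[of v 0] by auto
      then have "v - a \<in> W 0"
        using v V_mono[of 0] V_grp[of 1] by (auto simp: W_def orthogonal_part_def additive_subgroup_def)
      moreover have "v = a + (v - a)" by simp
      ultimately show "v \<in> set_sum (V 0) (W 0)" using a(1) unfolding set_sum_def by blast
    qed
    show "set_sum (V 0) (W 0) \<subseteq> V 1"
      using V_mono[of 0] additive_subgroup_add[OF V_grp[of 1]]
      by (auto simp: set_sum_def W_def orthogonal_part_def)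
  qed
  \<comment> \<open>The isometry \<open>?R k\<close> takes \<open>V k\<close> onto \<open>?A\<close>
    and \<open>V (Suc k)\<close> onto the orthogonal sum of \<open>?A\<close> and \<open>?B\<close>.
    Orthogonality to \<open>V k\<close> becomes orthogonality to \<open>?A\<close>, and inside that
    sum the part orthogonal to \<open>?A\<close> is \<open>?B\<close>.\<close>
  have R_W: "?R k ` W k = tensor_span M YinfM (W 0) k" for k
  proof -
    interpret Rk: hm_isometry Yinf "tpow YinfM k" "?R k" using R_pow by blast
    let ?A = "tensor_span M YinfM (V 0) k" and ?B = "tensor_span M YinfM (W 0) k"
    have AB: "tensor_span M YinfM (V 1) k = set_sum ?A ?B"
      unfolding V1 by (rule Q.tensor_span_orthogonal_sum[OF V_grp W_grp VW])
    have A: "additive_subgroup (tpow YinfM k) ?A" and B: "additive_subgroup (tpow YinfM k) ?B"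
      by (intro Q.tensor_span_subgroup V_grp W_grp)+
    have orth: "orthogonal_sets (tpow YinfM k) ?A ?B"
      using V_grp W_grp VW by (intro Q.orthogonal_tensor_span) (auto simp: additive_subgroup_def)
    have RV: "?R k ` V (Suc k) = set_sum ?A ?B" "?R k ` V k = ?A"
      using R_V[of k 1] R_V[of k 0] AB by simp_all
    show ?thesis
    proof
      show "?R k ` W k \<subseteq> ?B"
      proof
        fix v assume "v \<in> ?R k ` W k"
        then obtain x where x: "x \<in> V (Suc k)" "\<And>n. n \<in> V k \<Longrightarrow> ip Yinf n x = 0" "v = ?R k x"
          by (auto simp: W_def orthogonal_part_def)
        show "v \<in> ?B"
        proof (rule Rk.Y.orthogonal_part_of_sum[OF A B orth])
          show "v \<in> set_sum ?A ?B" using RV(1) x by blast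
          show "ip (tpow YinfM k) a v = 0" if a: "a \<in> ?A" for a
          proof -
            obtain n where n: "n \<in> V k" "a = ?R k n"
              using a unfolding RV(2)[symmetric] by blast
            have "n \<in> carr Yinf" "x \<in> carr Yinf" using n(1) x(1) VX by blast+
            then show ?thesis using Rk.ip_image[of n x] x(2)[OF n(1)] by (simp add: n(2) x(3))
          qed
        qed
      qed
      show "?B \<subseteq> ?R k ` W k"
      proof
        fix v assume v: "v \<in> ?B"
        have "v = 0 + v" "0 \<in> ?A" using A by (simp_all add: additive_subgroup_def)
        then have "v \<in> set_sum ?A ?B" using v unfolding set_sum_def by blast
        then obtain x where x: "x \<in> V (Suc k)" "v = ?R k x" unfolding RV(1)[symmetric] by blast
        have "ip Yinf n x = 0" if n: "n \<in> V k" for n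
        proof -
          have "?R k n \<in> ?A" using RV(2) n by blast
          then have "ip (tpow YinfM k) (?R k n) v = 0" using orth v by (simp add: orthogonal_sets_def)
          moreover have "n \<in> carr Yinf" "x \<in> carr Yinf" using n x(1) VX by blast+
          ultimately show ?thesis using Rk.ip_image[of n x] by (simp add: x(2))
        qed
        then have "x \<in> W k" using x(1) by (simp add: W_def orthogonal_part_def)
        then show "v \<in> ?R k ` W k" using x(2) by blast
      qed
    qed
  qed
  have "hm_iso (Z k) (sub_tensor M YinfM (Z 0) k) (?R k)" for k
  proof -
    interpret Rk: hm_isometry Yinf "tpow YinfM k" "?R k" using R_pow by blast
    have carrs: "carr (Z k) = W k" "carr (sub_tensor M YinfM (Z 0) k) = tensor_span M YinfM (W 0) k"
      by (simp_all add: Z carr_sub_tensor) (simp_all add: submod_def)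
    have ips: "ip (Z k) = ip Yinf" "ip (sub_tensor M YinfM (Z 0) k) = ip (tpow YinfM k)"
      by (simp_all add: Z sub_tensor_def submod_def)
    have "ip_preserving (Z k) (sub_tensor M YinfM (Z 0) k) (?R k)"
      using R_W[of k] by (auto simp: ip_preserving_def carrs ips Rk.ip_image dec.W_carr)
    then show ?thesis using R_W[of k] by (simp add: hm_iso_def carrs)
  qed
  moreover have "hm_iso Yinf (tpow YinfM k) (?R k)" for k
    using R_pow hm_isometry.isometric unfolding hm_iso_def by blast
  ultimately show ?thesis
    using dec.direct_sum_isomorphism by (simp add: Yk Z_eq)
qed

end
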